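(* Let $G$ be a compact Lie group and let $\Gamma\le G$ be a dense finitely generated subgroup, considered as a discrete group acting on $G$ by left translation. Suppose that the warped cone $\mathcal{O}_\Gamma(G)$ is uniformly embeddable in Hilbert space. Then $\Gamma$ has the Haagerup property. In particular, if $\Gamma$ has property T, then $\mathcal{O}_\Gamma(G)$ cannot be uniformly embedded in Hilbert space.
   Context: Open cone: for a compact smooth manifold $Y$, embed $Y$ smoothly in a sphere $S^{N-1}\subset\mathbb{R}^N$; the open cone is $\mathcal{O}Y=\{ty: t\ge 0,\ y\in Y\}\subset\mathbb{R}^N$ with the metric $d$ induced from $\mathbb{R}^N$. Up to coarse equivalence it does not depend on choices. If $\Gamma$ acts on $Y$ by homeomorphisms, it acts on $\mathcal{O}Y$ by $\gamma(ty)=t(\gamma y)$. Warped metric: if $(X,d)$ is a proper metric space (closed bounded sets are compact) on which a group $\Gamma$ with finite generating set $S$ acts by homeomorphisms, then $d_\Gamma$ is the greatest metric on $X$ with $d_\Gamma(x,x')\le d(x,x')$ for all $x,x'\in X$ and $d_\Gamma(x,sx)\le 1$ for all $x\in X$, $s\in S$. The warped cone $\mathcal{O}_\Gamma(Y)$ is $\mathcal{O}Y$ with the metric $d_\Gamma$ (its coarse structure does not depend on choices). Uniform embedding: a metric space $(X,d)$ is uniformly (coarsely) embeddable in Hilbert space if there are a map $F\colon X\to H$ to a Hilbert space and nondecreasing unbounded functions $\rho_1,\rho_2\colon\mathbb{R}^+\to\mathbb{R}^+$ with $\rho_1(d(x,x'))\le\|F(x)-F(x')\|\le\rho_2(d(x,x'))$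 for all $x,x'\in X$. Haagerup property: a countable discrete group $\Gamma$ has the Haagerup property if it admits a proper function $h\colon\Gamma\to[0,\infty)$ of (conditionally) negative type. Property T is Kazhdan's property (T) for the discrete group $\Gamma$: every unitary representation of $\Gamma$ that has almost invariant unit vectors has a nonzero invariant vector.
   Formalization: In the "in particular" clause Γ is assumed infinite; for finite G (so Γ = G) the clause is false, since a finite group has property T while its warped cone is coarsely a half-line and embeds in Hilbert space. *)

theory Defs
  imports
    "HOL-Analysis.Analysis"
    "HOL-Algebra.Generated_Groups"
    "HOL-Algebra.Module"
    "HOL-Algebra.Algebraic_Closure_Type"
begin

section \<open>Smooth manifolds and Lie groups\<close>

primrec Ck_on :: "nat \<Rightarrow> 'a::euclidean_space set \<Rightarrow> ('a \<Rightarrow> 'b::euclidean_space) \<Rightarrow> bool" where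
  "Ck_on 0 U f \<longleftrightarrow> continuous_on U f"
| "Ck_on (Suc k) U f \<longleftrightarrow>
     (\<forall>x\<in>U. f differentiable (at x)) \<and>
     (\<forall>v. Ck_on k U (\<lambda>x. frechet_derivative f (at x) v))"

text \<open>Smoothness on a set that need not be open: near each point of the set the map is the
  restriction of a smooth map defined on an open set.  This is needed for sets that are open in
  a proper linear subspace.\<close>

definition smooth_on :: "'a::euclidean_space set \<Rightarrow> ('a \<Rightarrow> 'b::euclidean_space) \<Rightarrow> bool" where
  "smooth_on A f \<longleftrightarrow>
     (\<forall>x\<in>A. \<exists>U g. open U \<and> x \<in> U \<and> (\<forall>k. Ck_on k U g) \<and> (\<forall>y\<in>A \<inter> U. g y = f y))"

type_synonym ('a, 'm) chart = "'a set \<times> ('a \<Rightarrow> 'm)"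

text \<open>The model space is a linear subspace \<open>V\<close> of a Euclidean space, so the dimension of the
  manifold is \<open>dim V\<close>.  A subspace is used because the types of class \<open>euclidean_space\<close> all have
  positive dimension, whereas a manifold (or Lie group) may have dimension 0.\<close>

definition smooth_manifold ::
    "'a topology \<Rightarrow> 'm::euclidean_space set \<Rightarrow> ('a, 'm) chart set \<Rightarrow> bool" where
  "smooth_manifold T V \<A> \<longleftrightarrow>
     Hausdorff_space T \<and> second_countable T \<and> subspace V \<and>
     (\<Union>(U, \<phi>)\<in>\<A>. U) = topspace T \<and>
     (\<forall>(U, \<phi>)\<in>\<A>. openin T U \<and> openin (top_of_set V) (\<phi> ` U) \<and>
        homeomorphic_map (subtopology T U) (top_of_set (\<phi> ` U)) \<phi>) \<and>
     (\<forall>(U, \<phi>)\<in>\<A>. \<forall>(U', \<phi>')\<in>\<A>. smooth_on (\<phi> ` (U \<inter> U')) (\<phi>' \<circ> inv_into U \<phi>))"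

definition smooth_map ::
    "'a topology \<Rightarrow> ('a, 'm::euclidean_space) chart set \<Rightarrow>
     'b topology \<Rightarrow> ('b, 'n::euclidean_space) chart set \<Rightarrow> ('a \<Rightarrow> 'b) \<Rightarrow> bool" where
  "smooth_map T \<A> T' \<A>' f \<longleftrightarrow>
     continuous_map T T' f \<and>
     (\<forall>(U, \<phi>)\<in>\<A>. \<forall>(U', \<phi>')\<in>\<A>'.
        smooth_on (\<phi> ` {x \<in> U. f x \<in> U'}) (\<phi>' \<circ> f \<circ> inv_into U \<phi>))"

definition prod_atlas ::
    "('a, 'm) chart set \<Rightarrow> ('b, 'n) chart set \<Rightarrow> ('a \<times> 'b, 'm \<times> 'n) chart set" where
  "prod_atlas \<A> \<B> = {(U \<times> U', map_prod \<phi> \<phi>') | U \<phi> U' \<phi>'. (U, \<phi>) \<in> \<A> \<and> (U', \<phi>') \<in> \<B>}"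

definition lie_group ::
    "'a monoid \<Rightarrow> 'a topology \<Rightarrow> 'm::euclidean_space set \<Rightarrow> ('a, 'm) chart set \<Rightarrow> bool" where
  "lie_group G T V \<A> \<longleftrightarrow>
     group G \<and> topspace T = carrier G \<and> smooth_manifold T V \<A> \<and>
     smooth_map (prod_topology T T) (prod_atlas \<A> \<A>) T \<A> (\<lambda>(x, y). x \<otimes>\<^bsub>G\<^esub> y) \<and>
     smooth_map T \<A> T \<A> (\<lambda>x. inv\<^bsub>G\<^esub> x)"

definition compact_lie_group ::
    "'a monoid \<Rightarrow> 'a topology \<Rightarrow> 'm::euclidean_space set \<Rightarrow> ('a, 'm) chart set \<Rightarrow> bool" where
  "compact_lie_group G T V \<A> \<longleftrightarrow> lie_group G T V \<A> \<and> compact_space T"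

text \<open>In the immersion condition \<open>\<phi> ` U\<close> is open in \<open>V\<close>, so the restriction of the derivative \<open>D\<close>
  to \<open>V\<close> is uniquely determined: it is the differential of \<open>e\<close> read in the chart.\<close>

definition smooth_embedding ::
    "'a topology \<Rightarrow> 'm::euclidean_space set \<Rightarrow> ('a, 'm) chart set \<Rightarrow> ('a \<Rightarrow> 'e::euclidean_space) \<Rightarrow> bool"
  where
  "smooth_embedding T V \<A> e \<longleftrightarrow>
     smooth_map T \<A> euclidean {(UNIV, id)} e \<and>
     (\<forall>(U, \<phi>)\<in>\<A>. \<forall>x\<in>U. \<exists>D.
        ((e \<circ> inv_into U \<phi>) has_derivative D) (at (\<phi> x) within \<phi> ` U) \<and> inj_on D V) \<and>
     embedding_map T euclidean e"


section \<open>Warped cones\<close>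

definition open_cone :: "('a \<Rightarrow> 'e::euclidean_space) \<Rightarrow> 'a set \<Rightarrow> 'e set" where
  "open_cone e Y = {t *\<^sub>R e y | t y. 0 \<le> t \<and> y \<in> Y}"

definition cone_act ::
    "('a \<Rightarrow> 'e::euclidean_space) \<Rightarrow> 'a set \<Rightarrow> ('s \<Rightarrow> 'a \<Rightarrow> 'a) \<Rightarrow> 's \<Rightarrow> 'e \<Rightarrow> 'e" where
  "cone_act e Y act s z = (THE w. \<exists>t\<ge>0. \<exists>y\<in>Y. z = t *\<^sub>R e y \<and> w = t *\<^sub>R e (act s y))"

lemma cone_act_eq:
  assumes "e ` Y \<subseteq> sphere 0 1" "inj_on e Y" "0 \<le> t" "y \<in> Y"
  shows "cone_act e Y act s (t *\<^sub>R e y) = t *\<^sub>R e (act s y)"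
  unfolding cone_act_def
proof (rule the_equality)
  show "\<exists>t'\<ge>0. \<exists>y'\<in>Y. t *\<^sub>R e y = t' *\<^sub>R e y' \<and> t *\<^sub>R e (act s y) = t' *\<^sub>R e (act s y')"
    using assms by blast
next
  fix w
  assume "\<exists>t'\<ge>0. \<exists>y'\<in>Y. t *\<^sub>R e y = t' *\<^sub>R e y' \<and> w = t' *\<^sub>R e (act s y')"
  then obtain t' y' where h: "0 \<le> t'" "y' \<in> Y" "t *\<^sub>R e y = t' *\<^sub>R e y'"
    "w = t' *\<^sub>R e (act s y')" by blast
  have n: "norm (e y) = 1" "norm (e y') = 1"
    using assms h by (auto simp: image_subset_iff)
  have "norm (t *\<^sub>R e y) = norm (t' *\<^sub>R e y')"
    using h(3) by simp
  then have "t = t'"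
    using n h(1) assms(3) by simp
  moreover have "y = y'" if "t \<noteq> 0"
  proof -
    have "e y = e y'" using h(3) that \<open>t = t'\<close> by simp
    then show ?thesis using assms h(2) by (simp add: inj_on_eq_iff)
  qed
  ultimately show "w = t *\<^sub>R e (act s y)"
    using h(4) by (cases "t = 0") auto
qed

definition warped_admissible ::
    "'x set \<Rightarrow> ('x \<Rightarrow> 'x \<Rightarrow> real) \<Rightarrow> ('s \<Rightarrow> 'x \<Rightarrow> 'x) \<Rightarrow> 's set \<Rightarrow> ('x \<Rightarrow> 'x \<Rightarrow> real) \<Rightarrow> bool" where
  "warped_admissible E d act S \<delta> \<longleftrightarrow>
     Metric_space E \<delta> \<and>
     (\<forall>x\<in>E. \<forall>x'\<in>E. \<delta> x x' \<le> d x x') \<and>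
     (\<forall>x\<in>E. \<forall>s\<in>S. \<delta> x (act s x) \<le> 1)"

text \<open>The greatest admissible metric.  The value 0 off \<open>E\<close> is only there because \<open>Metric_space\<close>
  requires nonnegativity and symmetry on the whole type.\<close>

definition warped_dist ::
    "'x set \<Rightarrow> ('x \<Rightarrow> 'x \<Rightarrow> real) \<Rightarrow> ('s \<Rightarrow> 'x \<Rightarrow> 'x) \<Rightarrow> 's set \<Rightarrow> 'x \<Rightarrow> 'x \<Rightarrow> real" where
  "warped_dist E d act S x x' =
     (if x \<in> E \<and> x' \<in> E then SUP \<delta>\<in>{\<delta>. warped_admissible E d act S \<delta>}. \<delta> x x' else 0)"

lemma warped_dist_greatest:
  assumes "warped_admissible E d act S \<delta>" "x \<in> E" "x' \<in> E"
  shows "\<delta> x x' \<le> warped_dist E d act S x x'"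
proof -
  have "bdd_above ((\<lambda>\<delta>. \<delta> x x') ` {\<delta>. warped_admissible E d act S \<delta>})"
    using assms(2,3) by (auto simp: bdd_above_def warped_admissible_def)
  then show ?thesis
    using assms by (auto simp: warped_dist_def intro!: cSUP_upper2)
qed

lemma warped_admissible_warped_dist:
  assumes "Metric_space E d" and act: "\<And>x s. x \<in> E \<Longrightarrow> s \<in> S \<Longrightarrow> act s x \<in> E"
  shows "warped_admissible E d act S (warped_dist E d act S)"
proof -
  interpret Metric_space E d by fact
  define \<D> where "\<D> = {\<delta>. warped_admissible E d act S \<delta>}"
  let ?w = "warped_dist E d act S"
  define b where "b = (\<lambda>x y. min (d x y) 1)"
  have "Metric_space E b"
  proof
    show "0 \<le> b x y" "b x y = b y x" for x y
      by (auto simp: b_def commute)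
    show "b x y = 0 \<longleftrightarrow> x = y" if "x \<in> E" "y \<in> E" for x y
      using that zero[of x y] by (auto simp: b_def min_def)
    show "b x z \<le> b x y + b y z" if "x \<in> E" "y \<in> E" "z \<in> E" for x y z
      using triangle[OF that] nonneg[of x y] nonneg[of y z] unfolding b_def by linarith
  qed
  then have b: "b \<in> \<D>"
    by (auto simp: \<D>_def warped_admissible_def b_def)
  have upper: "\<delta> x y \<le> ?w x y" if "\<delta> \<in> \<D>" "x \<in> E" "y \<in> E" for \<delta> x y
    using warped_dist_greatest that by (auto simp: \<D>_def)
  have least: "?w x y \<le> c" if "x \<in> E" "y \<in> E" "\<And>\<delta>. \<delta> \<in> \<D> \<Longrightarrow> \<delta> x y \<le> c" for x y c
    using that b unfolding warped_dist_def \<D>_def[symmetric] by (auto intro!: cSUP_least)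
  have D: "Metric_space E \<delta>" "\<And>x y. x \<in> E \<Longrightarrow> y \<in> E \<Longrightarrow> \<delta> x y \<le> d x y"
    "\<And>x s. x \<in> E \<Longrightarrow> s \<in> S \<Longrightarrow> \<delta> x (act s x) \<le> 1" if "\<delta> \<in> \<D>" for \<delta>
    using that by (auto simp: \<D>_def warped_admissible_def)
  have "Metric_space E ?w"
  proof
    show nn: "0 \<le> ?w x y" for x y
    proof (cases "x \<in> E \<and> y \<in> E")
      case True
      then have "b x y \<le> ?w x y" using upper[OF b] by blast
      then show ?thesis using nonneg[of x y] unfolding b_def by linarith
    qed (auto simp: warped_dist_def)
    show "?w x y = ?w y x" for x y
    proof -
      have "(\<lambda>\<delta>. \<delta> x y) ` \<D> = (\<lambda>\<delta>. \<delta> y x) ` \<D>"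
        by (intro image_cong refl) (simp add: Metric_space.commute[OF D(1)])
      then show ?thesis by (simp add: warped_dist_def \<D>_def[symmetric] conj_commute)
    qed
    show "?w x y = 0 \<longleftrightarrow> x = y" if xy: "x \<in> E" "y \<in> E" for x y
    proof
      assume "?w x y = 0"
      then have "b x y \<le> 0" using upper[OF b xy] by simp
      then show "x = y" using xy \<open>Metric_space E b\<close>
        by (metis Metric_space.nonneg Metric_space.zero order_antisym)
    next
      assume "x = y"
      then have "?w x y \<le> 0"
        using xy by (intro least) (auto simp: Metric_space.mdist_zero[OF D(1)])
      then show "?w x y = 0" using nn[of x y] by simp
    qed
    show "?w x z \<le> ?w x y + ?w y z" if "x \<in> E" "y \<in> E" "z \<in> E" for x y z
    proof (rule least)
      fix \<delta> assume \<delta>: "\<delta> \<in> \<D>"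
      have "\<delta> x z \<le> \<delta> x y + \<delta> y z"
        by (rule Metric_space.triangle[OF D(1)[OF \<delta>] that])
      then show "\<delta> x z \<le> ?w x y + ?w y z"
        using upper[OF \<delta> that(1,2)] upper[OF \<delta> that(2,3)] by simp
    qed (use that in auto)
  qed
  then show ?thesis
    unfolding warped_admissible_def using act D by (auto intro!: least)
qed

text \<open>The metric of the warped cone of \<open>G\<close>, embedded by \<open>e\<close>, with respect to left translation by
  the group generated by \<open>S\<close>.\<close>

definition warped_cone_dist ::
    "'a monoid \<Rightarrow> ('a \<Rightarrow> 'e::euclidean_space) \<Rightarrow> 'a set \<Rightarrow> 'e \<Rightarrow> 'e \<Rightarrow> real" where
  "warped_cone_dist G e S =
     warped_dist (open_cone e (carrier G)) dist
       (cone_act e (carrier G) (\<lambda>\<gamma> x. \<gamma> \<otimes>\<^bsub>G\<^esub> x)) S"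


section \<open>Uniform embeddability in Hilbert space\<close>

text \<open>The control functions are functions on \<open>[0, \<infinity>)\<close>; their values at negative reals are irrelevant.\<close>

definition control_function :: "(real \<Rightarrow> real) \<Rightarrow> bool" where
  "control_function \<rho> \<longleftrightarrow>
     mono_on {0..} \<rho> \<and> (\<forall>t\<ge>0. 0 \<le> \<rho> t) \<and> \<not> bdd_above (\<rho> ` {0..})"

text \<open>Hilbert spaces are the types of class \<open>{real_inner, complete_space}\<close>; a complex Hilbert space
  is one of these with the real part of its inner product, which has the same norm.\<close>

definition uniformly_embeddable ::
    "'h::{real_inner, complete_space} itself \<Rightarrow> 'x set \<Rightarrow> ('x \<Rightarrow> 'x \<Rightarrow> real) \<Rightarrow> bool" where
  "uniformly_embeddable _ E d \<longleftrightarrow>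
     (\<exists>(F :: 'x \<Rightarrow> 'h) \<rho>\<^sub>1 \<rho>\<^sub>2. control_function \<rho>\<^sub>1 \<and> control_function \<rho>\<^sub>2 \<and>
        (\<forall>x\<in>E. \<forall>x'\<in>E. \<rho>\<^sub>1 (d x x') \<le> norm (F x - F x') \<and> norm (F x - F x') \<le> \<rho>\<^sub>2 (d x x')))"


section \<open>The Haagerup property\<close>

definition conditionally_negative_type :: "'a monoid \<Rightarrow> ('a \<Rightarrow> real) \<Rightarrow> bool" where
  "conditionally_negative_type \<Gamma> h \<longleftrightarrow>
     h \<one>\<^bsub>\<Gamma>\<^esub> = 0 \<and>
     (\<forall>g\<in>carrier \<Gamma>. h (inv\<^bsub>\<Gamma>\<^esub> g) = h g) \<and>
     (\<forall>F c. finite F \<and> F \<subseteq> carrier \<Gamma> \<and> (\<Sum>x\<in>F. c x) = (0::real) \<longrightarrow>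
        (\<Sum>x\<in>F. \<Sum>y\<in>F. c x * c y * h (inv\<^bsub>\<Gamma>\<^esub> x \<otimes>\<^bsub>\<Gamma>\<^esub> y)) \<le> 0)"

definition haagerup_property :: "'a monoid \<Rightarrow> bool" where
  "haagerup_property \<Gamma> \<longleftrightarrow>
     (\<exists>h. (\<forall>g\<in>carrier \<Gamma>. 0 \<le> h g) \<and> conditionally_negative_type \<Gamma> h \<and>
        (\<forall>R. finite {g \<in> carrier \<Gamma>. h g \<le> R}))"


section \<open>Property T\<close>

definition ip_norm :: "('v \<Rightarrow> 'v \<Rightarrow> complex) \<Rightarrow> 'v \<Rightarrow> real" where
  "ip_norm ip x = sqrt (Re (ip x x))"

text \<open>Complex Hilbert spaces with an explicit carrier, so that one can quantify over them.
  The fields \<open>mult\<close> and \<open>one\<close> that the record type \<open>module\<close> inherits from rings play no role.\<close>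

definition complex_hilbert_space ::
    "(complex, 'v) module \<Rightarrow> ('v \<Rightarrow> 'v \<Rightarrow> complex) \<Rightarrow> bool" where
  "complex_hilbert_space M ip \<longleftrightarrow>
     module ring_of_type_algebra M \<and>
     (\<forall>x\<in>carrier M. \<forall>y\<in>carrier M. \<forall>z\<in>carrier M. ip (x \<oplus>\<^bsub>M\<^esub> y) z = ip x z + ip y z) \<and>
     (\<forall>a. \<forall>x\<in>carrier M. \<forall>y\<in>carrier M. ip (a \<odot>\<^bsub>M\<^esub> x) y = a * ip x y) \<and>
     (\<forall>x\<in>carrier M. \<forall>y\<in>carrier M. ip y x = cnj (ip x y)) \<and>
     (\<forall>x\<in>carrier M. x \<noteq> \<zero>\<^bsub>M\<^esub> \<longrightarrow> 0 < Re (ip x x)) \<and>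
     (\<forall>f::nat \<Rightarrow> 'v. range f \<subseteq> carrier M \<and>
        (\<forall>\<epsilon>>0. \<exists>N. \<forall>m\<ge>N. \<forall>n\<ge>N. ip_norm ip (f m \<ominus>\<^bsub>M\<^esub> f n) < \<epsilon>) \<longrightarrow>
        (\<exists>l\<in>carrier M. (\<lambda>n. ip_norm ip (f n \<ominus>\<^bsub>M\<^esub> l)) \<longlonglongrightarrow> 0))"

definition unitary_operator ::
    "(complex, 'v) module \<Rightarrow> ('v \<Rightarrow> 'v \<Rightarrow> complex) \<Rightarrow> ('v \<Rightarrow> 'v) \<Rightarrow> bool" where
  "unitary_operator M ip u \<longleftrightarrow>
     bij_betw u (carrier M) (carrier M) \<and>
     (\<forall>x\<in>carrier M. \<forall>y\<in>carrier M. u (x \<oplus>\<^bsub>M\<^esub> y) = u x \<oplus>\<^bsub>M\<^esub> u y) \<and>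
     (\<forall>a. \<forall>x\<in>carrier M. u (a \<odot>\<^bsub>M\<^esub> x) = a \<odot>\<^bsub>M\<^esub> u x) \<and>
     (\<forall>x\<in>carrier M. \<forall>y\<in>carrier M. ip (u x) (u y) = ip x y)"

definition unitary_representation ::
    "'a monoid \<Rightarrow> (complex, 'v) module \<Rightarrow> ('v \<Rightarrow> 'v \<Rightarrow> complex) \<Rightarrow> ('a \<Rightarrow> 'v \<Rightarrow> 'v) \<Rightarrow> bool" where
  "unitary_representation \<Gamma> M ip \<pi> \<longleftrightarrow>
     complex_hilbert_space M ip \<and>
     (\<forall>g\<in>carrier \<Gamma>. unitary_operator M ip (\<pi> g)) \<and>
     (\<forall>v\<in>carrier M. \<pi> \<one>\<^bsub>\<Gamma>\<^esub> v = v) \<and>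
     (\<forall>g\<in>carrier \<Gamma>. \<forall>h\<in>carrier \<Gamma>. \<forall>v\<in>carrier M. \<pi> (g \<otimes>\<^bsub>\<Gamma>\<^esub> h) v = \<pi> g (\<pi> h v))"

definition almost_invariant_unit_vectors ::
    "'a monoid \<Rightarrow> (complex, 'v) module \<Rightarrow> ('v \<Rightarrow> 'v \<Rightarrow> complex) \<Rightarrow> ('a \<Rightarrow> 'v \<Rightarrow> 'v) \<Rightarrow> bool" where
  "almost_invariant_unit_vectors \<Gamma> M ip \<pi> \<longleftrightarrow>
     (\<forall>Q \<epsilon>. finite Q \<and> Q \<subseteq> carrier \<Gamma> \<and> 0 < \<epsilon> \<longrightarrow>
        (\<exists>v\<in>carrier M. ip_norm ip v = 1 \<and> (\<forall>g\<in>Q. ip_norm ip (\<pi> g v \<ominus>\<^bsub>M\<^esub> v) < \<epsilon>)))"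

text \<open>HOL cannot quantify over all Hilbert spaces of all types, so the underlying sets are taken
  inside the type \<open>nat \<Rightarrow> complex\<close>, which has the cardinality of the continuum.  For a countable
  group \<open>\<Gamma>\<close> this loses nothing: if \<open>\<pi>\<close> has almost invariant unit vectors, so has its restriction to
  the closed span of the \<open>\<Gamma>\<close>-orbits of countably many suitable unit vectors, and this is a separable
  Hilbert space and therefore isometrically isomorphic to one with carrier in \<open>nat \<Rightarrow> complex\<close>.\<close>

definition property_T :: "'a monoid \<Rightarrow> bool" where
  "property_T \<Gamma> \<longleftrightarrow>
     (\<forall>(M :: (complex, nat \<Rightarrow> complex) module) ip \<pi>.
        unitary_representation \<Gamma> M ip \<pi> \<and> almost_invariant_unit_vectors \<Gamma> M ip \<pi> \<longrightarrow>
        (\<exists>v\<in>carrier M. v \<noteq> \<zero>\<^bsub>M\<^esub> \<and> (\<forall>g\<in>carrier \<Gamma>. \<pi> g v = v)))"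

end

theory Submission
  imports Defs "HOL-Computational_Algebra.Polynomial"
begin

text \<open>Let \<open>F\<close> be a uniform embedding of the warped cone. At every scale \<open>t\<close>, the mean over \<open>x\<close> of
  \<open>\<parallel>F (t \<gamma> x) - F (t x)\<parallel>\<^sup>2\<close> with respect to a translation-invariant mean on \<open>G\<close> is a conditionally
  negative function \<open>h\<^sub>t\<close> of \<open>\<gamma>\<close>; for the mean to make sense, \<open>F\<close> is first replaced by a function at
  bounded distance that is continuous on \<open>tG\<close>. The points \<open>t \<gamma> x\<close> and \<open>t x\<close> are joined by a number of
  moves depending only on \<open>\<gamma>\<close>, so \<open>h\<^sub>t \<gamma>\<close> is bounded uniformly in \<open>t\<close>. As \<open>t\<close> grows, jumps of bounded
  length become useless: if \<open>\<gamma>\<close> is not a word of length at most \<open>N\<close>, compactness of \<open>G\<close> and freeness of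
  left translation give \<open>d\<^sub>\<Gamma> (t \<gamma> x) (t x) \<ge> N\<close> for all \<open>x\<close> once \<open>t\<close> is large. Hence a pointwise cluster
  point of the \<open>h\<^sub>t\<close> is proper.

  No Haar measure is needed: averages over minimal \<open>\<epsilon>\<close>-nets for a left-invariant metric are almost
  invariant, because Hall's theorem matches a minimal net with each of its translates by moving points
  less than \<open>2\<epsilon>\<close>.

  An infinite group with a proper conditionally negative function \<open>h\<close> fails property T: by Schoenberg's
  theorem the functions \<open>exp (- h / m)\<close> are positive definite, and the direct sum of the associated
  representations, realised on a space of functions on \<open>\<Gamma> \<times> \<nat>\<close>, has almost invariant unit vectors
  while its matrix coefficients tend to 0 at infinity.\<close>

section \<open>Invariant means on totally bounded spaces\<close>

text \<open>Nothing makes the net averages of a given function converge, and a diagonal subsequence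
  would need a countable family of functions. Limits are therefore taken at a cluster point in a
  product of intervals, for all indices at once; the same device serves the averages and the
  functions h_t. Minimal nets dictate the metric: a translate of a minimal net has to be a minimal
  net again, so translations must be isometries, which the Euclidean distance of embedded points
  does not guarantee. The obstacle on the side of property T is the type: \<open>property_T\<close>
  tests only spaces with carrier in \<open>nat \<Rightarrow> complex\<close>. A reproducing kernel
  space consists of functions on its index set, so an enumeration of \<Gamma> \<times> \<nat> puts
  it there without an orthonormal basis. For a single m the displacement of the generating vector is
  a fixed function of g, so almost invariance needs all m in one space. A finite group has both
  properties, hence the contradiction exists only for infinite \<Gamma>.\<close>

lemma pointwise_convergent_subfilter:
  fixes A :: "nat \<Rightarrow> 'b \<Rightarrow> real"
  assumes bounded: "\<And>n f. \<bar>A n f\<bar> \<le> b f"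
  obtains U L where "U \<noteq> bot" "U \<le> sequentially" "\<And>f. ((\<lambda>n. A n f) \<longlongrightarrow> L f) U"
proof -
  \<comment> \<open>Tychonoff: every \<open>A n\<close> lies in a product of compact intervals, so
    the sequence has a cluster point L there.\<close>
  have "compactin (product_topology (\<lambda>_. euclidean) UNIV) (PiE UNIV (\<lambda>f. {- b f .. b f}))"
    by (simp add: compactin_PiE)
  then have "compact (PiE UNIV (\<lambda>f. {- b f .. b f}))" (is "compact ?P")
    by (simp add: euclidean_product_topology)
  moreover have "eventually (\<lambda>a. a \<in> ?P) (filtermap A sequentially)"
    using bounded by (auto simp: eventually_filtermap PiE_def Pi_def abs_le_iff minus_le_iff)
  moreover have "filtermap A sequentially \<noteq> bot"
    by (simp add: filtermap_bot_iff)
  ultimately obtain L where L: "inf (nhds L) (filtermap A sequentially) \<noteq> bot"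
    unfolding compact_filter by blast
  \<comment> \<open>The filter of indices at which A is near L. It is proper because L is a cluster
    point, and lying below \<open>sequentially\<close> it retains every statement that holds for all
    large n.\<close>
  define U where "U = inf (filtercomap A (nhds L)) sequentially"
  have "U \<noteq> bot"
  proof
    assume "U = bot"
    then have "eventually (\<lambda>_. False) U" by simp
    then obtain P Q where P: "eventually P (nhds L)" and Q: "eventually Q sequentially"
      and PQ: "\<And>n. P (A n) \<Longrightarrow> Q n \<Longrightarrow> False"
      unfolding U_def eventually_inf eventually_filtercomap by metis
    have "eventually (\<lambda>a. \<not> P a) (filtermap A sequentially)"
      unfolding eventually_filtermap by (rule eventually_mono[OF Q]) (use PQ in blast)
    with P have "eventually (\<lambda>_. False) (inf (nhds L) (filtermap A sequentially))"
      unfolding eventually_inf by (intro exI[of _ P] exI[of _ "\<lambda>a. \<not> P a"]) simp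
    with L show False by simp
  qed
  moreover have "U \<le> sequentially" by (simp add: U_def)
  moreover have "((\<lambda>n. A n f) \<longlongrightarrow> L f) U" for f
  proof -
    have "filterlim A (nhds L) U"
      unfolding U_def by (simp add: filterlim_iff_le_filtercomap)
    moreover have "continuous_on UNIV (\<lambda>a::'b \<Rightarrow> real. a f)"
      by (rule continuous_on_product_coordinates)
    ultimately show ?thesis
      using continuous_on_tendsto_compose[of UNIV "\<lambda>a::'b \<Rightarrow> real. a f" A L U] by simp
  qed
  ultimately show ?thesis using that by blast
qed

text \<open>Induction after Halmos and Vaughan. If a nonempty proper J has exactly
  \<open>card J\<close> neighbours, J and its complement are matched separately, the latter without
  the neighbours of J. Otherwise every such set has a neighbour to spare, and any single pair may be
  fixed.\<close>

theorem Hall_marriage: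
  assumes "finite I" "\<And>i. i \<in> I \<Longrightarrow> finite (N i)"
    "\<And>J. J \<subseteq> I \<Longrightarrow> card J \<le> card (\<Union>(N ` J))"
  shows "\<exists>m. inj_on m I \<and> (\<forall>i\<in>I. m i \<in> N i)"
  using assms
proof (induction "card I" arbitrary: I N rule: less_induct)
  case less
  note fin = less.prems(1) and finN = less.prems(2) and hall = less.prems(3)
  have finU: "finite (\<Union>(N ` J))" if "J \<subseteq> I" for J
    using that fin finN by (meson finite_UN_I finite_subset subsetD)
  consider (empty) "I = {}"
    | (tight) J where "J \<noteq> {}" "J \<subset> I" "card (\<Union>(N ` J)) = card J"
    | (slack) "I \<noteq> {}" "\<And>J. J \<noteq> {} \<Longrightarrow> J \<subset> I \<Longrightarrow> card J < card (\<Union>(N ` J))"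
    using hall by (metis le_neq_implies_less psubset_imp_subset)
  then show ?case
  proof cases
    case empty
    then show ?thesis by simp
  next
    case tight
    have finJ: "finite J" and JI: "J \<subseteq> I" using tight fin finite_subset by auto
    have "card J < card I" using tight fin psubset_card_mono by blast
    moreover have "finite (N i)" if "i \<in> J" for i using that JI finN by blast
    moreover have "card A \<le> card (\<Union>(N ` A))" if "A \<subseteq> J" for A
      using that JI by (intro hall) blast
    ultimately obtain m where m: "inj_on m J" "\<forall>i\<in>J. m i \<in> N i"
      using less.hyps[of J N] finJ by blast
    let ?U = "\<Union>(N ` J)"
    have "card (I - J) < card I"
      using tight fin by (intro psubset_card_mono) auto
    moreover have "finite (I - J)" using fin by simp
    moreover have "card A \<le> card (\<Union>((\<lambda>i. N i - ?U) ` A))" if A: "A \<subseteq> I - J" for A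
    proof -
      have finA: "finite A" using A fin by (meson finite_Diff finite_subset)
      have "card A + card J = card (A \<union> J)"
        using A finA finJ by (subst card_Un_disjoint) auto
      also have "\<dots> \<le> card (\<Union>(N ` (A \<union> J)))" using A JI by (intro hall) auto
      also have "\<Union>(N ` (A \<union> J)) = \<Union>((\<lambda>i. N i - ?U) ` A) \<union> ?U" by auto
      also have "card \<dots> \<le> card (\<Union>((\<lambda>i. N i - ?U) ` A)) + card ?U" by (rule card_Un_le)
      finally show ?thesis using tight by simp
    qed
    ultimately obtain m' where m': "inj_on m' (I - J)" "\<forall>i\<in>I - J. m' i \<in> N i - ?U"
      using less.hyps[of "I - J" "\<lambda>i. N i - ?U"] finN by (auto simp: finite_Diff)
    let ?m = "\<lambda>i. if i \<in> J then m i else m' i"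
    have "inj_on ?m I"
    proof (rule inj_onI)
      fix x y assume "x \<in> I" "y \<in> I" "?m x = ?m y"
      moreover have "m i \<noteq> m' j" "m' j \<noteq> m i" if "i \<in> J" "j \<in> I" "j \<notin> J" for i j
        using that bspec[OF m(2), of i] bspec[OF m'(2), of j] by auto
      ultimately show "x = y"
        using m(1) m'(1) by (cases "x \<in> J"; cases "y \<in> J") (auto dest: inj_onD)
    qed
    moreover have "\<forall>i\<in>I. ?m i \<in> N i" using m m' by auto
    ultimately show ?thesis by blast
  next
    case slack
    then obtain i where i: "i \<in> I" by blast
    have "card {i} \<le> card (N i)" using hall[of "{i}"] i by simp
    then have "N i \<noteq> {}" by auto
    then obtain y where y: "y \<in> N i" by blast
    have "card (I - {i}) < card I" using i fin by (meson card_Diff1_less)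
    moreover have "card A \<le> card (\<Union>((\<lambda>j. N j - {y}) ` A))" if A: "A \<subseteq> I - {i}" for A
    proof (cases "A = {}")
      case False
      then have "card A < card (\<Union>(N ` A))" using A i by (intro slack) auto
      moreover have "\<Union>((\<lambda>j. N j - {y}) ` A) = \<Union>(N ` A) - {y}" by auto
      moreover have "finite (\<Union>(N ` A))" using A by (intro finU) auto
      ultimately show ?thesis by (simp add: card_Diff_singleton_if) linarith
    qed simp
    ultimately obtain m where m: "inj_on m (I - {i})" "\<forall>j\<in>I - {i}. m j \<in> N j - {y}"
      using less.hyps[of "I - {i}" "\<lambda>j. N j - {y}"] finN fin by (auto simp: finite_Diff)
    have "inj_on (m(i := y)) I"
      using m by (auto simp: inj_on_def)
    moreover have "\<forall>j\<in>I. (m(i := y)) j \<in> N j" using m y by auto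
    ultimately show ?thesis by blast
  qed
qed

section \<open>Minimal nets in a totally bounded pseudometric space\<close>

locale totally_bounded_pseudometric =
  fixes M :: "'a set" and d :: "'a \<Rightarrow> 'a \<Rightarrow> real"
  assumes nonempty: "M \<noteq> {}"
    and refl: "x \<in> M \<Longrightarrow> d x x = 0"
    and sym: "d x y = d y x"
    and triangle: "x \<in> M \<Longrightarrow> y \<in> M \<Longrightarrow> z \<in> M \<Longrightarrow> d x z \<le> d x y + d y z"
    and totally_bounded: "0 < \<epsilon> \<Longrightarrow> \<exists>N. finite N \<and> N \<subseteq> M \<and> (\<forall>x\<in>M. \<exists>y\<in>N. d x y < \<epsilon>)"
begin

definition net :: "real \<Rightarrow> 'a set \<Rightarrow> bool" where
  "net \<epsilon> N \<longleftrightarrow> finite N \<and> N \<subseteq> M \<and> (\<forall>x\<in>M. \<exists>y\<in>N. d x y < \<epsilon>)"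

definition minimal_net :: "real \<Rightarrow> 'a set" where
  "minimal_net \<epsilon> = (ARG_MIN card N. net \<epsilon> N)"

lemma minimal_net:
  assumes "0 < \<epsilon>"
  shows "net \<epsilon> (minimal_net \<epsilon>)" "net \<epsilon> N \<Longrightarrow> card (minimal_net \<epsilon>) \<le> card N"
proof -
  obtain N0 where N0: "net \<epsilon> N0" using totally_bounded[OF assms] unfolding net_def by blast
  show "net \<epsilon> (minimal_net \<epsilon>)" unfolding minimal_net_def by (rule arg_min_natI) (rule N0)
  show "net \<epsilon> N \<Longrightarrow> card (minimal_net \<epsilon>) \<le> card N"
    unfolding minimal_net_def by (rule arg_min_nat_le)
qed

lemma net_not_empty: "net \<epsilon> N \<Longrightarrow> N \<noteq> {}"
  using nonempty unfolding net_def by blast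

text \<open>Hall's condition holds because a set of points of a minimal net with too few neighbours in the
  other net could be exchanged for these neighbours.\<close>

lemma minimal_nets_matched:
  assumes \<epsilon>: "0 < \<epsilon>" and N: "net \<epsilon> N" and N': "net \<epsilon> N'" and card: "card N' = card N"
    and min: "\<And>K. net \<epsilon> K \<Longrightarrow> card N \<le> card K"
  obtains m where "bij_betw m N N'" "\<And>x. x \<in> N \<Longrightarrow> d x (m x) < 2 * \<epsilon>"
proof -
  let ?B = "\<lambda>x. {y \<in> N'. d x y < 2 * \<epsilon>}"
  have fin: "finite N" "finite N'" and sub: "N \<subseteq> M" "N' \<subseteq> M" using N N' unfolding net_def by auto
  have "card A \<le> card (\<Union>(?B ` A))" if A: "A \<subseteq> N" for A
  proof -
    let ?K = "(N - A) \<union> \<Union>(?B ` A)"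
    have finA: "finite A" using A fin finite_subset by blast
    have finB: "finite (\<Union>(?B ` A))" by (rule finite_subset[OF _ fin(2)]) auto
    have "net \<epsilon> ?K"
      unfolding net_def
    proof (intro conjI ballI)
      show "finite ?K" using fin finB by simp
      show "?K \<subseteq> M" using sub by auto
      fix x assume x: "x \<in> M"
      obtain y where y: "y \<in> N" "d x y < \<epsilon>" using N x unfolding net_def by blast
      obtain y' where y': "y' \<in> N'" "d x y' < \<epsilon>" using N' x unfolding net_def by blast
      \<comment> \<open>A point x has \<epsilon>-close points in both nets, which are then within 2
        * \<epsilon> of each other: if y was discarded, y' was taken in as its neighbour. This fixes
        the radius of the matching.\<close>
      have "d y y' \<le> d y x + d x y'" using x y y' sub by (intro triangle) auto
      then have "d y y' < 2 * \<epsilon>" using y y' sym[of y x] by linarith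
      then show "\<exists>z\<in>?K. d x z < \<epsilon>" using y y' by (cases "y \<in> A") auto
    qed
    then have "card N \<le> card ?K" by (rule min)
    also have "\<dots> \<le> card (N - A) + card (\<Union>(?B ` A))" by (rule card_Un_le)
    also have "card (N - A) = card N - card A" using A finA by (simp add: card_Diff_subset)
    finally show ?thesis using card_mono[OF fin(1) A] by linarith
  qed
  then obtain m where m: "inj_on m N" "\<forall>x\<in>N. m x \<in> ?B x"
    using Hall_marriage[of N ?B] fin by auto
  have "m ` N = N'"
    using m fin card by (intro card_subset_eq) (auto simp: card_image)
  then show ?thesis using that[of m] m by (auto simp: bij_betw_def)
qed

section \<open>Uniformly continuous functions and their averages over minimal nets\<close>

definition unif_cont :: "('a \<Rightarrow> real) \<Rightarrow> bool" where
  "unif_cont f \<longleftrightarrow> (\<forall>\<epsilon>>0. \<exists>\<delta>>0. \<forall>x\<in>M. \<forall>y\<in>M. d x y < \<delta> \<longrightarrow> \<bar>f x - f y\<bar> < \<epsilon>)"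

lemma unif_cont_const: "unif_cont (\<lambda>_. c)"
  unfolding unif_cont_def by (auto intro: exI[of _ 1])

lemma unif_cont_add:
  assumes "unif_cont f" "unif_cont g"
  shows "unif_cont (\<lambda>x. f x + g x)"
  unfolding unif_cont_def
proof (intro allI impI)
  fix \<epsilon> :: real assume "0 < \<epsilon>"
  then obtain \<delta>1 \<delta>2 where
    \<delta>1: "0 < \<delta>1" "\<And>x y. x \<in> M \<Longrightarrow> y \<in> M \<Longrightarrow> d x y < \<delta>1 \<Longrightarrow> \<bar>f x - f y\<bar> < \<epsilon> / 2" and
    \<delta>2: "0 < \<delta>2" "\<And>x y. x \<in> M \<Longrightarrow> y \<in> M \<Longrightarrow> d x y < \<delta>2 \<Longrightarrow> \<bar>g x - g y\<bar> < \<epsilon> / 2"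
    using assms[unfolded unif_cont_def] half_gt_zero by metis
  show "\<exists>\<delta>>0. \<forall>x\<in>M. \<forall>y\<in>M. d x y < \<delta> \<longrightarrow> \<bar>f x + g x - (f y + g y)\<bar> < \<epsilon>"
  proof (intro exI[of _ "min \<delta>1 \<delta>2"] conjI ballI impI)
    fix x y assume "x \<in> M" "y \<in> M" "d x y < min \<delta>1 \<delta>2"
    then have "\<bar>f x - f y\<bar> < \<epsilon> / 2" "\<bar>g x - g y\<bar> < \<epsilon> / 2" using \<delta>1(2) \<delta>2(2) by simp_all
    then show "\<bar>f x + g x - (f y + g y)\<bar> < \<epsilon>" by arith
  qed (use \<delta>1 \<delta>2 in simp)
qed

lemma unif_cont_cmult:
  assumes "unif_cont f"
  shows "unif_cont (\<lambda>x. c * f x)"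
  unfolding unif_cont_def
proof (intro allI impI)
  fix \<epsilon> :: real assume \<epsilon>: "0 < \<epsilon>"
  then have "0 < \<epsilon> / (\<bar>c\<bar> + 1)" by simp
  then obtain \<delta> where \<delta>: "0 < \<delta>" "\<forall>x\<in>M. \<forall>y\<in>M. d x y < \<delta> \<longrightarrow> \<bar>f x - f y\<bar> < \<epsilon> / (\<bar>c\<bar> + 1)"
    using assms unfolding unif_cont_def by meson
  have "\<bar>c * f x - c * f y\<bar> < \<epsilon>" if "x \<in> M" "y \<in> M" "d x y < \<delta>" for x y
  proof -
    have "\<bar>f x - f y\<bar> < \<epsilon> / (\<bar>c\<bar> + 1)" using \<delta> that by blast
    then have "(\<bar>c\<bar> + 1) * \<bar>f x - f y\<bar> < \<epsilon>" by (simp add: field_simps)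
    moreover have "\<bar>c * f x - c * f y\<bar> \<le> (\<bar>c\<bar> + 1) * \<bar>f x - f y\<bar>"
      by (simp add: right_diff_distrib[symmetric] abs_mult mult_right_mono)
    ultimately show ?thesis by linarith
  qed
  with \<delta> show "\<exists>\<delta>>0. \<forall>x\<in>M. \<forall>y\<in>M. d x y < \<delta> \<longrightarrow> \<bar>c * f x - c * f y\<bar> < \<epsilon>" by blast
qed

text \<open>Provides the compact interval that the cluster point requires: on each ball around a
  point of a suitable finite net, f stays within 1 of its value at the centre.\<close>

lemma unif_cont_bounded:
  assumes "unif_cont f"
  shows "\<exists>b. \<forall>x\<in>M. \<bar>f x\<bar> \<le> b"
proof -
  obtain \<delta> where \<delta>: "0 < \<delta>" "\<forall>x\<in>M. \<forall>y\<in>M. d x y < \<delta> \<longrightarrow> \<bar>f x - f y\<bar> < 1"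
    using assms unfolding unif_cont_def by (meson zero_less_one)
  obtain N where N: "finite N" "N \<subseteq> M" "\<forall>x\<in>M. \<exists>y\<in>N. d x y < \<delta>"
    using totally_bounded[OF \<delta>(1)] by blast
  have "\<bar>f x\<bar> \<le> 1 + (\<Sum>y\<in>N. \<bar>f y\<bar>)" if x: "x \<in> M" for x
  proof -
    obtain y where y: "y \<in> N" "d x y < \<delta>" using N x by blast
    have "\<bar>f y\<bar> \<le> (\<Sum>y\<in>N. \<bar>f y\<bar>)" using y N by (intro member_le_sum) auto
    moreover have "\<bar>f x - f y\<bar> < 1" using \<delta> x y N by blast
    ultimately show ?thesis by linarith
  qed
  then show ?thesis by blast
qed

definition isometry :: "('a \<Rightarrow> 'a) \<Rightarrow> bool" where
  "isometry \<phi> \<longleftrightarrow> bij_betw \<phi> M M \<and> (\<forall>x\<in>M. \<forall>y\<in>M. d (\<phi> x) (\<phi> y) = d x y)"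

lemma unif_cont_isometry:
  assumes "unif_cont f" "isometry \<phi>"
  shows "unif_cont (\<lambda>x. f (\<phi> x))"
proof -
  have "\<phi> x \<in> M" if "x \<in> M" for x using assms(2) that by (auto simp: isometry_def bij_betw_def)
  moreover have "d (\<phi> x) (\<phi> y) = d x y" if "x \<in> M" "y \<in> M" for x y
    using assms(2) that by (simp add: isometry_def)
  ultimately show ?thesis using assms(1) unfolding unif_cont_def by (metis (no_types, lifting))
qed

lemma net_isometry:
  assumes "net \<epsilon> N" "isometry \<phi>"
  shows "net \<epsilon> (\<phi> ` N)" "card (\<phi> ` N) = card N"
proof -
  have inj: "inj_on \<phi> M" and im: "\<phi> ` M = M" and iso: "\<And>x y. x \<in> M \<Longrightarrow> y \<in> M \<Longrightarrow> d (\<phi> x) (\<phi> y) = d x y"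
    using assms(2) unfolding isometry_def bij_betw_def by auto
  have N: "finite N" "N \<subseteq> M" "\<And>x. x \<in> M \<Longrightarrow> \<exists>y\<in>N. d x y < \<epsilon>" using assms(1) unfolding net_def by auto
  show "net \<epsilon> (\<phi> ` N)"
    unfolding net_def
  proof (intro conjI ballI)
    fix x assume "x \<in> M"
    then obtain x' where x': "x' \<in> M" "x = \<phi> x'" using im by blast
    then obtain y where "y \<in> N" "d x' y < \<epsilon>" using N by blast
    then show "\<exists>y\<in>\<phi> ` N. d x y < \<epsilon>" using iso x' N by (metis imageI subsetD)
  qed (use N im in auto)
  show "card (\<phi> ` N) = card N" using inj N by (meson card_image inj_on_subset)
qed

definition average :: "'a set \<Rightarrow> ('a \<Rightarrow> real) \<Rightarrow> real" where
  "average N f = (\<Sum>x\<in>N. f x) / card N"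

text \<open>An isometry carries a minimal net to a net of the same cardinality, and the two are
  matched within 2 * \<epsilon>. After reindexing along the matching, the sums differ term by term
  by at most the oscillation of f at that scale.\<close>

lemma average_isometry:
  assumes f: "unif_cont f" and \<phi>: "isometry \<phi>"
  shows "(\<lambda>n. average (minimal_net (1 / Suc n)) (\<lambda>x. f (\<phi> x)) - average (minimal_net (1 / Suc n)) f) \<longlonglongrightarrow> 0"
proof (rule LIMSEQ_I)
  fix \<eta> :: real assume \<eta>: "0 < \<eta>"
  then obtain \<delta> where \<delta>: "0 < \<delta>" "\<And>x y. x \<in> M \<Longrightarrow> y \<in> M \<Longrightarrow> d x y < \<delta> \<Longrightarrow> \<bar>f x - f y\<bar> < \<eta>"
    using f unfolding unif_cont_def by metis
  obtain k :: nat where k: "2 / \<delta> < k" using reals_Archimedean2 by blast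
  show "\<exists>k. \<forall>n\<ge>k. norm (average (minimal_net (1 / Suc n)) (\<lambda>x. f (\<phi> x)) - average (minimal_net (1 / Suc n)) f - 0) < \<eta>"
  proof (intro exI[of _ k] allI impI)
    fix n assume n: "n \<ge> k"
    define \<epsilon> where "\<epsilon> = 1 / real (Suc n)"
    have \<epsilon>: "0 < \<epsilon>" by (simp add: \<epsilon>_def)
    have "2 / \<delta> < Suc n" using k n by linarith
    then have \<epsilon>\<delta>: "2 * \<epsilon> < \<delta>" using \<delta>(1) by (simp add: \<epsilon>_def field_simps)
    let ?N = "minimal_net \<epsilon>"
    have N: "net \<epsilon> ?N" using minimal_net(1)[OF \<epsilon>] .
    then have finN: "finite ?N" "?N \<subseteq> M" unfolding net_def by auto
    have card: "0 < card ?N" using finN net_not_empty[OF N] by (simp add: card_gt_0_iff)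
    obtain m where m: "bij_betw m ?N (\<phi> ` ?N)" "\<And>x. x \<in> ?N \<Longrightarrow> d x (m x) < 2 * \<epsilon>"
      using minimal_nets_matched[OF \<epsilon> N net_isometry[OF N \<phi>] minimal_net(2)[OF \<epsilon>]] by blast
    have "inj_on \<phi> ?N" using \<phi> finN unfolding isometry_def bij_betw_def by (meson inj_on_subset)
    then have "(\<Sum>x\<in>?N. f (\<phi> x)) = (\<Sum>y\<in>\<phi> ` ?N. f y)" by (simp add: sum.reindex)
    also have "\<dots> = (\<Sum>x\<in>?N. f (m x))" using sum.reindex_bij_betw[OF m(1), of f] by simp
    finally have eq: "(\<Sum>x\<in>?N. f (\<phi> x)) - (\<Sum>x\<in>?N. f x) = (\<Sum>x\<in>?N. f (m x) - f x)"
      by (simp add: sum_subtractf)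
    have "m x \<in> M" if "x \<in> ?N" for x
      using that m(1) finN \<phi> unfolding isometry_def bij_betw_def by blast
    then have "\<bar>f (m x) - f x\<bar> < \<eta>" if "x \<in> ?N" for x
      using \<delta>(2)[of x "m x"] m(2)[OF that] \<epsilon>\<delta> that finN by (metis abs_minus_commute order_less_trans subsetD)
    then have "(\<Sum>x\<in>?N. \<bar>f (m x) - f x\<bar>) < (\<Sum>x\<in>?N. \<eta>)"
      using finN net_not_empty[OF N] by (intro sum_strict_mono) auto
    then have "\<bar>\<Sum>x\<in>?N. f (m x) - f x\<bar> < card ?N * \<eta>"
      using order_le_less_trans[OF sum_abs] by simp
    then show "norm (average (minimal_net (1 / Suc n)) (\<lambda>x. f (\<phi> x)) - average (minimal_net (1 / Suc n)) f - 0) < \<eta>"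
      using card unfolding \<epsilon>_def[symmetric] average_def real_norm_def
      by (simp add: diff_divide_distrib[symmetric] eq field_simps)
  qed
qed

text \<open>Normalisation, linearity and monotonicity hold for each average and survive the limit;
  invariance appears only in the limit.\<close>

theorem invariant_mean_exists:
  obtains L :: "('a \<Rightarrow> real) \<Rightarrow> real" where
    "\<And>c. L (\<lambda>_. c) = c"
    "\<And>f g. unif_cont f \<Longrightarrow> unif_cont g \<Longrightarrow> L (\<lambda>x. f x + g x) = L f + L g"
    "\<And>f c. unif_cont f \<Longrightarrow> L (\<lambda>x. c * f x) = c * L f"
    "\<And>f g. unif_cont f \<Longrightarrow> unif_cont g \<Longrightarrow> (\<And>x. x \<in> M \<Longrightarrow> f x \<le> g x) \<Longrightarrow> L f \<le> L g"
    "\<And>f \<phi>. unif_cont f \<Longrightarrow> isometry \<phi> \<Longrightarrow> L (\<lambda>x. f (\<phi> x)) = L f"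
proof -
  define N where "N = (\<lambda>n::nat. minimal_net (1 / Suc n))"
  have N: "net (1 / Suc n) (N n)" for n unfolding N_def by (rule minimal_net) simp
  have finN: "finite (N n)" "N n \<subseteq> M" "card (N n) > 0" for n
    using N[of n] net_not_empty[OF N[of n]] unfolding net_def by (auto simp: card_gt_0_iff)
  \<comment> \<open>Averages of an arbitrary function can be unbounded in n, whereas the cluster
    point asks for a bound at every index; hence the value 0 for functions that are not uniformly
    continuous.\<close>
  define A where "A = (\<lambda>n f. if unif_cont f then average (N n) f else 0)"
  define b where "b = (\<lambda>f::'a\<Rightarrow>real. SOME b. \<forall>x\<in>M. \<bar>f x\<bar> \<le> b)"
  have b: "\<bar>f x\<bar> \<le> b f" if "unif_cont f" "x \<in> M" for f x
    using someI_ex[OF unif_cont_bounded[OF that(1)]] that(2) unfolding b_def by blast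
  \<comment> \<open>If f is not uniformly continuous, \<open>b f\<close> may be an arbitrary, even
    negative number; the outer absolute value keeps the bound true.\<close>
  have "\<bar>A n f\<bar> \<le> \<bar>b f\<bar>" for n f
  proof (cases "unif_cont f")
    case True
    have "\<bar>\<Sum>x\<in>N n. f x\<bar> \<le> (\<Sum>x\<in>N n. \<bar>b f\<bar>)"
      by (rule order_trans[OF sum_abs], rule sum_mono) (use b[OF True] finN in force)
    then have "\<bar>\<Sum>x\<in>N n. f x\<bar> \<le> card (N n) * \<bar>b f\<bar>" by simp
    then show ?thesis using True finN(3)[of n] by (simp add: A_def average_def field_simps)
  qed (simp add: A_def)
  then obtain U L where U: "U \<noteq> bot" "U \<le> sequentially"
    and L: "\<And>f. ((\<lambda>n. A n f) \<longlongrightarrow> L f) U"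
    using pointwise_convergent_subfilter[of A "\<lambda>f. \<bar>b f\<bar>"] by blast
  show ?thesis
  proof
    show "L (\<lambda>_. c) = c" for c
    proof -
      have "A n (\<lambda>_. c) = c" for n
        using finN(3)[of n] by (simp add: A_def average_def unif_cont_const)
      then show ?thesis using L[of "\<lambda>_. c"] tendsto_unique[OF U(1) _ tendsto_const] by auto
    qed
    show "L (\<lambda>x. f x + g x) = L f + L g" if "unif_cont f" "unif_cont g" for f g
    proof -
      have "A n (\<lambda>x. f x + g x) = A n f + A n g" for n
        using that by (simp add: A_def average_def unif_cont_add sum.distrib add_divide_distrib)
      then show ?thesis
        using L[of "\<lambda>x. f x + g x"] tendsto_add[OF L[of f] L[of g]] tendsto_unique[OF U(1)] by auto
    qed
    show "L (\<lambda>x. c * f x) = c * L f" if "unif_cont f" for f c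
    proof -
      have "A n (\<lambda>x. c * f x) = c * A n f" for n
        using that by (simp add: A_def average_def unif_cont_cmult sum_distrib_left)
      then show ?thesis
        using L[of "\<lambda>x. c * f x"] tendsto_mult_left[OF L[of f], of c] tendsto_unique[OF U(1)] by auto
    qed
    show "L f \<le> L g" if "unif_cont f" "unif_cont g" "\<And>x. x \<in> M \<Longrightarrow> f x \<le> g x" for f g
    proof (rule tendsto_le[OF U(1) L[of g] L[of f]], rule always_eventually, rule allI)
      fix n
      have "(\<Sum>x\<in>N n. f x) \<le> (\<Sum>x\<in>N n. g x)" using that(3) finN by (intro sum_mono) auto
      then show "A n f \<le> A n g" using that by (simp add: A_def average_def divide_right_mono)
    qed
    show "L (\<lambda>x. f (\<phi> x)) = L f" if "unif_cont f" "isometry \<phi>" for f \<phi>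
    proof -
      have "((\<lambda>n. A n (\<lambda>x. f (\<phi> x)) - A n f) \<longlongrightarrow> 0) U"
        using tendsto_mono[OF U(2) average_isometry[OF that]] that
        by (simp add: A_def N_def unif_cont_isometry)
      then have "L (\<lambda>x. f (\<phi> x)) - L f = 0"
        using tendsto_diff[OF L[of "\<lambda>x. f (\<phi> x)"] L[of f]] tendsto_unique[OF U(1)] by blast
      then show ?thesis by simp
    qed
  qed
qed

end

section \<open>Mean square displacement on a compact group\<close>

text \<open>A partition of unity subordinate to finitely many unit balls: the new value at x is a
  convex combination of values \<open>F p\<close> with p closer than 1 to x, each within C of
  \<open>F x\<close>.\<close>

lemma compact_smoothing:
  fixes F :: "'e::metric_space \<Rightarrow> 'h::real_normed_vector"
  assumes K: "compact K" and C: "\<And>x y. x \<in> K \<Longrightarrow> y \<in> K \<Longrightarrow> dist x y < 1 \<Longrightarrow> norm (F x - F y) \<le> C"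
  obtains F' where "continuous_on K F'" "\<And>x. x \<in> K \<Longrightarrow> norm (F' x - F x) \<le> C"
proof -
  obtain P where P: "finite P" "P \<subseteq> K" "K \<subseteq> (\<Union>p\<in>P. ball p 1)"
    by (rule compactE_image[OF K, of K "\<lambda>p. ball p 1"]) auto
  define \<phi> where "\<phi> = (\<lambda>p x::'e. max 0 (1 - dist x p))"
  define W where "W = (\<lambda>x. \<Sum>p\<in>P. \<phi> p x)"
  define F' where "F' = (\<lambda>x. inverse (W x) *\<^sub>R (\<Sum>p\<in>P. \<phi> p x *\<^sub>R F p))"
  have \<phi>_nonneg: "0 \<le> \<phi> p x" for p x by (simp add: \<phi>_def)
  have W: "0 < W x" if x: "x \<in> K" for x
  proof -
    obtain p where p: "p \<in> P" "dist p x < 1" using P(3) x by auto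
    then have "0 < \<phi> p x" by (simp add: \<phi>_def dist_commute)
    moreover have "\<phi> p x \<le> W x" unfolding W_def
      by (rule member_le_sum) (use p P \<phi>_nonneg in auto)
    ultimately show ?thesis by linarith
  qed
  have "continuous_on K W" unfolding W_def \<phi>_def by (intro continuous_intros)
  moreover have "W x \<noteq> 0" if "x \<in> K" for x using W[OF that] by simp
  ultimately have cont: "continuous_on K F'"
    unfolding F'_def \<phi>_def by (intro continuous_intros) auto
  have "norm (F' x - F x) \<le> C" if x: "x \<in> K" for x
  proof -
    have "F' x - F x = inverse (W x) *\<^sub>R ((\<Sum>p\<in>P. \<phi> p x *\<^sub>R F p) - W x *\<^sub>R F x)"
      using W[OF x] by (simp add: F'_def algebra_simps)
    also have "(\<Sum>p\<in>P. \<phi> p x *\<^sub>R F p) - W x *\<^sub>R F x = (\<Sum>p\<in>P. \<phi> p x *\<^sub>R (F p - F x))"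
      by (simp add: W_def scaleR_sum_left sum_subtractf scaleR_diff_right)
    finally have "norm (F' x - F x) = inverse (W x) * norm (\<Sum>p\<in>P. \<phi> p x *\<^sub>R (F p - F x))"
      using W[OF x] by simp
    moreover have "norm (\<Sum>p\<in>P. \<phi> p x *\<^sub>R (F p - F x)) \<le> (\<Sum>p\<in>P. \<phi> p x * C)"
    proof (rule sum_norm_le)
      fix p assume p: "p \<in> P"
      show "norm (\<phi> p x *\<^sub>R (F p - F x)) \<le> \<phi> p x * C"
      proof (cases "dist p x < 1")
        case True
        then have "norm (F p - F x) \<le> C" using C p P x by blast
        then show ?thesis using \<phi>_nonneg[of p x] by (simp add: mult_left_mono)
      next
        case False
        then have "\<phi> p x = 0" by (simp add: \<phi>_def dist_commute)
        then show ?thesis by simp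
      qed
    qed
    moreover have "(\<Sum>p\<in>P. \<phi> p x * C) = W x * C" by (simp add: W_def sum_distrib_right)
    ultimately have "norm (F' x - F x) \<le> inverse (W x) * (W x * C)"
      using W[OF x] by (simp add: mult_left_mono)
    then show ?thesis using W[OF x] by (simp add: mult.assoc[symmetric])
  qed
  then show ?thesis using that cont by blast
qed

text \<open>After expanding the squares, the terms with the squared norm of only one vector vanish
  because the coefficients sum to 0; what remains is -2 times a squared norm.\<close>

lemma sum_norm_diff_nonpos:
  fixes a :: "'i \<Rightarrow> 'h::real_inner"
  assumes "(\<Sum>x\<in>F. c x) = (0::real)"
  shows "(\<Sum>x\<in>F. \<Sum>y\<in>F. c x * c y * (norm (a x - a y))\<^sup>2) \<le> 0"
proof -
  have "(\<Sum>x\<in>F. \<Sum>y\<in>F. c x * c y * (norm (a x - a y))\<^sup>2)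
    = (\<Sum>x\<in>F. \<Sum>y\<in>F. (c x * (a x \<bullet> a x)) * c y + c x * (c y * (a y \<bullet> a y))
        - 2 * ((c x *\<^sub>R a x) \<bullet> (c y *\<^sub>R a y)))"
    by (intro sum.cong refl)
      (simp add: power2_norm_eq_inner inner_diff_left inner_diff_right inner_commute algebra_simps)
  also have "\<dots> = - 2 * ((\<Sum>x\<in>F. c x *\<^sub>R a x) \<bullet> (\<Sum>y\<in>F. c y *\<^sub>R a y))"
    by (simp only: sum_subtractf sum.distrib sum_distrib_left[symmetric] sum_distrib_right[symmetric]
        assms inner_sum_left inner_sum_right) (simp, rule sum.swap)
  finally show ?thesis by simp
qed

lemma conditionally_negative_type_subgroup:
  assumes "group G" "subgroup \<Gamma> G" "conditionally_negative_type G h"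
  shows "conditionally_negative_type (G\<lparr>carrier := \<Gamma>\<rparr>) h"
proof -
  interpret group G by fact
  have sub: "\<Gamma> \<subseteq> carrier G" by (rule subgroup.subset[OF assms(2)])
  have inv: "inv\<^bsub>G\<lparr>carrier := \<Gamma>\<rparr>\<^esub> x = inv\<^bsub>G\<^esub> x" if "x \<in> \<Gamma>" for x
    using m_inv_consistent[OF assms(2) that] .
  have "(\<Sum>x\<in>F. \<Sum>y\<in>F. c x * c y * h (inv\<^bsub>G\<lparr>carrier := \<Gamma>\<rparr>\<^esub> x \<otimes>\<^bsub>G\<^esub> y))
      = (\<Sum>x\<in>F. \<Sum>y\<in>F. c x * c y * h (inv\<^bsub>G\<^esub> x \<otimes>\<^bsub>G\<^esub> y))" if "F \<subseteq> \<Gamma>" for F c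
    using that inv by (intro sum.cong refl) auto
  then show ?thesis
    using assms(3) sub inv unfolding conditionally_negative_type_def by auto
qed

lemma conditionally_negative_type_tendsto:
  assumes "group \<Gamma>" "U \<noteq> bot" "\<And>n. conditionally_negative_type \<Gamma> (A n)"
    and lim: "\<And>g. g \<in> carrier \<Gamma> \<Longrightarrow> ((\<lambda>n. A n g) \<longlongrightarrow> h g) U"
  shows "conditionally_negative_type \<Gamma> h"
proof -
  interpret group \<Gamma> by fact
  have A: "A n \<one>\<^bsub>\<Gamma>\<^esub> = 0" "\<And>g. g \<in> carrier \<Gamma> \<Longrightarrow> A n (inv\<^bsub>\<Gamma>\<^esub> g) = A n g"
    "\<And>F c. finite F \<Longrightarrow> F \<subseteq> carrier \<Gamma> \<Longrightarrow> (\<Sum>x\<in>F. c x) = 0 \<Longrightarrow>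
      (\<Sum>x\<in>F. \<Sum>y\<in>F. c x * c y * A n (inv\<^bsub>\<Gamma>\<^esub> x \<otimes>\<^bsub>\<Gamma>\<^esub> y)) \<le> 0" for n
    using assms(3)[of n] unfolding conditionally_negative_type_def by auto
  show ?thesis
    unfolding conditionally_negative_type_def
  proof (intro conjI ballI allI impI)
    show "h \<one>\<^bsub>\<Gamma>\<^esub> = 0"
      using lim[OF one_closed] A(1) tendsto_unique[OF assms(2) _ tendsto_const] by auto
    show "h (inv\<^bsub>\<Gamma>\<^esub> g) = h g" if g: "g \<in> carrier \<Gamma>" for g
      using lim[OF g] lim[OF inv_closed[OF g]] A(2)[OF g] tendsto_unique[OF assms(2)] by auto
    fix F and c :: "_ \<Rightarrow> real"
    assume F: "finite F \<and> F \<subseteq> carrier \<Gamma> \<and> (\<Sum>x\<in>F. c x) = 0"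
    have "((\<lambda>n. \<Sum>x\<in>F. \<Sum>y\<in>F. c x * c y * A n (inv\<^bsub>\<Gamma>\<^esub> x \<otimes>\<^bsub>\<Gamma>\<^esub> y))
      \<longlongrightarrow> (\<Sum>x\<in>F. \<Sum>y\<in>F. c x * c y * h (inv\<^bsub>\<Gamma>\<^esub> x \<otimes>\<^bsub>\<Gamma>\<^esub> y))) U"
      using F by (intro tendsto_sum tendsto_mult_left lim) auto
    then show "(\<Sum>x\<in>F. \<Sum>y\<in>F. c x * c y * h (inv\<^bsub>\<Gamma>\<^esub> x \<otimes>\<^bsub>\<Gamma>\<^esub> y)) \<le> 0"
      by (rule tendsto_upperbound) (use assms(2) A(3) F in auto)
  qed
qed

text \<open>The form in which compactness and continuity of the group enter: a compact set of unit
  vectors on which multiplication, read through e, is uniformly continuous in the Euclidean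
  distance, the one that measures jumps in the cone.\<close>

locale spherical_group = group G for G :: "'a monoid" (structure) +
  fixes e :: "'a \<Rightarrow> 'e::euclidean_space"
  assumes sphere: "e ` carrier G \<subseteq> sphere 0 1"
    and inj: "inj_on e (carrier G)"
    and compact: "compact (e ` carrier G)"
    and unif_mult: "0 < \<epsilon> \<Longrightarrow> \<exists>\<delta>>0. \<forall>x\<in>carrier G. \<forall>x'\<in>carrier G. \<forall>y\<in>carrier G. \<forall>y'\<in>carrier G.
      dist (e x) (e x') < \<delta> \<longrightarrow> dist (e y) (e y') < \<delta> \<longrightarrow> dist (e (x \<otimes> y)) (e (x' \<otimes> y')) < \<epsilon>"
begin

lemma norm_e: "x \<in> carrier G \<Longrightarrow> norm (e x) = 1"
  using sphere by auto

text \<open>The modulus does not depend on the translating element z, so a supremum over all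
  translates is still controlled.\<close>

lemma unif_left:
  assumes "0 < \<epsilon>"
  obtains \<delta> where "0 < \<delta>" "\<And>z x y. z \<in> carrier G \<Longrightarrow> x \<in> carrier G \<Longrightarrow> y \<in> carrier G \<Longrightarrow>
    dist (e x) (e y) < \<delta> \<Longrightarrow> dist (e (z \<otimes> x)) (e (z \<otimes> y)) < \<epsilon>"
  using unif_mult[OF assms] by (metis dist_self)

lemma unif_right:
  assumes "0 < \<epsilon>"
  obtains \<delta> where "0 < \<delta>" "\<And>z x y. z \<in> carrier G \<Longrightarrow> x \<in> carrier G \<Longrightarrow> y \<in> carrier G \<Longrightarrow>
    dist (e x) (e y) < \<delta> \<Longrightarrow> dist (e (x \<otimes> z)) (e (y \<otimes> z)) < \<epsilon>"
  using unif_mult[OF assms] by (metis dist_self)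

text \<open>The supremum over all left translates is what makes left translation isometric.\<close>

definition left_invariant_dist :: "'a \<Rightarrow> 'a \<Rightarrow> real" where
  "left_invariant_dist x y = (SUP z\<in>carrier G. dist (e (z \<otimes> x)) (e (z \<otimes> y)))"

lemma dist_le_left_invariant_dist:
  assumes "x \<in> carrier G" "y \<in> carrier G" "z \<in> carrier G"
  shows "dist (e (z \<otimes> x)) (e (z \<otimes> y)) \<le> left_invariant_dist x y"
  unfolding left_invariant_dist_def
proof (rule cSUP_upper[OF assms(3)])
  have "dist (e (z \<otimes> x)) (e (z \<otimes> y)) \<le> 2" if "z \<in> carrier G" for z
    using norm_triangle_ineq4[of "e (z \<otimes> x)" "e (z \<otimes> y)"] norm_e assms that by (simp add: dist_norm)
  then show "bdd_above ((\<lambda>z. dist (e (z \<otimes> x)) (e (z \<otimes> y))) ` carrier G)"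
    by (auto simp: bdd_above_def)
qed

lemma left_invariant_dist_least:
  assumes "\<And>z. z \<in> carrier G \<Longrightarrow> dist (e (z \<otimes> x)) (e (z \<otimes> y)) \<le> c"
  shows "left_invariant_dist x y \<le> c"
  unfolding left_invariant_dist_def using one_closed assms by (intro cSUP_least) auto

sublocale totally_bounded_pseudometric "carrier G" left_invariant_dist
proof
  show nonempty: "carrier G \<noteq> {}" using one_closed by blast
  show "left_invariant_dist x x = 0" for x
    using nonempty by (simp add: left_invariant_dist_def cSUP_const)
  show "left_invariant_dist x y = left_invariant_dist y x" for x y
    by (simp add: left_invariant_dist_def dist_commute)
  show "left_invariant_dist x z \<le> left_invariant_dist x y + left_invariant_dist y z"
    if "x \<in> carrier G" "y \<in> carrier G" "z \<in> carrier G" for x y z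
  proof (rule left_invariant_dist_least)
    fix w assume w: "w \<in> carrier G"
    show "dist (e (w \<otimes> x)) (e (w \<otimes> z)) \<le> left_invariant_dist x y + left_invariant_dist y z"
      using dist_triangle[of "e (w \<otimes> x)" "e (w \<otimes> z)" "e (w \<otimes> y)"]
        dist_le_left_invariant_dist[OF that(1,2) w] dist_le_left_invariant_dist[OF that(2,3) w] by linarith
  qed
  fix \<epsilon> :: real assume \<epsilon>: "0 < \<epsilon>"
  \<comment> \<open>Tolerance \<epsilon> / 2, since the supremum over z turns a strict bound into a
    weak one.\<close>
  then obtain \<delta> where \<delta>: "0 < \<delta>" "\<And>z x y. z \<in> carrier G \<Longrightarrow> x \<in> carrier G \<Longrightarrow> y \<in> carrier G \<Longrightarrow>
    dist (e x) (e y) < \<delta> \<Longrightarrow> dist (e (z \<otimes> x)) (e (z \<otimes> y)) < \<epsilon> / 2"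
    using unif_left[of "\<epsilon> / 2"] by auto
  obtain P where P: "finite P" "P \<subseteq> e ` carrier G" "e ` carrier G \<subseteq> (\<Union>p\<in>P. ball p \<delta>)"
    by (rule compactE_image[OF compact, of "e ` carrier G" "\<lambda>p. ball p \<delta>"]) (use \<delta>(1) in auto)
  obtain N where N: "finite N" "N \<subseteq> carrier G" "P = e ` N"
    using finite_subset_image[OF P(1,2)] by blast
  show "\<exists>N. finite N \<and> N \<subseteq> carrier G \<and> (\<forall>x\<in>carrier G. \<exists>y\<in>N. left_invariant_dist x y < \<epsilon>)"
  proof (intro exI[of _ N] conjI ballI)
    fix x assume x: "x \<in> carrier G"
    then obtain y where y: "y \<in> N" "dist (e y) (e x) < \<delta>" using P(3) N(3) by fastforce
    have "left_invariant_dist x y \<le> \<epsilon> / 2"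
      using \<delta>(2)[of _ x y] x y N by (intro left_invariant_dist_least less_imp_le) (auto simp: dist_commute)
    then show "\<exists>y\<in>N. left_invariant_dist x y < \<epsilon>" using y \<epsilon> by (intro bexI[of _ y]) auto
  qed (use N in auto)
qed

text \<open>Left translation by a only permutes the translates in the supremum: z \<otimes> a and z
  \<otimes> inv a run over the same index set as z.\<close>

lemma isometry_translation:
  assumes a: "a \<in> carrier G"
  shows "isometry (\<lambda>x. a \<otimes> x)"
proof -
  have "left_invariant_dist (a \<otimes> x) (a \<otimes> y) = left_invariant_dist x y"
    if xy: "x \<in> carrier G" "y \<in> carrier G" for x y
  proof (rule antisym; rule left_invariant_dist_least)
    fix z assume z: "z \<in> carrier G"
    show "dist (e (z \<otimes> (a \<otimes> x))) (e (z \<otimes> (a \<otimes> y))) \<le> left_invariant_dist x y"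
      using dist_le_left_invariant_dist[OF xy, of "z \<otimes> a"] a z xy by (simp add: m_assoc)
    have "z \<otimes> x = (z \<otimes> inv a) \<otimes> (a \<otimes> x)" "z \<otimes> y = (z \<otimes> inv a) \<otimes> (a \<otimes> y)"
      using a z xy by (simp_all add: m_assoc inv_solve_left flip: m_assoc[of "inv a"])
    then show "dist (e (z \<otimes> x)) (e (z \<otimes> y)) \<le> left_invariant_dist (a \<otimes> x) (a \<otimes> y)"
      using dist_le_left_invariant_dist[of "a \<otimes> x" "a \<otimes> y" "z \<otimes> inv a"] a z xy by simp
  qed
  moreover have "bij_betw (\<lambda>x. a \<otimes> x) (carrier G) (carrier G)"
    unfolding bij_betw_def using a inj_on_cmult surj_const_mult by blast
  ultimately show ?thesis by (simp add: isometry_def)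
qed

text \<open>Uniform continuity on the compact square. The invariant distance of x and y dominates
  the Euclidean distance between their translates by any one element, so both coordinates move by
  less than \<delta> / 2.\<close>

lemma unif_cont_translates:
  fixes \<psi> :: "'e \<times> 'e \<Rightarrow> real"
  assumes \<psi>: "continuous_on (e ` carrier G \<times> e ` carrier G) \<psi>" and ab: "a \<in> carrier G" "b \<in> carrier G"
  shows "unif_cont (\<lambda>x. \<psi> (e (a \<otimes> x), e (b \<otimes> x)))"
  unfolding unif_cont_def
proof (intro allI impI)
  fix \<epsilon> :: real assume \<epsilon>: "0 < \<epsilon>"
  have "uniformly_continuous_on (e ` carrier G \<times> e ` carrier G) \<psi>"
    by (rule compact_uniformly_continuous[OF \<psi>]) (intro compact_Times compact)
  then obtain \<delta> where \<delta>: "0 < \<delta>" "\<And>p q. p \<in> e ` carrier G \<times> e ` carrier G \<Longrightarrow> q \<in> e ` carrier G \<times> e ` carrier G \<Longrightarrow>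
    dist p q < \<delta> \<Longrightarrow> dist (\<psi> p) (\<psi> q) < \<epsilon>"
    using \<epsilon> unfolding uniformly_continuous_on_def by metis
  show "\<exists>\<delta>>0. \<forall>x\<in>carrier G. \<forall>y\<in>carrier G. left_invariant_dist x y < \<delta> \<longrightarrow>
      \<bar>\<psi> (e (a \<otimes> x), e (b \<otimes> x)) - \<psi> (e (a \<otimes> y), e (b \<otimes> y))\<bar> < \<epsilon>"
  proof (intro exI[of _ "\<delta> / 2"] conjI ballI impI)
    fix x y assume xy: "x \<in> carrier G" "y \<in> carrier G" "left_invariant_dist x y < \<delta> / 2"
    have "dist (e (a \<otimes> x), e (b \<otimes> x)) (e (a \<otimes> y), e (b \<otimes> y))
      \<le> dist (e (a \<otimes> x)) (e (a \<otimes> y)) + dist (e (b \<otimes> x)) (e (b \<otimes> y))"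
      unfolding dist_Pair_Pair by (rule sqrt_sum_squares_le_sum) auto
    also have "\<dots> < \<delta>"
      using dist_le_left_invariant_dist[OF xy(1,2) ab(1)] dist_le_left_invariant_dist[OF xy(1,2) ab(2)] xy(3)
      by linarith
    finally show "\<bar>\<psi> (e (a \<otimes> x), e (b \<otimes> x)) - \<psi> (e (a \<otimes> y), e (b \<otimes> y))\<bar> < \<epsilon>"
      using \<delta>(2) ab xy by (simp add: dist_real_def)
  qed (use \<delta> in simp)
qed

text \<open>Substituting y \<otimes> g for g in the invariant mean shows that
  \<open>h (inv x \<otimes> y)\<close> is the mean over g of the squared distance between
  \<open>u (inv x \<otimes> g)\<close> and \<open>u (inv y \<otimes> g)\<close>. For fixed g such a
  kernel has negative type, and the mean is linear and monotone.\<close>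

lemma mean_square_displacement:
  fixes u :: "'a \<Rightarrow> 'h::real_inner"
  assumes uc: "\<And>a b. a \<in> carrier G \<Longrightarrow> b \<in> carrier G \<Longrightarrow> unif_cont (\<lambda>g. (norm (u (a \<otimes> g) - u (b \<otimes> g)))\<^sup>2)"
  obtains h where "conditionally_negative_type G h"
    "\<And>a r. a \<in> carrier G \<Longrightarrow> (\<And>g. g \<in> carrier G \<Longrightarrow> norm (u (a \<otimes> g) - u g) \<le> r) \<Longrightarrow> h a \<le> r\<^sup>2"
    "\<And>a r. a \<in> carrier G \<Longrightarrow> 0 \<le> r \<Longrightarrow> (\<And>g. g \<in> carrier G \<Longrightarrow> r \<le> norm (u (a \<otimes> g) - u g)) \<Longrightarrow> r\<^sup>2 \<le> h a"
proof -
  obtain L where L_const: "\<And>c. L (\<lambda>_. c) = c"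
    and L_add: "\<And>f g. unif_cont f \<Longrightarrow> unif_cont g \<Longrightarrow> L (\<lambda>x. f x + g x) = L f + L g"
    and L_cmult: "\<And>f c. unif_cont f \<Longrightarrow> L (\<lambda>x. c * f x) = c * L f"
    and L_mono: "\<And>f g. unif_cont f \<Longrightarrow> unif_cont g \<Longrightarrow> (\<And>x. x \<in> carrier G \<Longrightarrow> f x \<le> g x) \<Longrightarrow> L f \<le> L g"
    and L_inv: "\<And>f \<phi>. unif_cont f \<Longrightarrow> isometry \<phi> \<Longrightarrow> L (\<lambda>x. f (\<phi> x)) = L f"
    using invariant_mean_exists by blast
  have uc_cong: "unif_cont g" if "unif_cont f" "\<And>x. x \<in> carrier G \<Longrightarrow> f x = g x" for f g
    using that unfolding unif_cont_def by simp
  have L_cong: "L f = L g" if "unif_cont f" "\<And>x. x \<in> carrier G \<Longrightarrow> f x = g x" for f g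
    using that uc_cong[OF that] by (intro antisym L_mono) auto
  have uc_sum: "unif_cont (\<lambda>x. \<Sum>i\<in>I. c i * f i x) \<and> L (\<lambda>x. \<Sum>i\<in>I. c i * f i x) = (\<Sum>i\<in>I. c i * L (f i))"
    if "finite I" "\<And>i. i \<in> I \<Longrightarrow> unif_cont (f i)" for I :: "('a \<times> 'a) set" and c f
    using that
    by (induction I rule: finite_induct)
      (auto simp: L_const L_add L_cmult unif_cont_const unif_cont_add unif_cont_cmult)
  define f where "f = (\<lambda>a b g. (norm (u (a \<otimes> g) - u (b \<otimes> g)))\<^sup>2)"
  define h where "h = (\<lambda>a. L (f a \<one>))"
  have uc: "unif_cont (f a b)" if "a \<in> carrier G" "b \<in> carrier G" for a b
    using uc[OF that] by (simp add: f_def)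
  have h_mult: "h (inv x \<otimes> y) = L (f (inv x) (inv y))" if xy: "x \<in> carrier G" "y \<in> carrier G" for x y
  proof -
    have "L (f (inv x) (inv y)) = L (\<lambda>g. f (inv x) (inv y) (y \<otimes> g))"
      using L_inv[OF uc isometry_translation[OF xy(2)]] xy by simp
    also have "\<dots> = L (f (inv x \<otimes> y) \<one>)"
      by (rule L_cong[OF unif_cont_isometry[OF uc isometry_translation]])
        (use xy in \<open>auto simp: f_def m_assoc simp flip: m_assoc[of "inv y"]\<close>)
    finally show ?thesis by (simp add: h_def)
  qed
  show ?thesis
  proof
    show "conditionally_negative_type G h"
      unfolding conditionally_negative_type_def
    proof (intro conjI ballI allI impI)
      have "h \<one> = L (\<lambda>_. 0)" unfolding h_def f_def by simp
      then show "h \<one> = 0" by (simp add: L_const)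
      show "h (inv g) = h g" if g: "g \<in> carrier G" for g
      proof -
        have "h (inv g) = L (f (inv g) \<one>)" by (simp add: h_def)
        also have "f (inv g) \<one> = f \<one> (inv g)" by (simp add: f_def norm_minus_commute)
        also have "L \<dots> = h g" using h_mult[of \<one> g] g by simp
        finally show ?thesis .
      qed
      fix F and c :: "'a \<Rightarrow> real"
      assume F: "finite F \<and> F \<subseteq> carrier G \<and> (\<Sum>x\<in>F. c x) = 0"
      let ?f = "\<lambda>p. f (inv (fst p)) (inv (snd p))" and ?c = "\<lambda>p. c (fst p) * c (snd p)"
      have sum: "unif_cont (\<lambda>g. \<Sum>p\<in>F \<times> F. ?c p * ?f p g)"
        "L (\<lambda>g. \<Sum>p\<in>F \<times> F. ?c p * ?f p g) = (\<Sum>p\<in>F \<times> F. ?c p * L (?f p))"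
        using uc_sum[of "F \<times> F" ?f ?c] F uc by (auto simp: subset_iff)
      have "(\<Sum>x\<in>F. \<Sum>y\<in>F. c x * c y * h (inv x \<otimes> y)) = (\<Sum>x\<in>F. \<Sum>y\<in>F. c x * c y * L (f (inv x) (inv y)))"
        using F h_mult by (intro sum.cong refl) (auto simp: subset_iff)
      also have "\<dots> = L (\<lambda>g. \<Sum>p\<in>F \<times> F. ?c p * ?f p g)"
        by (simp add: sum(2) sum.cartesian_product case_prod_unfold)
      also have "\<dots> \<le> L (\<lambda>_. 0)"
      proof (rule L_mono[OF sum(1) unif_cont_const])
        fix g
        have "(\<Sum>x\<in>F. \<Sum>y\<in>F. c x * c y * f (inv x) (inv y) g) \<le> 0"
          unfolding f_def using F by (intro sum_norm_diff_nonpos) auto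
        then show "(\<Sum>p\<in>F \<times> F. ?c p * ?f p g) \<le> 0"
          by (simp add: sum.cartesian_product case_prod_unfold)
      qed
      finally show "(\<Sum>x\<in>F. \<Sum>y\<in>F. c x * c y * h (inv x \<otimes> y)) \<le> 0" by (simp add: L_const)
    qed
    show "h a \<le> r\<^sup>2"
      if "a \<in> carrier G" "\<And>g. g \<in> carrier G \<Longrightarrow> norm (u (a \<otimes> g) - u g) \<le> r" for a r
    proof -
      have "h a \<le> L (\<lambda>_. r\<^sup>2)" unfolding h_def
        using that by (intro L_mono uc unif_cont_const) (auto simp: f_def power_mono)
      then show ?thesis by (simp add: L_const)
    qed
    show "r\<^sup>2 \<le> h a"
      if "a \<in> carrier G" "0 \<le> r" "\<And>g. g \<in> carrier G \<Longrightarrow> r \<le> norm (u (a \<otimes> g) - u g)" for a r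
    proof -
      have "L (\<lambda>_. r\<^sup>2) \<le> h a" unfolding h_def
        using that by (intro L_mono uc unif_cont_const) (auto simp: f_def power_mono)
      then show ?thesis by (simp add: L_const)
    qed
  qed
qed

end

section \<open>Distances in the warped cone\<close>

text \<open>A chain model of the warped metric: jumps cost their length, moves cost 1. Moves run
  both ways because a metric is symmetric, although the warping condition names only the step from x
  to \<open>act s x\<close>.\<close>

inductive warped_path ::
    "'x::metric_space set \<Rightarrow> ('s \<Rightarrow> 'x \<Rightarrow> 'x) \<Rightarrow> 's set \<Rightarrow> real \<Rightarrow> 'x \<Rightarrow> 'x \<Rightarrow> bool"
  for E act S where
  nil: "x \<in> E \<Longrightarrow> warped_path E act S 0 x x"
| jump: "warped_path E act S r x y \<Longrightarrow> z \<in> E \<Longrightarrow> warped_path E act S (r + dist y z) x z"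
| move: "warped_path E act S r x y \<Longrightarrow> z \<in> E \<Longrightarrow> s \<in> S \<Longrightarrow> z = act s y \<or> y = act s z \<Longrightarrow>
    warped_path E act S (r + 1) x z"

lemma warped_path_in: "warped_path E act S r x y \<Longrightarrow> x \<in> E \<and> y \<in> E"
  by (induction rule: warped_path.induct) auto

lemma warped_path_nonneg: "warped_path E act S r x y \<Longrightarrow> 0 \<le> r"
  by (induction rule: warped_path.induct) auto

text \<open>A path containing a move costs at least 1, one without moves at least the distance. This
  makes the path metric definite.\<close>

lemma warped_path_min_dist: "warped_path E act S r x y \<Longrightarrow> min (dist x y) 1 \<le> r"
proof (induction rule: warped_path.induct)
  case (jump r x y z)
  then show ?case using dist_triangle[of x z y] zero_le_dist[of y z] by linarith
next
  case (move r x y z s)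
  then show ?case using warped_path_nonneg[OF move.hyps(1)] by linarith
qed simp

lemma warped_path_trans:
  assumes "warped_path E act S q y z" "warped_path E act S r x y"
  shows "warped_path E act S (r + q) x z"
  using assms
  by (induction rule: warped_path.induct) (auto simp flip: add.assoc intro: warped_path.intros)

lemma warped_path_sym: "warped_path E act S r x y \<Longrightarrow> warped_path E act S r y x"
proof (induction rule: warped_path.induct)
  case (nil x)
  then show ?case by (rule warped_path.nil)
next
  case (jump r x y z)
  have "warped_path E act S (0 + dist z y) z y"
    using jump.hyps warped_path_in[OF jump.hyps(1)] by (intro warped_path.jump warped_path.nil) auto
  from warped_path_trans[OF jump.IH this] show ?case by (simp add: dist_commute add.commute)
next
  case (move r x y z s)
  have "warped_path E act S (0 + 1) z y"
    using warped_path_in[OF move.hyps(1)]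
    by (intro warped_path.move[OF warped_path.nil _ move.hyps(3)]) (use move.hyps in auto)
  from warped_path_trans[OF move.IH this] show ?case by (simp add: add.commute)
qed

lemma Metric_space_dist: "Metric_space E dist"
  by unfold_locales (auto simp: dist_commute dist_triangle)

text \<open>Path lengths define an admissible metric, so the warped distance is at least that large.\<close>

lemma warped_path_exists:
  fixes E :: "'x::metric_space set"
  assumes act: "\<And>x s. x \<in> E \<Longrightarrow> s \<in> S \<Longrightarrow> act s x \<in> E"
    and xy: "x \<in> E" "y \<in> E" and less: "warped_dist E dist act S x y < R"
  obtains r where "r < R" "warped_path E act S r x y"
proof -
  define P where "P = (\<lambda>x y. {r. warped_path E act S r x y})"
  define \<delta> where "\<delta> = (\<lambda>x y. if x \<in> E \<and> y \<in> E then Inf (P x y) else 0)"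
  have P_dist: "dist x y \<in> P x y" if "x \<in> E" "y \<in> E" for x y
    using warped_path.jump[OF warped_path.nil[OF that(1)] that(2)] by (simp add: P_def)
  have bdd: "bdd_below (P x y)" for x y
    using warped_path_nonneg by (auto simp: P_def intro!: bdd_belowI)
  have upper: "\<delta> x y \<le> r" if "r \<in> P x y" for x y r
  proof -
    have "x \<in> E \<and> y \<in> E" using that warped_path_in unfolding P_def by fast
    then show ?thesis using cInf_lower[OF that bdd] by (simp add: \<delta>_def)
  qed
  have least: "c \<le> \<delta> x y" if "x \<in> E" "y \<in> E" "\<And>r. r \<in> P x y \<Longrightarrow> c \<le> r" for x y c
    using that P_dist by (auto simp: \<delta>_def intro!: cInf_greatest)
  have nonneg: "0 \<le> \<delta> x y" for x y
  proof (cases "x \<in> E \<and> y \<in> E")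
    case True
    then show ?thesis by (intro least) (auto simp: P_def warped_path_nonneg)
  qed (auto simp: \<delta>_def)
  have "warped_admissible E dist act S \<delta>"
    unfolding warped_admissible_def
  proof (intro conjI ballI)
    show "Metric_space E \<delta>"
    proof
      show "0 \<le> \<delta> x y" for x y by (rule nonneg)
      show "\<delta> x y = \<delta> y x" for x y
      proof -
        have "P x y = P y x" by (auto simp: P_def intro: warped_path_sym)
        then show ?thesis by (auto simp: \<delta>_def)
      qed
      show "\<delta> x y = 0 \<longleftrightarrow> x = y" if "x \<in> E" "y \<in> E" for x y
      proof
        assume "\<delta> x y = 0"
        moreover have "min (dist x y) 1 \<le> \<delta> x y"
          using that by (intro least) (auto simp: P_def dest: warped_path_min_dist)
        ultimately have "dist x y \<le> 0" by linarith
        then show "x = y" by simp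
      next
        assume "x = y"
        then have "\<delta> x y \<le> 0" using upper[OF P_dist[OF that]] by simp
        then show "\<delta> x y = 0" using nonneg[of x y] by linarith
      qed
      show "\<delta> x z \<le> \<delta> x y + \<delta> y z" if "x \<in> E" "y \<in> E" "z \<in> E" for x y z
      proof -
        \<comment> \<open>The triangle inequality for infima, one variable at a time: first over the
          paths from x to y with a path of length q fixed, then over q.\<close>
        have "\<delta> x z - q \<le> \<delta> x y" if "q \<in> P y z" for q
        proof (rule least)
          fix r assume "r \<in> P x y"
          then have "r + q \<in> P x z" using that warped_path_trans by (auto simp: P_def)
          then show "\<delta> x z - q \<le> r" using upper by force
        qed fact+
        then have "\<delta> x z - \<delta> x y \<le> \<delta> y z"
          using \<open>y \<in> E\<close> \<open>z \<in> E\<close> by (intro least) force+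
        then show ?thesis by simp
      qed
    qed
    show "\<delta> x x' \<le> dist x x'" if "x \<in> E" "x' \<in> E" for x x'
      using upper P_dist that by blast
    show "\<delta> x (act s x) \<le> 1" if "x \<in> E" "s \<in> S" for x s
    proof (rule upper)
      show "1 \<in> P x (act s x)"
        using warped_path.move[OF warped_path.nil[OF that(1)] act[OF that] that(2)] by (simp add: P_def)
    qed
  qed
  then have "\<delta> x y < R" using warped_dist_greatest less xy by force
  then have "Inf (P x y) < R" using xy by (simp add: \<delta>_def)
  then obtain r where "r \<in> P x y" "r < R"
    using cInf_lessD P_dist[OF xy] by blast
  then show ?thesis using that by (auto simp: P_def)
qed

text \<open>Consecutive jumps merged into one: \<open>reach n q\<close> allows \<open>n\<close> moves and jumps of total length \<open>q\<close>.\<close>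

inductive reach ::
    "'x::metric_space set \<Rightarrow> ('s \<Rightarrow> 'x \<Rightarrow> 'x) \<Rightarrow> 's set \<Rightarrow> nat \<Rightarrow> real \<Rightarrow> 'x \<Rightarrow> 'x \<Rightarrow> bool"
  for E act S where
  start: "x \<in> E \<Longrightarrow> y \<in> E \<Longrightarrow> dist x y \<le> q \<Longrightarrow> reach E act S 0 q x y"
| step: "reach E act S n q x u \<Longrightarrow> v \<in> E \<Longrightarrow> s \<in> S \<Longrightarrow> v = act s u \<or> u = act s v \<Longrightarrow>
    y \<in> E \<Longrightarrow> dist v y \<le> q' \<Longrightarrow> reach E act S (Suc n) (q + q') x y"

lemma reach_in: "reach E act S n q x y \<Longrightarrow> x \<in> E \<and> y \<in> E \<and> 0 \<le> q"
  by (induction rule: reach.induct) (auto intro: order_trans[OF zero_le_dist] add_nonneg_nonneg)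

text \<open>The final jump of the chain absorbs a further one by the triangle inequality.\<close>

lemma reach_jump:
  assumes "reach E act S n q x y" "z \<in> E"
  shows "reach E act S n (q + dist y z) x z"
  using assms(1)
proof cases
  case start
  then show ?thesis using assms(2) dist_triangle[of x z y] by (auto intro: reach.start)
next
  case (step n q u v s q')
  then have "reach E act S (Suc n) (q + (q' + dist y z)) x z"
    using assms(2) dist_triangle[of v z y] by (intro reach.step[where v = v and s = s]) auto
  then show ?thesis using step by (simp add: add.assoc)
qed

text \<open>Splits the cost into a number of moves and a jump length, so that a bound on the cost
  bounds both.\<close>

lemma warped_path_reach:
  "warped_path E act S r x y \<Longrightarrow> \<exists>n q. r = real n + q \<and> reach E act S n q x y"
proof (induction rule: warped_path.induct)
  case (nil x)
  then show ?case by (intro exI[of _ 0] exI[of _ 0]) (auto intro: reach.start)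
next
  case (jump r x y z)
  then obtain n q where "r = real n + q" "reach E act S n q x y" by blast
  then show ?case using reach_jump jump.hyps(2) by (metis add.assoc)
next
  case (move r x y z s)
  then obtain n q where nq: "r = real n + q" "reach E act S n q x y" by blast
  have "reach E act S (Suc n) (q + 0) x z"
    using nq(2) move.hyps by (intro reach.step[where v = z and s = s]) auto
  then show ?case using nq(1) by (intro exI[of _ "Suc n"] exI[of _ q]) auto
qed

text \<open>A jump of length r changes the radius by at most r; rescaling the second point to radius
  t costs another r, hence the factor 2 in the change of direction.\<close>

lemma norm_diff_directions:
  fixes a b :: "'e::real_normed_vector"
  assumes "norm a = 1" "norm b = 1" "0 \<le> t" "0 \<le> t'" "dist (t *\<^sub>R a) (t' *\<^sub>R b) \<le> r"
  shows "t - r \<le> t'" "t * dist a b \<le> 2 * r"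
proof -
  have "\<bar>t - t'\<bar> \<le> dist (t *\<^sub>R a) (t' *\<^sub>R b)"
    using norm_triangle_ineq3[of "t *\<^sub>R a" "t' *\<^sub>R b"] assms by (simp add: dist_norm)
  then have tt: "\<bar>t - t'\<bar> \<le> r" using assms(5) by linarith
  then show "t - r \<le> t'" by linarith
  have "t * dist a b = norm (t *\<^sub>R a - t *\<^sub>R b)"
    using assms(3) by (simp add: dist_norm scaleR_diff_right[symmetric])
  also have "t *\<^sub>R a - t *\<^sub>R b = (t *\<^sub>R a - t' *\<^sub>R b) + (t' - t) *\<^sub>R b"
    by (simp add: algebra_simps)
  also have "norm \<dots> \<le> norm (t *\<^sub>R a - t' *\<^sub>R b) + norm ((t' - t) *\<^sub>R b)"
    by (rule norm_triangle_ineq)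
  also have "\<dots> \<le> 2 * r" using assms tt by (simp add: dist_norm abs_minus_commute)
  finally show "t * dist a b \<le> 2 * r" .
qed

section \<open>Translations in the warped cone at large height\<close>

locale spherical_warped_cone = spherical_group G e
  for G :: "'a monoid" (structure) and e :: "'a \<Rightarrow> 'e::euclidean_space" +
  fixes S :: "'a set"
  assumes finite_S: "finite S" and S_sub: "S \<subseteq> carrier G"
begin

abbreviation cone where "cone \<equiv> open_cone e (carrier G)"
abbreviation cact where "cact \<equiv> cone_act e (carrier G) (\<lambda>\<gamma> x. \<gamma> \<otimes> x)"
abbreviation cdist where "cdist \<equiv> warped_cone_dist G e S"

lemma cact: "0 \<le> t \<Longrightarrow> g \<in> carrier G \<Longrightarrow> cact s (t *\<^sub>R e g) = t *\<^sub>R e (s \<otimes> g)"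
  using cone_act_eq[OF sphere inj] .

lemma coneI: "0 \<le> t \<Longrightarrow> g \<in> carrier G \<Longrightarrow> t *\<^sub>R e g \<in> cone"
  by (auto simp: open_cone_def)

lemma coneE:
  assumes "x \<in> cone"
  obtains t g where "0 \<le> t" "g \<in> carrier G" "x = t *\<^sub>R e g"
  using assms by (auto simp: open_cone_def)

lemma cact_closed: "x \<in> cone \<Longrightarrow> s \<in> S \<Longrightarrow> cact s x \<in> cone"
  using S_sub by (elim coneE) (auto simp: cact intro!: coneI)

lemma polar_unique:
  assumes "0 \<le> t" "0 \<le> t'" "g \<in> carrier G" "g' \<in> carrier G" "t *\<^sub>R e g = t' *\<^sub>R e g'"
  shows "t = t'" "0 < t \<Longrightarrow> g = g'"
proof -
  have "\<bar>t\<bar> * norm (e g) = \<bar>t'\<bar> * norm (e g')" using assms(5) by (metis norm_scaleR)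
  then show t: "t = t'" using assms(1-4) norm_e by simp
  show "g = g'" if "0 < t"
  proof -
    have "e g = e g'" using assms(5) t that by simp
    then show ?thesis using inj assms by (simp add: inj_on_eq_iff)
  qed
qed

lemma warped_admissible_cdist: "warped_admissible cone dist cact S cdist"
  unfolding warped_cone_dist_def
  by (rule warped_admissible_warped_dist[OF Metric_space_dist cact_closed])

lemma Metric_space_cdist: "Metric_space cone cdist"
  using warped_admissible_cdist by (simp add: warped_admissible_def)

lemma cdist_le_dist: "x \<in> cone \<Longrightarrow> y \<in> cone \<Longrightarrow> cdist x y \<le> dist x y"
  using warped_admissible_cdist by (simp add: warped_admissible_def)

lemma cdist_cact: "x \<in> cone \<Longrightarrow> s \<in> S \<Longrightarrow> cdist x (cact s x) \<le> 1"
  using warped_admissible_cdist by (simp add: warped_admissible_def)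

lemma cdist_nonneg: "0 \<le> cdist x y"
  using Metric_space.nonneg[OF Metric_space_cdist] .

text \<open>Generators act at cost 1 at every height, so the length of any expression of \<gamma> in
  the generators and their inverses is a bound independent of t and g.\<close>

lemma cdist_translate_bounded:
  assumes "\<gamma> \<in> generate G S"
  shows "\<exists>b. \<forall>t\<ge>0. \<forall>g\<in>carrier G. cdist (t *\<^sub>R e (\<gamma> \<otimes> g)) (t *\<^sub>R e g) \<le> b"
  using assms
proof (induction rule: generate.induct)
  case one
  have "cdist (t *\<^sub>R e (\<one> \<otimes> g)) (t *\<^sub>R e g) = 0" if "0 \<le> t" "g \<in> carrier G" for t g
    using Metric_space.zero[OF Metric_space_cdist] that coneI by simp
  then show ?case by (intro exI[of _ 0]) auto
next
  case (incl s)
  have "cdist (t *\<^sub>R e (s \<otimes> g)) (t *\<^sub>R e g) \<le> 1" if "0 \<le> t" "g \<in> carrier G" for t g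
    using cdist_cact[OF coneI[OF that] incl] that
    by (simp add: cact Metric_space.commute[OF Metric_space_cdist])
  then show ?case by blast
next
  case (inv s)
  have s: "s \<in> carrier G" using inv S_sub by blast
  have "cdist (t *\<^sub>R e (inv s \<otimes> g)) (t *\<^sub>R e g) \<le> 1" if "0 \<le> t" "g \<in> carrier G" for t g
    using cdist_cact[OF coneI inv, of t "inv s \<otimes> g"] that s
    by (simp add: cact flip: m_assoc)
  then show ?case by blast
next
  case (eng a b)
  then obtain r q where
    r: "\<forall>t\<ge>0. \<forall>g\<in>carrier G. cdist (t *\<^sub>R e (a \<otimes> g)) (t *\<^sub>R e g) \<le> r" and
    q: "\<forall>t\<ge>0. \<forall>g\<in>carrier G. cdist (t *\<^sub>R e (b \<otimes> g)) (t *\<^sub>R e g) \<le> q" by blast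
  have ab: "a \<in> carrier G" "b \<in> carrier G"
    using eng generate_in_carrier[OF S_sub] by auto
  have "cdist (t *\<^sub>R e (a \<otimes> b \<otimes> g)) (t *\<^sub>R e g) \<le> r + q" if t: "0 \<le> t" and g: "g \<in> carrier G" for t g
  proof -
    have "cdist (t *\<^sub>R e (a \<otimes> (b \<otimes> g))) (t *\<^sub>R e g)
      \<le> cdist (t *\<^sub>R e (a \<otimes> (b \<otimes> g))) (t *\<^sub>R e (b \<otimes> g)) + cdist (t *\<^sub>R e (b \<otimes> g)) (t *\<^sub>R e g)"
      using ab g t by (intro Metric_space.triangle[OF Metric_space_cdist] coneI) auto
    also have "\<dots> \<le> r + q" using r q ab g t by (intro add_mono) auto
    finally show ?thesis using ab g by (simp add: m_assoc)
  qed
  then show ?case by blast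
qed

text \<open>Exactly n letters, to match the count of moves; a new letter is put on the left because
  the latest move acts last. The words of at most N letters form the ball of radius N in the word
  metric.\<close>

primrec words :: "nat \<Rightarrow> 'a set" where
  "words 0 = {\<one>}"
| "words (Suc n) = (\<Union>s\<in>S. (\<lambda>w. s \<otimes> w) ` words n \<union> (\<lambda>w. inv s \<otimes> w) ` words n)"

lemma finite_words: "finite (words n)"
  by (induction n) (auto simp: finite_S)

lemma words_carrier: "words n \<subseteq> carrier G"
proof (induction n)
  case (Suc n)
  then show ?case using S_sub by auto
qed simp

text \<open>At height t, jumps of total length at most R turn the direction only by an error of
  order R / t, so after n moves the direction is nearly that of w \<otimes> g, with w the word read
  off from the moves. The induction needs arbitrary \<epsilon> because the earlier error must stay
  below \<epsilon> / 2 after translation by one more letter.\<close>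

lemma reach_direction:
  assumes "0 < \<epsilon>"
  shows "\<forall>\<^sub>F t in at_top. \<forall>g\<in>carrier G. \<forall>q\<le>R. \<forall>y. reach cone cact S n q (t *\<^sub>R e g) y \<longrightarrow>
    (\<exists>t' g' w. t - q \<le> t' \<and> 0 \<le> t' \<and> g' \<in> carrier G \<and> w \<in> words n \<and> y = t' *\<^sub>R e g' \<and>
      dist (e g') (e (w \<otimes> g)) < \<epsilon>)"
  using assms
proof (induction n arbitrary: \<epsilon>)
  case 0
  show ?case
    using eventually_gt_at_top[of "max 0 (2 * R / \<epsilon>)"]
  proof eventually_elim
    case (elim t)
    then have t: "0 < t" "2 * R < t * \<epsilon>" using 0 by (simp_all add: pos_divide_less_eq)
    show ?case
    proof (intro ballI allI impI)
      fix g q y assume g: "g \<in> carrier G" and q: "q \<le> R" and "reach cone cact S 0 q (t *\<^sub>R e g) y"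
      then have y: "y \<in> cone" "dist (t *\<^sub>R e g) y \<le> q" by (auto elim: reach.cases)
      obtain t' g' where y': "0 \<le> t'" "g' \<in> carrier G" "y = t' *\<^sub>R e g'" using coneE[OF y(1)] by blast
      have "t - q \<le> t'" "t * dist (e g) (e g') \<le> 2 * q"
        using norm_diff_directions[of "e g" "e g'" t t' q] t g y y' norm_e by auto
      moreover have "t * dist (e g) (e g') < t * \<epsilon>" using calculation(2) q t by linarith
      then have "dist (e g') (e g) < \<epsilon>" using t by (simp add: dist_commute)
      ultimately show "\<exists>t' g' w. t - q \<le> t' \<and> 0 \<le> t' \<and> g' \<in> carrier G \<and> w \<in> words 0 \<and> y = t' *\<^sub>R e g' \<and>
          dist (e g') (e (w \<otimes> g)) < \<epsilon>"
        using y' g by (intro exI[of _ t'] exI[of _ g'] exI[of _ \<one>]) auto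
    qed
  qed
next
  case (Suc n)
  obtain \<delta> where \<delta>: "0 < \<delta>" "\<And>z x y. z \<in> carrier G \<Longrightarrow> x \<in> carrier G \<Longrightarrow> y \<in> carrier G \<Longrightarrow>
    dist (e x) (e y) < \<delta> \<Longrightarrow> dist (e (z \<otimes> x)) (e (z \<otimes> y)) < \<epsilon> / 2"
    using unif_left[OF half_gt_zero[OF Suc.prems]] by metis
  show ?case
    \<comment> \<open>The last jump starts at height at least t - R, which must be positive, and may
      add only \<epsilon> / 2 to the error, which requires 2 * R / (t - R) < \<epsilon> / 2.\<close>
    using Suc.IH[OF \<delta>(1)] eventually_gt_at_top[of "max R (R + 4 * R / \<epsilon>)"]
  proof eventually_elim
    case (elim t)
    have "4 * R / \<epsilon> < t - R" using elim(2) by simp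
    then have tR: "R < t" "4 * R < (t - R) * \<epsilon>"
      using elim(2) Suc.prems by (simp_all add: pos_divide_less_eq)
    show ?case
    proof (intro ballI allI impI)
      fix g q y assume g: "g \<in> carrier G" and q: "q \<le> R" and "reach cone cact S (Suc n) q (t *\<^sub>R e g) y"
      then obtain q1 u v s q2 where q_eq: "q = q1 + q2" and u: "reach cone cact S n q1 (t *\<^sub>R e g) u"
        and v: "v \<in> cone" and s: "s \<in> S" and uv: "v = cact s u \<or> u = cact s v"
        and y: "y \<in> cone" "dist v y \<le> q2"
        by (auto elim: reach.cases)
      have q2: "0 \<le> q2" using y(2) zero_le_dist[of v y] by linarith
      have q1: "0 \<le> q1" using reach_in[OF u] by blast
      have "q1 \<le> R" using q q_eq q2 by linarith
      then obtain t1 g1 w where t1: "t - q1 \<le> t1" and g1: "g1 \<in> carrier G" and w: "w \<in> words n"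
        and u_eq: "u = t1 *\<^sub>R e g1" and close: "dist (e g1) (e (w \<otimes> g)) < \<delta>"
        using elim(1)[rule_format, OF g _ u] by blast
      have t1_pos: "0 < t1" using t1 tR q q_eq q2 by linarith
      have sG: "s \<in> carrier G" using s S_sub by blast
      have wG: "w \<in> carrier G" using w words_carrier by blast
      obtain z where z: "z = s \<or> z = inv s" and v_eq: "v = t1 *\<^sub>R e (z \<otimes> g1)"
      proof (cases "v = cact s u")
        case True
        then show ?thesis using that[of s] u_eq cact t1_pos g1 by simp
      next
        case False
        \<comment> \<open>A move along the inverse of s: since polar coordinates are unique at
          positive height, \<open>u = cact s v\<close> determines v.\<close>
        obtain t2 g2 where g2: "0 \<le> t2" "g2 \<in> carrier G" "v = t2 *\<^sub>R e g2" using coneE[OF v] by blast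
        have "t1 *\<^sub>R e g1 = t2 *\<^sub>R e (s \<otimes> g2)" using False uv g2 u_eq by (simp add: cact)
        then have "t1 = t2" "g1 = s \<otimes> g2"
          using polar_unique[of t1 t2 g1 "s \<otimes> g2"] t1_pos g1 g2 sG by auto
        then have "v = t1 *\<^sub>R e (inv s \<otimes> g1)" using g2 sG by (simp flip: m_assoc)
        then show ?thesis using that[of "inv s"] by blast
      qed
      have zG: "z \<in> carrier G" using z sG by auto
      have zw: "z \<otimes> w \<in> words (Suc n)" using z s w by auto
      obtain t' g' where y': "0 \<le> t'" "g' \<in> carrier G" "y = t' *\<^sub>R e g'" using coneE[OF y(1)] by blast
      have *: "t1 - q2 \<le> t'" "t1 * dist (e (z \<otimes> g1)) (e g') \<le> 2 * q2"
        using norm_diff_directions[of "e (z \<otimes> g1)" "e g'" t1 t' q2] t1_pos zG g1 y y' v_eq norm_e by auto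
      have "(t - R) * dist (e (z \<otimes> g1)) (e g') \<le> t1 * dist (e (z \<otimes> g1)) (e g')"
        using t1 q q_eq q2 by (intro mult_right_mono) auto
      also have "\<dots> < (t - R) * (\<epsilon> / 2)" using * tR q q_eq q1 by simp
      finally have "dist (e (z \<otimes> g1)) (e g') < \<epsilon> / 2" using tR by simp
      moreover have "dist (e (z \<otimes> g1)) (e (z \<otimes> (w \<otimes> g))) < \<epsilon> / 2"
        using \<delta>(2) zG g1 wG g close by simp
      ultimately have "dist (e g') (e (z \<otimes> w \<otimes> g)) < \<epsilon>"
        using dist_triangle_half_r zG wG g by (simp add: m_assoc)
      then show "\<exists>t' g' w. t - q \<le> t' \<and> 0 \<le> t' \<and> g' \<in> carrier G \<and> w \<in> words (Suc n) \<and> y = t' *\<^sub>R e g' \<and>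
          dist (e g') (e (w \<otimes> g)) < \<epsilon>"
        using y' * t1 q_eq zw by (intro exI[of _ t'] exI[of _ g'] exI[of _ "z \<otimes> w"]) auto
    qed
  qed
qed

text \<open>Freeness made quantitative: right multiplication by inv g takes \<gamma> \<otimes> g and
  w \<otimes> g back to \<gamma> and w, with a modulus independent of g.\<close>

lemma translates_separated:
  assumes "\<gamma> \<in> carrier G" "w \<in> carrier G" "w \<noteq> \<gamma>"
  obtains \<delta> where "0 < \<delta>" "\<And>g. g \<in> carrier G \<Longrightarrow> \<delta> \<le> dist (e (\<gamma> \<otimes> g)) (e (w \<otimes> g))"
proof -
  have "0 < dist (e \<gamma>) (e w)" using assms inj by (auto simp: inj_on_eq_iff)
  then obtain \<delta> where \<delta>: "0 < \<delta>" "\<And>z x y. z \<in> carrier G \<Longrightarrow> x \<in> carrier G \<Longrightarrow> y \<in> carrier G \<Longrightarrow>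
    dist (e x) (e y) < \<delta> \<Longrightarrow> dist (e (x \<otimes> z)) (e (y \<otimes> z)) < dist (e \<gamma>) (e w)"
    using unif_right by metis
  have "\<delta> \<le> dist (e (\<gamma> \<otimes> g)) (e (w \<otimes> g))" if "g \<in> carrier G" for g
    using \<delta>(2)[of "inv g" "\<gamma> \<otimes> g" "w \<otimes> g"] that assms by (auto simp: m_assoc not_less[symmetric])
  then show ?thesis using that \<delta>(1) by blast
qed

text \<open>A path cheaper than N has at most N moves and jumps of total length at most N, so at
  large height it ends near the direction of w \<otimes> g for one of finitely many words w. All of
  these keep a fixed distance from \<gamma> \<otimes> g.\<close>

lemma cdist_translate_eventually_large:
  assumes \<gamma>: "\<gamma> \<in> carrier G" "\<gamma> \<notin> (\<Union>n\<le>N. words n)"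
  shows "\<forall>\<^sub>F t in at_top. \<forall>g\<in>carrier G. real N \<le> cdist (t *\<^sub>R e (\<gamma> \<otimes> g)) (t *\<^sub>R e g)"
proof -
  define W where "W = (\<Union>n\<le>N. words n)"
  have W: "finite W" "W \<subseteq> carrier G" using finite_words words_carrier by (auto simp: W_def)
  have "\<forall>w\<in>W. \<exists>\<delta>>0. \<forall>g\<in>carrier G. \<delta> \<le> dist (e (\<gamma> \<otimes> g)) (e (w \<otimes> g))"
    using translates_separated[OF \<gamma>(1)] W(2) \<gamma>(2) unfolding W_def by (metis subsetD)
  then obtain f where f: "\<And>w. w \<in> W \<Longrightarrow> 0 < f w"
    "\<And>w g. w \<in> W \<Longrightarrow> g \<in> carrier G \<Longrightarrow> f w \<le> dist (e (\<gamma> \<otimes> g)) (e (w \<otimes> g))" by metis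
  define \<delta> where "\<delta> = Min (insert 1 (f ` W))"
  have \<delta>: "0 < \<delta>" "\<And>w. w \<in> W \<Longrightarrow> \<delta> \<le> f w" using W(1) f(1) by (auto simp: \<delta>_def)
  have "\<forall>\<^sub>F t in at_top. \<forall>n\<in>{..N}. \<forall>g\<in>carrier G. \<forall>q\<le>real N. \<forall>y. reach cone cact S n q (t *\<^sub>R e g) y \<longrightarrow>
    (\<exists>t' g' w. t - q \<le> t' \<and> 0 \<le> t' \<and> g' \<in> carrier G \<and> w \<in> words n \<and> y = t' *\<^sub>R e g' \<and>
      dist (e g') (e (w \<otimes> g)) < \<delta>)"
    by (intro eventually_ball_finite ballI reach_direction \<delta>) simp
  then show ?thesis
    using eventually_gt_at_top[of 0]
  proof eventually_elim
    case (elim t)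
    show ?case
    proof (intro ballI, rule ccontr)
      fix g assume g: "g \<in> carrier G" and "\<not> real N \<le> cdist (t *\<^sub>R e (\<gamma> \<otimes> g)) (t *\<^sub>R e g)"
      then have "warped_dist cone dist cact S (t *\<^sub>R e g) (t *\<^sub>R e (\<gamma> \<otimes> g)) < real N"
        using Metric_space.commute[OF Metric_space_cdist] by (simp add: warped_cone_dist_def)
      then obtain r where r: "r < real N" "warped_path cone cact S r (t *\<^sub>R e g) (t *\<^sub>R e (\<gamma> \<otimes> g))"
        using warped_path_exists[of cone S cact, OF cact_closed coneI[of t g] coneI[of t "\<gamma> \<otimes> g"]] g \<gamma>(1) elim(2)
        by (metis less_imp_le m_closed)
      then obtain n q where nq: "r = real n + q" "reach cone cact S n q (t *\<^sub>R e g) (t *\<^sub>R e (\<gamma> \<otimes> g))"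
        using warped_path_reach by blast
      moreover have "0 \<le> q" using reach_in[OF nq(2)] by blast
      ultimately have "n \<le> N" "q \<le> real N" using r(1) by linarith+
      then obtain t' g' w where w: "0 \<le> t'" "g' \<in> carrier G" "w \<in> words n"
        "t *\<^sub>R e (\<gamma> \<otimes> g) = t' *\<^sub>R e g'" "dist (e g') (e (w \<otimes> g)) < \<delta>"
        using elim(1)[rule_format, OF _ g _ nq(2)] by auto
      then have "g' = \<gamma> \<otimes> g" using polar_unique[of t t' "\<gamma> \<otimes> g" g'] elim(2) \<gamma>(1) g by simp
      moreover have "w \<in> W" using w(3) \<open>n \<le> N\<close> by (auto simp: W_def)
      ultimately show False using \<delta>(2)[of w] f(2)[of w g] g w(5) by simp
    qed
  qed
qed

theorem haagerup_if_embeddable: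
  assumes "uniformly_embeddable TYPE('h::{real_inner, complete_space}) cone cdist"
  shows "haagerup_property (G\<lparr>carrier := generate G S\<rparr>)"
proof -
  let ?\<Gamma> = "generate G S"
  have sub: "subgroup ?\<Gamma> G" using generate_is_subgroup[OF S_sub] .
  then have \<Gamma>G: "?\<Gamma> \<subseteq> carrier G" by (rule subgroup.subset)
  have grp: "group (G\<lparr>carrier := ?\<Gamma>\<rparr>)" using subgroup_imp_group[OF sub] .
  obtain F :: "'e \<Rightarrow> 'h" and \<rho>1 \<rho>2 where \<rho>: "control_function \<rho>1" "control_function \<rho>2"
    and F1: "\<And>x y. x \<in> cone \<Longrightarrow> y \<in> cone \<Longrightarrow> \<rho>1 (cdist x y) \<le> norm (F x - F y)"
    and F2: "\<And>x y. x \<in> cone \<Longrightarrow> y \<in> cone \<Longrightarrow> norm (F x - F y) \<le> \<rho>2 (cdist x y)"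
    using assms unfolding uniformly_embeddable_def by blast
  have \<rho>_mono: "\<rho>1 s \<le> \<rho>1 t" "\<rho>2 s \<le> \<rho>2 t" if "0 \<le> s" "s \<le> t" for s t
    using \<rho> that unfolding control_function_def mono_on_def by auto
  \<comment> \<open>Points of the cone at Euclidean distance below 1 have warped distance at most 1,
    so C bounds the oscillation of F at this scale.\<close>
  define C where "C = \<rho>2 1"
  have C: "0 \<le> C" using \<rho>(2) by (simp add: C_def control_function_def)
  \<comment> \<open>Smoothing takes place on each copy of G separately, at integer heights n; what
    must be common to all heights is the constant C.\<close>
  have "\<exists>F'. continuous_on ((\<lambda>x. real n *\<^sub>R x) ` e ` carrier G) F' \<and>
      (\<forall>x\<in>(\<lambda>x. real n *\<^sub>R x) ` e ` carrier G. norm (F' x - F x) \<le> C)" for n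
  proof (rule compact_smoothing[of "(\<lambda>x. real n *\<^sub>R x) ` e ` carrier G" F C])
    show "compact ((\<lambda>x. real n *\<^sub>R x) ` e ` carrier G)" by (intro compact_scaling compact)
    fix x y assume "x \<in> (\<lambda>x. real n *\<^sub>R x) ` e ` carrier G" "y \<in> (\<lambda>x. real n *\<^sub>R x) ` e ` carrier G"
      and d: "dist x y < 1"
    then have xy: "x \<in> cone" "y \<in> cone" by (auto intro: coneI)
    then have "cdist x y \<le> 1" using cdist_le_dist[OF xy] d by linarith
    then show "norm (F x - F y) \<le> C"
      unfolding C_def using F2[OF xy] \<rho>_mono(2)[OF cdist_nonneg] by (meson order_trans)
  qed blast
  then obtain F' where F'_cont: "\<And>n. continuous_on ((\<lambda>x. real n *\<^sub>R x) ` e ` carrier G) (F' n)"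
    and F': "\<And>n g. g \<in> carrier G \<Longrightarrow> norm (F' n (real n *\<^sub>R e g) - F (real n *\<^sub>R e g)) \<le> C"
    by (metis image_eqI)
  define u where "u = (\<lambda>n g. F' n (real n *\<^sub>R e g))"
  have u_diff: "\<bar>norm (u n x - u n y) - norm (F (real n *\<^sub>R e x) - F (real n *\<^sub>R e y))\<bar> \<le> 2 * C"
    if "x \<in> carrier G" "y \<in> carrier G" for n x y
  proof -
    let ?a = "F (real n *\<^sub>R e x)" and ?b = "F (real n *\<^sub>R e y)"
    have "\<bar>norm (u n x - u n y) - norm (?a - ?b)\<bar> \<le> norm ((u n x - u n y) - (?a - ?b))"
      by (rule norm_triangle_ineq3)
    also have "(u n x - u n y) - (?a - ?b) = (u n x - ?a) - (u n y - ?b)" by simp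
    also have "norm \<dots> \<le> norm (u n x - ?a) + norm (u n y - ?b)" by (rule norm_triangle_ineq4)
    also have "\<dots> \<le> 2 * C" using F'[OF that(1), of n] F'[OF that(2), of n] by (simp add: u_def)
    finally show ?thesis .
  qed
  have "unif_cont (\<lambda>g. (norm (u n (a \<otimes> g) - u n (b \<otimes> g)))\<^sup>2)" if "a \<in> carrier G" "b \<in> carrier G" for n a b
  proof -
    have "continuous_on (e ` carrier G \<times> e ` carrier G)
      (\<lambda>p. (norm (F' n (real n *\<^sub>R fst p) - F' n (real n *\<^sub>R snd p)))\<^sup>2)"
      by (intro continuous_intros continuous_on_compose2[OF F'_cont]) auto
    from unif_cont_translates[OF this that] show ?thesis by (simp add: u_def)
  qed
  then have "\<exists>h. conditionally_negative_type G h \<and>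
    (\<forall>a\<in>carrier G. \<forall>r. (\<forall>g\<in>carrier G. norm (u n (a \<otimes> g) - u n g) \<le> r) \<longrightarrow> h a \<le> r\<^sup>2) \<and>
    (\<forall>a\<in>carrier G. \<forall>r\<ge>0. (\<forall>g\<in>carrier G. r \<le> norm (u n (a \<otimes> g) - u n g)) \<longrightarrow> r\<^sup>2 \<le> h a)" for n
    using mean_square_displacement[of "u n"] by (metis (no_types, lifting))
  then obtain H where H_neg: "\<And>n. conditionally_negative_type G (H n)"
    and H_le: "\<And>n a r. a \<in> carrier G \<Longrightarrow> (\<And>g. g \<in> carrier G \<Longrightarrow> norm (u n (a \<otimes> g) - u n g) \<le> r) \<Longrightarrow> H n a \<le> r\<^sup>2"
    and H_ge: "\<And>n a r. a \<in> carrier G \<Longrightarrow> 0 \<le> r \<Longrightarrow> (\<And>g. g \<in> carrier G \<Longrightarrow> r \<le> norm (u n (a \<otimes> g) - u n g)) \<Longrightarrow> r\<^sup>2 \<le> H n a"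
    by metis
  have H_nonneg: "0 \<le> H n a" if "a \<in> carrier G" for n a
    using H_ge[OF that, of 0 n] by simp
  obtain b where b: "\<And>\<gamma> t g. \<gamma> \<in> ?\<Gamma> \<Longrightarrow> 0 \<le> t \<Longrightarrow> g \<in> carrier G \<Longrightarrow> cdist (t *\<^sub>R e (\<gamma> \<otimes> g)) (t *\<^sub>R e g) \<le> b \<gamma>"
    using cdist_translate_bounded by metis
  have H_bound: "H n \<gamma> \<le> (\<rho>2 (b \<gamma>) + 2 * C)\<^sup>2" if \<gamma>: "\<gamma> \<in> ?\<Gamma>" for n \<gamma>
  proof (rule H_le)
    show \<gamma>G: "\<gamma> \<in> carrier G" using \<gamma> \<Gamma>G by blast
    fix g assume g: "g \<in> carrier G"
    have "norm (F (real n *\<^sub>R e (\<gamma> \<otimes> g)) - F (real n *\<^sub>R e g)) \<le> \<rho>2 (cdist (real n *\<^sub>R e (\<gamma> \<otimes> g)) (real n *\<^sub>R e g))"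
      using g \<gamma>G by (intro F2 coneI) auto
    also have "\<dots> \<le> \<rho>2 (b \<gamma>)" using b[OF \<gamma> _ g] by (intro \<rho>_mono cdist_nonneg) auto
    finally show "norm (u n (\<gamma> \<otimes> g) - u n g) \<le> \<rho>2 (b \<gamma>) + 2 * C"
      using u_diff[of "\<gamma> \<otimes> g" g n] g \<gamma>G by simp
  qed
  \<comment> \<open>The bound \<open>b \<gamma>\<close> is established only on \<Gamma>, whereas the
    cluster point requires one at every index; the value 0 supplies it elsewhere.\<close>
  have "\<bar>if \<gamma> \<in> ?\<Gamma> then H n \<gamma> else 0\<bar> \<le> (\<rho>2 (b \<gamma>) + 2 * C)\<^sup>2" for n \<gamma>
    using H_bound[of \<gamma> n] H_nonneg[of \<gamma> n] \<Gamma>G by auto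
  then obtain U h where U: "U \<noteq> bot" "U \<le> sequentially"
    and h: "\<And>\<gamma>. ((\<lambda>n. if \<gamma> \<in> ?\<Gamma> then H n \<gamma> else 0) \<longlongrightarrow> h \<gamma>) U"
    using pointwise_convergent_subfilter[of "\<lambda>n \<gamma>. if \<gamma> \<in> ?\<Gamma> then H n \<gamma> else 0" "\<lambda>\<gamma>. (\<rho>2 (b \<gamma>) + 2 * C)\<^sup>2"]
    by metis
  have h: "((\<lambda>n. H n \<gamma>) \<longlongrightarrow> h \<gamma>) U" if "\<gamma> \<in> ?\<Gamma>" for \<gamma>
    using h[of \<gamma>] that by simp
  have "conditionally_negative_type (G\<lparr>carrier := ?\<Gamma>\<rparr>) h"
  proof (rule conditionally_negative_type_tendsto[OF grp U(1)])
    show "conditionally_negative_type (G\<lparr>carrier := ?\<Gamma>\<rparr>) (H n)" for n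
      by (rule conditionally_negative_type_subgroup[OF is_group sub H_neg])
    show "((\<lambda>n. H n g) \<longlongrightarrow> h g) U" if "g \<in> carrier (G\<lparr>carrier := ?\<Gamma>\<rparr>)" for g
      using h that by simp
  qed
  moreover have "0 \<le> h \<gamma>" if "\<gamma> \<in> ?\<Gamma>" for \<gamma>
    using tendsto_lowerbound[OF h[OF that] _ U(1)] H_nonneg that \<Gamma>G by (auto intro: always_eventually)
  moreover have "finite {\<gamma> \<in> ?\<Gamma>. h \<gamma> \<le> B}" for B
  proof -
    \<comment> \<open>Chosen so that \<open>r\<^sup>2\<close> exceeds B, whose sign is
      arbitrary.\<close>
    define r where "r = sqrt \<bar>B\<bar> + 1"
    have sqrt: "0 \<le> sqrt \<bar>B\<bar>" by simp
    then have r: "0 \<le> r" by (simp add: r_def)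
    have "r\<^sup>2 = \<bar>B\<bar> + 1 + 2 * sqrt \<bar>B\<bar>" by (simp add: r_def power2_sum)
    then have Br: "B < r\<^sup>2" using sqrt by linarith
    have "\<not> (\<forall>y\<in>\<rho>1 ` {0..}. y \<le> r + 2 * C)"
      using \<rho>(1) unfolding control_function_def bdd_above_def by blast
    \<comment> \<open>The margin 2 * C makes up for the loss in passing from F to the smoothed
      maps.\<close>
    then obtain R where R: "0 \<le> R" "r + 2 * C < \<rho>1 R" by (auto simp: not_le)
    obtain N :: nat where N: "R \<le> real N" using real_arch_simple by blast
    have "{\<gamma> \<in> ?\<Gamma>. h \<gamma> \<le> B} \<subseteq> (\<Union>n\<le>N. words n)"
    proof (rule subsetI, rule ccontr)
      fix \<gamma> assume \<gamma>: "\<gamma> \<in> {\<gamma> \<in> ?\<Gamma>. h \<gamma> \<le> B}" and not: "\<gamma> \<notin> (\<Union>n\<le>N. words n)"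
      have \<gamma>G: "\<gamma> \<in> carrier G" using \<gamma> \<Gamma>G by blast
      \<comment> \<open>Here U has to lie below \<open>sequentially\<close>: the lower bound holds
        only at large heights.\<close>
      have "\<forall>\<^sub>F n in U. \<forall>g\<in>carrier G. real N \<le> cdist (real n *\<^sub>R e (\<gamma> \<otimes> g)) (real n *\<^sub>R e g)"
        using eventually_compose_filterlim[OF cdist_translate_eventually_large[OF \<gamma>G not] filterlim_real_sequentially]
          filter_leD[OF U(2)] by blast
      then have "\<forall>\<^sub>F n in U. r\<^sup>2 \<le> H n \<gamma>"
      proof eventually_elim
        case (elim n)
        show ?case
        proof (rule H_ge[OF \<gamma>G r])
          fix g assume g: "g \<in> carrier G"
          have "\<rho>1 R \<le> \<rho>1 (cdist (real n *\<^sub>R e (\<gamma> \<otimes> g)) (real n *\<^sub>R e g))"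
            using elim g N by (intro \<rho>_mono R(1)) force
          also have "\<dots> \<le> norm (F (real n *\<^sub>R e (\<gamma> \<otimes> g)) - F (real n *\<^sub>R e g))"
            using g \<gamma>G by (intro F1 coneI) auto
          finally show "r \<le> norm (u n (\<gamma> \<otimes> g) - u n g)"
            using u_diff[of "\<gamma> \<otimes> g" g n] g \<gamma>G R(2) by simp
        qed
      qed
      then have "r\<^sup>2 \<le> h \<gamma>" using tendsto_lowerbound[OF h _ U(1)] \<gamma> by blast
      then show False using \<gamma> Br by simp
    qed
    then show ?thesis by (rule finite_subset) (auto simp: finite_words)
  qed
  ultimately show ?thesis unfolding haagerup_property_def by auto
qed

end

section \<open>Schoenberg's theorem\<close>

text \<open>Symmetry is demanded separately because a real quadratic form does not see the
  antisymmetric part of K.\<close>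

definition psd_on :: "'a set \<Rightarrow> ('a \<Rightarrow> 'a \<Rightarrow> real) \<Rightarrow> bool" where
  "psd_on A K \<longleftrightarrow> (\<forall>x\<in>A. \<forall>y\<in>A. K x y = K y x) \<and>
    (\<forall>F c. finite F \<and> F \<subseteq> A \<longrightarrow> 0 \<le> (\<Sum>x\<in>F. \<Sum>y\<in>F. c x * c y * K x y))"

lemma psd_onI:
  assumes "\<And>x y. x \<in> A \<Longrightarrow> y \<in> A \<Longrightarrow> K x y = K y x"
    "\<And>F c. finite F \<Longrightarrow> F \<subseteq> A \<Longrightarrow> 0 \<le> (\<Sum>x\<in>F. \<Sum>y\<in>F. c x * c y * K x y)"
  shows "psd_on A K"
  using assms unfolding psd_on_def by blast

lemma psd_on_sym: "psd_on A K \<Longrightarrow> x \<in> A \<Longrightarrow> y \<in> A \<Longrightarrow> K x y = K y x"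
  unfolding psd_on_def by blast

lemma psd_on_nonneg: "psd_on A K \<Longrightarrow> finite F \<Longrightarrow> F \<subseteq> A \<Longrightarrow> 0 \<le> (\<Sum>x\<in>F. \<Sum>y\<in>F. c x * c y * K x y)"
  unfolding psd_on_def by blast

lemma psd_on_subset: "psd_on A K \<Longrightarrow> B \<subseteq> A \<Longrightarrow> psd_on B K"
  unfolding psd_on_def by (meson subset_trans subsetD)

text \<open>The form as a quadratic polynomial in the coefficient t of one point, so that t can be
  chosen afterwards: the minimiser in Gaussian elimination, the balancing coefficient in
  Schoenberg's theorem.\<close>

lemma quadratic_form_insert:
  fixes K :: "'a \<Rightarrow> 'a \<Rightarrow> real"
  assumes "finite F" "a \<notin> F" "\<And>x. x \<in> F \<Longrightarrow> K x a = K a x"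
  shows "(\<Sum>x\<in>insert a F. \<Sum>y\<in>insert a F. (c(a := t)) x * (c(a := t)) y * K x y)
    = t\<^sup>2 * K a a + 2 * t * (\<Sum>x\<in>F. c x * K a x) + (\<Sum>x\<in>F. \<Sum>y\<in>F. c x * c y * K x y)"
proof -
  have ne: "x \<noteq> a" if "x \<in> F" for x using that assms(2) by blast
  have row: "(\<Sum>y\<in>insert a F. s * (c(a := t)) y * L y) = s * t * L a + s * (\<Sum>y\<in>F. c y * L y)" for s and L :: "'a \<Rightarrow> real"
    using assms(1,2) ne by (simp add: sum_distrib_left mult.assoc)
  have "(\<Sum>x\<in>insert a F. \<Sum>y\<in>insert a F. (c(a := t)) x * (c(a := t)) y * K x y)
    = (\<Sum>x\<in>insert a F. (c(a := t)) x * t * K x a + (c(a := t)) x * (\<Sum>y\<in>F. c y * K x y))"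
    by (simp only: row)
  also have "\<dots> = t * t * K a a + t * (\<Sum>y\<in>F. c y * K a y)
      + (\<Sum>x\<in>F. c x * t * K x a + c x * (\<Sum>y\<in>F. c y * K x y))"
    using assms(1,2) ne by simp
  also have "(\<Sum>x\<in>F. c x * t * K x a + c x * (\<Sum>y\<in>F. c y * K x y))
    = t * (\<Sum>x\<in>F. c x * K a x) + (\<Sum>x\<in>F. \<Sum>y\<in>F. c x * c y * K x y)"
    using assms(3) by (simp add: sum.distrib sum_distrib_left mult_ac)
  finally show ?thesis by (simp add: power2_eq_square)
qed

text \<open>Symmetric Gaussian elimination of one point at a time.\<close>

lemma psd_on_gram:
  assumes "finite A" "psd_on A K"
  shows "\<exists>(n::nat) u. \<forall>x\<in>A. \<forall>y\<in>A. K x y = (\<Sum>i<n. u i x * u i y)"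
  using assms
proof (induction A arbitrary: K rule: finite_induct)
  case empty
  then show ?case by simp
next
  case (insert a A)
  have sym: "K x y = K y x" if "x \<in> insert a A" "y \<in> insert a A" for x y
    using psd_on_sym[OF insert.prems that] .
  have quad: "0 \<le> t\<^sup>2 * K a a + 2 * t * (\<Sum>x\<in>F. c x * K a x) + (\<Sum>x\<in>F. \<Sum>y\<in>F. c x * c y * K x y)"
    if F: "F \<subseteq> A" for F c t
  proof -
    have "finite F" "a \<notin> F" using F insert.hyps finite_subset by auto
    moreover have "K x a = K a x" if "x \<in> F" for x using that F sym by blast
    ultimately have "(\<Sum>x\<in>insert a F. \<Sum>y\<in>insert a F. (c(a := t)) x * (c(a := t)) y * K x y)
      = t\<^sup>2 * K a a + 2 * t * (\<Sum>x\<in>F. c x * K a x) + (\<Sum>x\<in>F. \<Sum>y\<in>F. c x * c y * K x y)"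
      by (rule quadratic_form_insert)
    moreover have "finite (insert a F)" "insert a F \<subseteq> insert a A" using \<open>finite F\<close> F by auto
    ultimately show ?thesis
      using psd_on_nonneg[OF insert.prems, of "insert a F" "c(a := t)"] by presburger
  qed
  have Kaa: "0 \<le> K a a" using quad[of "{}" 1] by simp
  show ?case
  proof (cases "K a a = 0")
    case True
    have zero: "K a x = 0" if x: "x \<in> A" for x
    proof (rule ccontr)
      assume ne: "K a x \<noteq> 0"
      \<comment> \<open>With a zero pivot the form is linear in the coefficient of a; the
        coefficient taken here gives it the value -1.\<close>
      have "0 \<le> 2 * (- (K x x + 1) / (2 * K a x)) * K a x + K x x"
        using quad[of "{x}" "- (K x x + 1) / (2 * K a x)" "\<lambda>_. 1"] x True by simp
      then show False using ne by simp
    qed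
    obtain n :: nat and u where u: "\<forall>x\<in>A. \<forall>y\<in>A. K x y = (\<Sum>i<n. u i x * u i y)"
      using insert.IH[OF psd_on_subset[OF insert.prems]] by blast
    have "K x y = (\<Sum>i<n. (if x \<in> A then u i x else 0) * (if y \<in> A then u i y else 0))" if "x \<in> insert a A" "y \<in> insert a A" for x y
      using that u zero sym[of x a] True insert.hyps(2) by auto
    then show ?thesis by (intro exI[of _ n] exI[of _ "\<lambda>i x. if x \<in> A then u i x else 0"]) blast
  next
    case False
    then have pos: "0 < K a a" using Kaa by simp
    \<comment> \<open>The Schur complement: its form is that of K with the coefficient of a at the
      minimiser - s / K a a, hence nonnegative.\<close>
    define K' where "K' = (\<lambda>x y. K x y - K a x * K a y / K a a)"
    have "psd_on A K'"
    proof (rule psd_onI)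
      show "K' x y = K' y x" if "x \<in> A" "y \<in> A" for x y
        using sym that by (simp add: K'_def)
      fix F and c :: "'a \<Rightarrow> real" assume F: "finite F" "F \<subseteq> A"
      define s where "s = (\<Sum>x\<in>F. c x * K a x)"
      have "(\<Sum>x\<in>F. \<Sum>y\<in>F. c x * c y * (K a x * K a y / K a a)) = (\<Sum>x\<in>F. \<Sum>y\<in>F. (c x * K a x) * (c y * K a y)) / K a a"
        by (simp add: sum_divide_distrib mult_ac)
      also have "\<dots> = s\<^sup>2 / K a a" by (simp add: s_def power2_eq_square sum_product)
      finally have "(\<Sum>x\<in>F. \<Sum>y\<in>F. c x * c y * K' x y) = (\<Sum>x\<in>F. \<Sum>y\<in>F. c x * c y * K x y) - s\<^sup>2 / K a a"
        by (simp add: K'_def right_diff_distrib sum_subtractf)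
      also have "\<dots> = (- s / K a a)\<^sup>2 * K a a + 2 * (- s / K a a) * s + (\<Sum>x\<in>F. \<Sum>y\<in>F. c x * c y * K x y)"
        using pos by (simp add: power2_eq_square field_simps)
      also have "0 \<le> \<dots>" using quad[OF F(2)] unfolding s_def by blast
      finally show "0 \<le> (\<Sum>x\<in>F. \<Sum>y\<in>F. c x * c y * K' x y)" .
    qed
    then obtain n :: nat and u where u: "\<forall>x\<in>A. \<forall>y\<in>A. K' x y = (\<Sum>i<n. u i x * u i y)"
      using insert.IH by blast
    \<comment> \<open>The new row of index n carries the pivot; the old rows are unspecified at a
      and are set to 0 there.\<close>
    define v where "v = (\<lambda>i. if i < n then (\<lambda>x. if x \<in> A then u i x else 0) else (\<lambda>x. K a x / sqrt (K a a)))"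
    have "K x y = (\<Sum>i<Suc n. v i x * v i y)" if "x \<in> insert a A" "y \<in> insert a A" for x y
    proof -
      have "(\<Sum>i<Suc n. v i x * v i y) = (\<Sum>i<n. (if x \<in> A then u i x else 0) * (if y \<in> A then u i y else 0)) + K a x * K a y / K a a"
        using pos by (simp add: v_def)
      also have "(\<Sum>i<n. (if x \<in> A then u i x else 0) * (if y \<in> A then u i y else 0)) = K x y - K a x * K a y / K a a"
        using that u sym[of x a] insert.hyps(2) pos by (auto simp: K'_def)
      finally show ?thesis by simp
    qed
    then show ?thesis by blast
  qed
qed

text \<open>A Gram representation of K writes the form of the product as a sum of forms of L with
  coefficients \<open>c x * u i x\<close>.\<close>

lemma psd_on_schur:
  assumes K: "psd_on A K" and L: "psd_on A L"
  shows "psd_on A (\<lambda>x y. K x y * L x y)"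
proof (rule psd_onI)
  show "K x y * L x y = K y x * L y x" if "x \<in> A" "y \<in> A" for x y
    using psd_on_sym[OF K that] psd_on_sym[OF L that] by simp
  fix F and c :: "'a \<Rightarrow> real" assume F: "finite F" "F \<subseteq> A"
  obtain n :: nat and u where u: "\<forall>x\<in>F. \<forall>y\<in>F. K x y = (\<Sum>i<n. u i x * u i y)"
    using psd_on_gram[OF F(1) psd_on_subset[OF K F(2)]] by blast
  have "(\<Sum>x\<in>F. \<Sum>y\<in>F. c x * c y * (K x y * L x y))
    = (\<Sum>x\<in>F. \<Sum>y\<in>F. \<Sum>i<n. (c x * u i x) * (c y * u i y) * L x y)"
    using u by (intro sum.cong refl) (simp add: sum_distrib_left sum_distrib_right mult_ac)
  also have "\<dots> = (\<Sum>i<n. \<Sum>x\<in>F. \<Sum>y\<in>F. (c x * u i x) * (c y * u i y) * L x y)"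
    by (simp only: sum.swap[of _ F "{..<n}"])
  also have "0 \<le> \<dots>"
    by (rule sum_nonneg) (rule psd_on_nonneg[OF L F])
  finally show "0 \<le> (\<Sum>x\<in>F. \<Sum>y\<in>F. c x * c y * (K x y * L x y))" .
qed

lemma psd_on_rank_one: "psd_on A (\<lambda>x y. f x * f y)"
proof (rule psd_onI)
  fix F and c :: "'a \<Rightarrow> real"
  have "(\<Sum>x\<in>F. \<Sum>y\<in>F. c x * c y * (f x * f y)) = (\<Sum>x\<in>F. c x * f x)\<^sup>2"
    by (simp add: power2_eq_square sum_product mult_ac)
  then show "0 \<le> (\<Sum>x\<in>F. \<Sum>y\<in>F. c x * c y * (f x * f y))" by simp
qed simp

lemma psd_on_power: "psd_on A K \<Longrightarrow> psd_on A (\<lambda>x y. K x y ^ n)"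
proof (induction n)
  case 0
  then show ?case using psd_on_rank_one[of A "\<lambda>_. 1"] by simp
next
  case (Suc n)
  then show ?case using psd_on_schur[OF Suc.prems Suc.IH[OF Suc.prems]] by simp
qed

text \<open>The exponential series has nonnegative coefficients, and positive kernels are closed
  under powers, sums and limits.\<close>

lemma psd_on_exp:
  assumes K: "psd_on A K" and t: "0 \<le> t"
  shows "psd_on A (\<lambda>x y. exp (t * K x y))"
proof (rule psd_onI)
  show "exp (t * K x y) = exp (t * K y x)" if "x \<in> A" "y \<in> A" for x y
    using psd_on_sym[OF K that] by simp
  fix F and c :: "'a \<Rightarrow> real" assume F: "finite F" "F \<subseteq> A"
  have sums: "(\<lambda>n. \<Sum>x\<in>F. \<Sum>y\<in>F. c x * c y * ((t * K x y) ^ n /\<^sub>R fact n))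
    sums (\<Sum>x\<in>F. \<Sum>y\<in>F. c x * c y * exp (t * K x y))"
    by (intro sums_sum sums_mult exp_converges)
  have "0 \<le> (\<Sum>x\<in>F. \<Sum>y\<in>F. c x * c y * ((t * K x y) ^ n /\<^sub>R fact n))" for n
  proof -
    have "(\<Sum>x\<in>F. \<Sum>y\<in>F. c x * c y * ((t * K x y) ^ n /\<^sub>R fact n))
      = t ^ n / fact n * (\<Sum>x\<in>F. \<Sum>y\<in>F. c x * c y * K x y ^ n)"
      by (simp add: sum_distrib_left power_mult_distrib field_simps)
    also have "0 \<le> \<dots>"
      using psd_on_nonneg[OF psd_on_power[OF K] F] t by simp
    finally show ?thesis .
  qed
  then show "0 \<le> (\<Sum>x\<in>F. \<Sum>y\<in>F. c x * c y * exp (t * K x y))"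
    by (rule sums_le[OF _ sums_zero sums])
qed

text \<open>If \<psi> is a squared distance, the kernel K of the proof is twice the inner product of
  vectors with origin a. Its definition makes \<open>exp (- (t * \<psi> x y))\<close> a rank one
  kernel times \<open>exp (t * K x y)\<close>.\<close>

theorem schoenberg:
  fixes \<psi> :: "'a \<Rightarrow> 'a \<Rightarrow> real"
  assumes sym: "\<And>x y. x \<in> A \<Longrightarrow> y \<in> A \<Longrightarrow> \<psi> x y = \<psi> y x"
    and zero: "\<And>x. x \<in> A \<Longrightarrow> \<psi> x x = 0"
    and neg: "\<And>F c. finite F \<Longrightarrow> F \<subseteq> A \<Longrightarrow> (\<Sum>x\<in>F. c x) = 0 \<Longrightarrow> (\<Sum>x\<in>F. \<Sum>y\<in>F. c x * c y * \<psi> x y) \<le> 0"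
    and t: "0 \<le> t"
  shows "psd_on A (\<lambda>x y. exp (- (t * \<psi> x y)))"
proof (cases "A = {}")
  case True
  then show ?thesis by (auto simp: psd_on_def)
next
  case False
  then obtain a where a: "a \<in> A" by blast
  define K where "K = (\<lambda>x y. \<psi> x a + \<psi> a y - \<psi> x y)"
  have K: "psd_on A K"
  proof (rule psd_onI)
    show "K x y = K y x" if "x \<in> A" "y \<in> A" for x y
      using that a sym by (simp add: K_def)
    fix F and c :: "'a \<Rightarrow> real" assume F: "finite F" "F \<subseteq> A"
    define F' where "F' = F - {a}"
    have F': "finite F'" "F' \<subseteq> A" "a \<notin> F'" using F by (auto simp: F'_def)
    define s where "s = (\<Sum>x\<in>F'. c x * \<psi> a x)"
    define q where "q = (\<Sum>x\<in>F'. \<Sum>y\<in>F'. c x * c y * \<psi> x y)"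
    \<comment> \<open>This local t, not the exponent, is the coefficient at a that brings the total
      to 0. K vanishes on the row and column of a, so the form of K does not feel it.\<close>
    define t where "t = - (\<Sum>x\<in>F'. c x)"
    have Kz: "K a y = 0" "K y a = 0" if "y \<in> A" for y
      using a zero sym that by (auto simp: K_def)
    have "(\<Sum>x\<in>F. \<Sum>y\<in>F. c x * c y * K x y) = (\<Sum>x\<in>F'. \<Sum>y\<in>F. c x * c y * K x y)"
      using F Kz by (intro sum.mono_neutral_right) (auto simp: F'_def subset_iff intro!: sum.neutral)
    also have "\<dots> = (\<Sum>x\<in>F'. \<Sum>y\<in>F'. c x * c y * K x y)"
      using F Kz by (intro sum.cong refl sum.mono_neutral_right) (auto simp: F'_def)
    also have "\<dots> = (\<Sum>x\<in>F'. \<Sum>y\<in>F'. (c x * \<psi> a x) * c y + c x * (c y * \<psi> a y) - c x * c y * \<psi> x y)"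
      using F' a sym by (intro sum.cong refl) (auto simp: K_def algebra_simps subset_iff)
    also have "\<dots> = - (2 * t * s + q)"
      by (simp add: sum.distrib sum_subtractf s_def q_def t_def flip: sum_distrib_left sum_distrib_right)
    finally have eq: "(\<Sum>x\<in>F. \<Sum>y\<in>F. c x * c y * K x y) = - (2 * t * s + q)" .
    have "(\<Sum>x\<in>insert a F'. (c(a := t)) x) = 0"
      using F' by (simp add: t_def) (rule sum.cong, auto)
    then have "(\<Sum>x\<in>insert a F'. \<Sum>y\<in>insert a F'. (c(a := t)) x * (c(a := t)) y * \<psi> x y) \<le> 0"
      using F' a by (intro neg) auto
    moreover have "\<psi> x a = \<psi> a x" if "x \<in> F'" for x using sym that a F' by blast
    ultimately have "2 * t * s + q \<le> 0"
      using quadratic_form_insert[OF F'(1,3), of \<psi> c t] zero[OF a] by (simp add: s_def q_def)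
    then show "0 \<le> (\<Sum>x\<in>F. \<Sum>y\<in>F. c x * c y * K x y)" using eq by simp
  qed
  have "psd_on A (\<lambda>x y. exp (- (t * \<psi> x a)) * exp (- (t * \<psi> y a)) * exp (t * K x y))"
    by (rule psd_on_schur[OF psd_on_rank_one psd_on_exp[OF K t]])
  moreover have "exp (- (t * \<psi> x a)) * exp (- (t * \<psi> y a)) * exp (t * K x y) = exp (- (t * \<psi> x y))"
    if "x \<in> A" "y \<in> A" for x y
    using that a sym by (simp add: K_def algebra_simps flip: exp_add)
  ultimately show ?thesis unfolding psd_on_def by (simp add: subset_iff cong: sum.cong)
qed

lemma conditionally_negative_type_exp:
  assumes "group \<Gamma>" "conditionally_negative_type \<Gamma> h" "0 \<le> t"
  shows "psd_on (carrier \<Gamma>) (\<lambda>x y. exp (- (t * h (inv\<^bsub>\<Gamma>\<^esub> x \<otimes>\<^bsub>\<Gamma>\<^esub> y))))"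
proof -
  interpret group \<Gamma> by fact
  have h: "h \<one>\<^bsub>\<Gamma>\<^esub> = 0" "\<And>g. g \<in> carrier \<Gamma> \<Longrightarrow> h (inv\<^bsub>\<Gamma>\<^esub> g) = h g"
    "\<And>F c. finite F \<Longrightarrow> F \<subseteq> carrier \<Gamma> \<Longrightarrow> (\<Sum>x\<in>F. c x) = 0 \<Longrightarrow>
      (\<Sum>x\<in>F. \<Sum>y\<in>F. c x * c y * h (inv\<^bsub>\<Gamma>\<^esub> x \<otimes>\<^bsub>\<Gamma>\<^esub> y)) \<le> 0"
    using assms(2) unfolding conditionally_negative_type_def by auto
  show ?thesis
  proof (rule schoenberg)
    show "h (inv\<^bsub>\<Gamma>\<^esub> x \<otimes>\<^bsub>\<Gamma>\<^esub> y) = h (inv\<^bsub>\<Gamma>\<^esub> y \<otimes>\<^bsub>\<Gamma>\<^esub> x)"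
      if "x \<in> carrier \<Gamma>" "y \<in> carrier \<Gamma>" for x y
      using h(2)[of "inv\<^bsub>\<Gamma>\<^esub> x \<otimes>\<^bsub>\<Gamma>\<^esub> y"] that by (simp add: inv_mult_group)
  qed (use h assms(3) in auto)
qed

section \<open>Hilbert space of a positive kernel\<close>

text \<open>The reproducing kernel Hilbert space of a kernel on the natural numbers. Polynomials serve as
  finitely supported coefficient sequences: \<open>p\<close> stands for the combination \<open>\<Sum>i. Polynomial.coeff p i \<cdot> k i\<close>.\<close>

locale psd_kernel =
  fixes k :: "nat \<Rightarrow> nat \<Rightarrow> real"
  assumes psd: "psd_on UNIV k"
begin

section \<open>The sesquilinear form on finite combinations\<close>

definition form :: "complex poly \<Rightarrow> complex poly \<Rightarrow> complex" where
  "form p q = (\<Sum>i\<le>Polynomial.degree p. \<Sum>j\<le>Polynomial.degree q. Polynomial.coeff p i * cnj (Polynomial.coeff q j) * k i j)"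

lemma form_bound:
  assumes "Polynomial.degree p \<le> n" "Polynomial.degree q \<le> n"
  shows "form p q = (\<Sum>i\<le>n. \<Sum>j\<le>n. Polynomial.coeff p i * cnj (Polynomial.coeff q j) * k i j)"
proof -
  have "form p q = (\<Sum>i\<le>n. \<Sum>j\<le>Polynomial.degree q. Polynomial.coeff p i * cnj (Polynomial.coeff q j) * k i j)"
    unfolding form_def using assms by (intro sum.mono_neutral_left) (auto simp: coeff_eq_0)
  also have "\<dots> = (\<Sum>i\<le>n. \<Sum>j\<le>n. Polynomial.coeff p i * cnj (Polynomial.coeff q j) * k i j)"
    using assms by (intro sum.cong refl sum.mono_neutral_left) (auto simp: coeff_eq_0)
  finally show ?thesis .
qed

lemma form_add_left: "form (p + q) r = form p r + form q r"
proof -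
  let ?n = "max (Polynomial.degree p) (max (Polynomial.degree q) (Polynomial.degree r))"
  have "Polynomial.degree (p + q) \<le> ?n" by (rule degree_add_le) auto
  then show ?thesis
    by (simp add: form_bound[of _ ?n] distrib_right sum.distrib)
qed

lemma form_smult_left: "form (Polynomial.smult a p) r = a * form p r"
proof -
  let ?n = "max (Polynomial.degree p) (Polynomial.degree r)"
  have "Polynomial.degree (Polynomial.smult a p) \<le> ?n" using degree_smult_le[of a p] by linarith
  then show ?thesis
    by (simp add: form_bound[of _ ?n] sum_distrib_left mult.assoc)
qed

lemma k_sym: "k i j = k j i"
  using psd_on_sym[OF psd] by simp

lemma form_cnj: "form q p = cnj (form p q)"
proof -
  have "cnj (form p q) = (\<Sum>i\<le>Polynomial.degree p. \<Sum>j\<le>Polynomial.degree q. Polynomial.coeff q j * cnj (Polynomial.coeff p i) * k j i)"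
    by (simp add: form_def k_sym mult_ac)
  also have "\<dots> = form q p" unfolding form_def by (rule sum.swap)
  finally show ?thesis by simp
qed

lemma form_add_right: "form r (p + q) = form r p + form r q"
  by (metis form_add_left form_cnj complex_cnj_add)

lemma form_smult_right: "form r (Polynomial.smult a p) = cnj a * form r p"
  by (metis form_smult_left form_cnj complex_cnj_mult)

lemma form_diff_left: "form (p - q) r = form p r - form q r"
  using form_add_left[of "p - q" q r] by simp

lemma form_diff_right: "form r (p - q) = form r p - form r q"
  using form_add_right[of r "p - q" q] by simp

text \<open>Since k is real, the real part of the form is the sum of the real forms of the real and
  the imaginary parts of the coefficients.\<close>

lemma form_nonneg: "0 \<le> Re (form p p)"
proof -
  let ?a = "\<lambda>i. Re (Polynomial.coeff p i)" and ?b = "\<lambda>i. Im (Polynomial.coeff p i)"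
  have "Re (form p p) = (\<Sum>i\<le>Polynomial.degree p. \<Sum>j\<le>Polynomial.degree p. ?a i * ?a j * k i j) + (\<Sum>i\<le>Polynomial.degree p. \<Sum>j\<le>Polynomial.degree p. ?b i * ?b j * k i j)"
    by (simp add: form_def sum.distrib[symmetric] distrib_right)
  also have "0 \<le> \<dots>"
    by (intro add_nonneg_nonneg psd_on_nonneg[OF psd]) auto
  finally show ?thesis .
qed

definition fnorm :: "complex poly \<Rightarrow> real" where
  "fnorm p = sqrt (Re (form p p))"

lemma fnorm_nonneg: "0 \<le> fnorm p"
  by (simp add: fnorm_def form_nonneg)

lemma fnorm_square: "(fnorm p)\<^sup>2 = Re (form p p)"
  by (simp add: fnorm_def form_nonneg)

lemma fnorm_minus_commute: "fnorm (p - q) = fnorm (q - p)"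
  by (simp add: fnorm_def form_diff_left form_diff_right)

lemma form_self: "form p p = complex_of_real ((fnorm p)\<^sup>2)"
  using form_cnj[of p p] by (simp add: complex_eq_iff fnorm_square)

text \<open>The form may be degenerate, so \<open>fnorm q = 0\<close> is a case of its own, where a
  suitable s would make the expanded form equal to -1. The test vector contains the factor z =
  \<open>form p q\<close>, so that only squared moduli remain.\<close>

lemma form_cauchy_schwarz: "cmod (form p q) \<le> fnorm p * fnorm q"
proof -
  define z where "z = form p q"
  have expand: "0 \<le> (fnorm p)\<^sup>2 - 2 * s * (cmod z)\<^sup>2 + s\<^sup>2 * (cmod z)\<^sup>2 * (fnorm q)\<^sup>2" for s :: real
  proof -
    let ?a = "complex_of_real s * z"
    have "form (p - Polynomial.smult ?a q) (p - Polynomial.smult ?a q)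
      = form p p - cnj ?a * z - ?a * cnj z + ?a * cnj ?a * form q q"
      by (simp add: form_diff_left form_diff_right form_smult_left form_smult_right z_def form_cnj[of q p] algebra_simps)
    also have "\<dots> = form p p - 2 * of_real s * (z * cnj z) + (of_real s)\<^sup>2 * (z * cnj z) * form q q"
      by (simp add: power2_eq_square algebra_simps)
    also have "\<dots> = complex_of_real ((fnorm p)\<^sup>2 - 2 * s * (cmod z)\<^sup>2 + s\<^sup>2 * (cmod z)\<^sup>2 * (fnorm q)\<^sup>2)"
      by (simp add: form_self complex_norm_square[symmetric])
    finally show ?thesis using form_nonneg[of "p - Polynomial.smult ?a q"] by simp
  qed
  have "(cmod z)\<^sup>2 \<le> (fnorm p)\<^sup>2 * (fnorm q)\<^sup>2"
  proof (cases "fnorm q = 0")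
    case True
    have "(cmod z)\<^sup>2 = 0"
    proof (rule ccontr)
      assume ne: "(cmod z)\<^sup>2 \<noteq> 0"
      show False using expand[of "((fnorm p)\<^sup>2 + 1) / (2 * (cmod z)\<^sup>2)"] True ne by simp
    qed
    then show ?thesis by simp
  next
    case False
    define Q where "Q = (fnorm q)\<^sup>2"
    have Q: "0 < Q" using False by (simp add: Q_def)
    have "(1 / Q)\<^sup>2 * (cmod z)\<^sup>2 * Q = (cmod z)\<^sup>2 / Q" using Q by (simp add: power2_eq_square)
    then have "(cmod z)\<^sup>2 / Q \<le> (fnorm p)\<^sup>2"
      using expand[of "1 / Q"] by (simp add: Q_def[symmetric])
    then show ?thesis using Q by (simp add: Q_def[symmetric] pos_divide_le_eq)
  qed
  then have "(cmod z)\<^sup>2 \<le> (fnorm p * fnorm q)\<^sup>2" by (simp add: power_mult_distrib)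
  then show ?thesis unfolding z_def by (rule power2_le_imp_le) (simp add: fnorm_nonneg)
qed

lemma fnorm_triangle: "fnorm (p + q) \<le> fnorm p + fnorm q"
proof (rule power2_le_imp_le)
  have "Re (form p q) \<le> fnorm p * fnorm q"
    using form_cauchy_schwarz[of p q] complex_Re_le_cmod order_trans by blast
  moreover have "Re (form q p) = Re (form p q)" by (simp add: form_cnj[of q p])
  ultimately show "(fnorm (p + q))\<^sup>2 \<le> (fnorm p + fnorm q)\<^sup>2"
    by (simp add: power2_sum fnorm_square form_add_left form_add_right)
qed (simp add: fnorm_nonneg)

lemma fnorm_smult: "fnorm (Polynomial.smult a p) = cmod a * fnorm p"
proof -
  have "form (Polynomial.smult a p) (Polynomial.smult a p) = (a * cnj a) * form p p"
    by (simp add: form_smult_left form_smult_right)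
  also have "\<dots> = complex_of_real ((cmod a * fnorm p)\<^sup>2)"
    by (simp add: form_self complex_norm_square[symmetric] power_mult_distrib)
  finally have "(fnorm (Polynomial.smult a p))\<^sup>2 = (cmod a * fnorm p)\<^sup>2"
    by (simp add: fnorm_square)
  then show ?thesis by (simp add: power2_eq_iff_nonneg fnorm_nonneg)
qed

abbreviation unit :: "nat \<Rightarrow> complex poly" where "unit i \<equiv> Polynomial.monom 1 i"

lemma form_unit: "form (unit i) (unit j) = k i j"
proof -
  have "form (unit i) (unit j) = (\<Sum>l\<le>i. if l = i then \<Sum>m\<le>j. if m = j then complex_of_real (k l m) else 0 else 0)"
    unfolding form_def by (intro sum.cong) (auto simp: degree_monom_eq if_distrib[of cnj] if_distrib[of "\<lambda>x. x * _"] cong: if_cong)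
  then show ?thesis by (simp add: sum.delta)
qed

lemma fnorm_unit: "fnorm (unit i) = sqrt (k i i)"
  by (simp add: fnorm_def form_unit)

lemma form_sum_left: "form (\<Sum>i\<in>I. f i) q = (\<Sum>i\<in>I. form (f i) q)"
proof (induction I rule: infinite_finite_induct)
  case (insert x F)
  then show ?case by (simp add: form_add_left)
qed (simp_all add: form_def)

lemma form_expand_left: "form p q = (\<Sum>i\<le>Polynomial.degree p. Polynomial.coeff p i * form (unit i) q)"
proof -
  have "form p q = form (\<Sum>i\<le>Polynomial.degree p. Polynomial.smult (Polynomial.coeff p i) (unit i)) q"
    using poly_as_sum_of_monoms[of p] by (simp add: smult_monom)
  then show ?thesis by (simp add: form_sum_left form_smult_left)
qed

lemma form_expand_right: "form p q = (\<Sum>j\<le>Polynomial.degree q. cnj (Polynomial.coeff q j) * form p (unit j))"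
  by (subst form_cnj, subst form_expand_left) (simp add: form_cnj[of p])

section \<open>Cauchy sequences of finite combinations\<close>

definition cauchy :: "(nat \<Rightarrow> complex poly) \<Rightarrow> bool" where
  "cauchy U \<longleftrightarrow> (\<forall>\<epsilon>>0. \<exists>N. \<forall>m\<ge>N. \<forall>n\<ge>N. fnorm (U m - U n) < \<epsilon>)"

lemma cauchyD:
  assumes "cauchy U" "0 < \<epsilon>"
  obtains N where "\<And>m n. m \<ge> N \<Longrightarrow> n \<ge> N \<Longrightarrow> fnorm (U m - U n) < \<epsilon>"
  using assms unfolding cauchy_def by metis

lemma cauchy_const: "cauchy (\<lambda>_. p)"
  by (simp add: cauchy_def fnorm_def form_def)

lemma cauchy_add:
  assumes "cauchy U" "cauchy Y"
  shows "cauchy (\<lambda>n. U n + Y n)"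
  unfolding cauchy_def
proof (intro allI impI)
  fix \<epsilon> :: real assume \<epsilon>: "0 < \<epsilon>"
  obtain N where N: "\<And>m n. m \<ge> N \<Longrightarrow> n \<ge> N \<Longrightarrow> fnorm (U m - U n) < \<epsilon> / 2"
    using cauchyD[OF assms(1) half_gt_zero[OF \<epsilon>]] by metis
  obtain N' where N': "\<And>m n. m \<ge> N' \<Longrightarrow> n \<ge> N' \<Longrightarrow> fnorm (Y m - Y n) < \<epsilon> / 2"
    using cauchyD[OF assms(2) half_gt_zero[OF \<epsilon>]] by metis
  have "fnorm (U m + Y m - (U n + Y n)) < \<epsilon>" if "m \<ge> max N N'" "n \<ge> max N N'" for m n
  proof -
    have "fnorm (U m + Y m - (U n + Y n)) \<le> fnorm (U m - U n) + fnorm (Y m - Y n)"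
      using fnorm_triangle[of "U m - U n" "Y m - Y n"] by (simp add: algebra_simps)
    then show ?thesis using N[of m n] N'[of m n] that by simp
  qed
  then show "\<exists>N. \<forall>m\<ge>N. \<forall>n\<ge>N. fnorm (U m + Y m - (U n + Y n)) < \<epsilon>" by blast
qed

lemma cauchy_smult:
  assumes "cauchy U"
  shows "cauchy (\<lambda>n. Polynomial.smult a (U n))"
  unfolding cauchy_def
proof (intro allI impI)
  fix \<epsilon> :: real assume "0 < \<epsilon>"
  have pos: "0 < cmod a + 1" by (simp add: add_nonneg_pos)
  with \<open>0 < \<epsilon>\<close> have "0 < \<epsilon> / (cmod a + 1)" by simp
  then obtain N where N: "\<And>m n. m \<ge> N \<Longrightarrow> n \<ge> N \<Longrightarrow> fnorm (U m - U n) < \<epsilon> / (cmod a + 1)"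
    using cauchyD[OF assms] by metis
  have "fnorm (Polynomial.smult a (U m) - Polynomial.smult a (U n)) < \<epsilon>" if "m \<ge> N" "n \<ge> N" for m n
  proof -
    have "fnorm (Polynomial.smult a (U m) - Polynomial.smult a (U n)) = cmod a * fnorm (U m - U n)"
      by (simp add: fnorm_smult flip: smult_diff_right)
    also have "\<dots> \<le> (cmod a + 1) * fnorm (U m - U n)" by (simp add: mult_right_mono fnorm_nonneg)
    also have "\<dots> < \<epsilon>"
      using mult_strict_left_mono[OF N[OF that] pos] pos by simp
    finally show ?thesis .
  qed
  then show "\<exists>N. \<forall>m\<ge>N. \<forall>n\<ge>N. fnorm (Polynomial.smult a (U m) - Polynomial.smult a (U n)) < \<epsilon>" by blast
qed

lemma cauchy_diff: "cauchy U \<Longrightarrow> cauchy Y \<Longrightarrow> cauchy (\<lambda>n. U n - Y n)"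
  using cauchy_add[of U "\<lambda>n. Polynomial.smult (-1) (Y n)"] cauchy_smult[of Y "-1"] by simp

lemma cauchy_bounded:
  assumes "cauchy U"
  obtains b where "0 < b" "\<And>n. fnorm (U n) \<le> b"
proof -
  obtain N where N: "\<And>m n. m \<ge> N \<Longrightarrow> n \<ge> N \<Longrightarrow> fnorm (U m - U n) < 1"
    using cauchyD[OF assms zero_less_one] by metis
  define b where "b = 1 + (\<Sum>i\<le>N. fnorm (U i))"
  have le: "fnorm (U i) \<le> (\<Sum>i\<le>N. fnorm (U i))" if "i \<le> N" for i
    using that by (intro member_le_sum) (auto simp: fnorm_nonneg)
  have "fnorm (U n) \<le> b" for n
  proof (cases "n \<le> N")
    case True
    then show ?thesis using le[OF True] by (simp add: b_def)
  next
    case False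
    have "fnorm (U n) \<le> fnorm (U n - U N) + fnorm (U N)" using fnorm_triangle[of "U n - U N" "U N"] by simp
    then show ?thesis using N[of n N] False le[of N] by (simp add: b_def)
  qed
  moreover have "0 < b" using le[of 0] fnorm_nonneg[of "U 0"] by (simp add: b_def)
  ultimately show ?thesis using that by blast
qed

lemma form_convergent:
  assumes "cauchy U" "cauchy Y"
  shows "convergent (\<lambda>n. form (U n) (Y n))"
  unfolding Cauchy_convergent_iff[symmetric]
proof (rule metric_CauchyI)
  fix \<epsilon> :: real assume \<epsilon>: "0 < \<epsilon>"
  obtain a where a: "0 < a" "\<And>n. fnorm (U n) \<le> a" by (rule cauchy_bounded[OF assms(1)]) blast
  obtain b where b: "0 < b" "\<And>n. fnorm (Y n) \<le> b" by (rule cauchy_bounded[OF assms(2)]) blast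
  obtain N where N: "\<And>m n. m \<ge> N \<Longrightarrow> n \<ge> N \<Longrightarrow> fnorm (U m - U n) < \<epsilon> / (2 * b)"
    using cauchyD[OF assms(1), of "\<epsilon> / (2 * b)"] \<epsilon> b(1) by (metis divide_pos_pos mult_pos_pos zero_less_numeral)
  obtain N' where N': "\<And>m n. m \<ge> N' \<Longrightarrow> n \<ge> N' \<Longrightarrow> fnorm (Y m - Y n) < \<epsilon> / (2 * a)"
    using cauchyD[OF assms(2), of "\<epsilon> / (2 * a)"] \<epsilon> a(1) by (metis divide_pos_pos mult_pos_pos zero_less_numeral)
  have "dist (form (U m) (Y m)) (form (U n) (Y n)) < \<epsilon>" if "m \<ge> max N N'" "n \<ge> max N N'" for m n
  proof -
    have "form (U m) (Y m) - form (U n) (Y n) = form (U m - U n) (Y m) + form (U n) (Y m - Y n)"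
      by (simp add: form_diff_left form_diff_right)
    then have "dist (form (U m) (Y m)) (form (U n) (Y n)) \<le> cmod (form (U m - U n) (Y m)) + cmod (form (U n) (Y m - Y n))"
      unfolding dist_norm by (metis norm_triangle_ineq)
    also have "\<dots> \<le> fnorm (U m - U n) * fnorm (Y m) + fnorm (U n) * fnorm (Y m - Y n)"
      by (intro add_mono form_cauchy_schwarz)
    also have "\<dots> \<le> fnorm (U m - U n) * b + a * fnorm (Y m - Y n)"
      by (intro add_mono mult_left_mono mult_right_mono a b fnorm_nonneg)
    also have "\<dots> < \<epsilon> / (2 * b) * b + a * (\<epsilon> / (2 * a))"
      using N[of m n] N'[of m n] that a(1) b(1)
      by (intro add_strict_mono mult_strict_left_mono mult_strict_right_mono) auto
    also have "\<dots> = \<epsilon>" using a b by simp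
    finally show ?thesis .
  qed
  then show "\<exists>M. \<forall>m\<ge>M. \<forall>n\<ge>M. dist (form (U m) (Y m)) (form (U n) (Y n)) < \<epsilon>" by blast
qed

lemma form_null_left:
  assumes "(\<lambda>n. fnorm (U n)) \<longlonglongrightarrow> 0" "cauchy Y"
  shows "(\<lambda>n. form (U n) (Y n)) \<longlonglongrightarrow> 0"
proof -
  obtain b where b: "0 < b" "\<And>n. fnorm (Y n) \<le> b" by (rule cauchy_bounded[OF assms(2)]) blast
  have "(\<lambda>n. fnorm (U n) * b) \<longlonglongrightarrow> 0" using tendsto_mult_left_zero[OF assms(1)] .
  then show ?thesis
  proof (rule Lim_null_comparison[rotated], intro always_eventually allI)
    show "norm (form (U n) (Y n)) \<le> fnorm (U n) * b" for n
      using form_cauchy_schwarz[of "U n" "Y n"] mult_left_mono[OF b(2) fnorm_nonneg] by (meson order_trans)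
  qed
qed

text \<open>The squared norm of U n is the product of U n with U n - U N plus its product with U N.
  The first is small by the Cauchy property, uniformly in n; the second tends to 0 because U N is a
  finite combination of units. Hence pointwise values determine an element of the
  completion.\<close>

lemma cauchy_null:
  assumes U: "cauchy U" and lim: "\<And>i. (\<lambda>n. form (U n) (unit i)) \<longlonglongrightarrow> 0"
  shows "(\<lambda>n. fnorm (U n)) \<longlonglongrightarrow> 0"
proof -
  have weak: "(\<lambda>n. form (U n) p) \<longlonglongrightarrow> 0" for p
  proof -
    have "(\<lambda>n. \<Sum>j\<le>Polynomial.degree p. cnj (Polynomial.coeff p j) * form (U n) (unit j)) \<longlonglongrightarrow> (\<Sum>j\<le>Polynomial.degree p. cnj (Polynomial.coeff p j) * 0)"
      by (intro tendsto_sum tendsto_mult_left lim)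
    then show ?thesis by (simp add: form_expand_right[of _ p])
  qed
  obtain b where b: "0 < b" "\<And>n. fnorm (U n) \<le> b" by (rule cauchy_bounded[OF U]) blast
  have "(\<lambda>n. (fnorm (U n))\<^sup>2) \<longlonglongrightarrow> 0"
  proof (rule LIMSEQ_I)
    fix \<epsilon> :: real assume \<epsilon>: "0 < \<epsilon>"
    obtain N where N: "\<And>m n. m \<ge> N \<Longrightarrow> n \<ge> N \<Longrightarrow> fnorm (U m - U n) < \<epsilon> / (2 * b)"
      using cauchyD[OF U, of "\<epsilon> / (2 * b)"] \<epsilon> b(1) by (metis divide_pos_pos mult_pos_pos zero_less_numeral)
    obtain N' where N': "\<And>n. n \<ge> N' \<Longrightarrow> cmod (form (U n) (U N)) < \<epsilon> / 2"
      using LIMSEQ_D[OF weak[of "U N"], of "\<epsilon> / 2"] \<epsilon> by auto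
    show "\<exists>N. \<forall>n\<ge>N. norm ((fnorm (U n))\<^sup>2 - 0) < \<epsilon>"
    proof (intro exI[of _ "max N N'"] allI impI)
      fix n assume n: "n \<ge> max N N'"
      have "(fnorm (U n))\<^sup>2 \<le> cmod (form (U n) (U n))"
        unfolding fnorm_square by (rule complex_Re_le_cmod)
      also have "form (U n) (U n) = form (U n) (U n - U N) + form (U n) (U N)" by (simp add: form_diff_right)
      also have "cmod \<dots> \<le> fnorm (U n) * fnorm (U n - U N) + cmod (form (U n) (U N))"
        by (rule order_trans[OF norm_triangle_ineq add_right_mono[OF form_cauchy_schwarz]])
      also have "\<dots> < b * (\<epsilon> / (2 * b)) + \<epsilon> / 2"
        using N[of n N] N'[of n] n b fnorm_nonneg
        by (intro add_le_less_mono mult_mono) (auto simp: less_imp_le)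
      also have "\<dots> = \<epsilon>" using b by simp
      finally show "norm ((fnorm (U n))\<^sup>2 - 0) < \<epsilon>" by simp
    qed
  qed
  then have "(\<lambda>n. sqrt ((fnorm (U n))\<^sup>2)) \<longlonglongrightarrow> sqrt 0" by (rule tendsto_real_sqrt)
  then show ?thesis by (simp add: fnorm_nonneg)
qed

section \<open>The completion as a space of functions\<close>

definition represents :: "(nat \<Rightarrow> complex poly) \<Rightarrow> (nat \<Rightarrow> complex) \<Rightarrow> bool" where
  "represents U f \<longleftrightarrow> cauchy U \<and> (\<forall>i. (\<lambda>n. form (U n) (unit i)) \<longlonglongrightarrow> f i)"

text \<open>An element of the completion is stored as the function of its inner products with the
  units; this is the type that \<open>property_T\<close> demands.\<close>

definition space :: "(nat \<Rightarrow> complex) set" where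
  "space = {f. \<exists>U. represents U f}"

definition feature :: "complex poly \<Rightarrow> nat \<Rightarrow> complex" where
  "feature p i = form p (unit i)"

definition ip :: "(nat \<Rightarrow> complex) \<Rightarrow> (nat \<Rightarrow> complex) \<Rightarrow> complex" where
  "ip f g = lim (\<lambda>n. form ((SOME U. represents U f) n) ((SOME U. represents U g) n))"

lemma spaceE:
  assumes "f \<in> space"
  obtains U where "represents U f"
  using assms by (auto simp: space_def)

lemma represents_cauchy: "represents U f \<Longrightarrow> cauchy U"
  by (simp add: represents_def)

lemma represents_space: "represents U f \<Longrightarrow> f \<in> space"
  by (auto simp: space_def)

lemma represents_unique:
  assumes "represents U f" "represents Y f"
  shows "(\<lambda>n. fnorm (U n - Y n)) \<longlonglongrightarrow> 0"
proof (rule cauchy_null)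
  show "cauchy (\<lambda>n. U n - Y n)" using assms represents_cauchy cauchy_diff by blast
  show "(\<lambda>n. form (U n - Y n) (unit i)) \<longlonglongrightarrow> 0" for i
    using tendsto_diff[of "\<lambda>n. form (U n) (unit i)" "f i" _ "\<lambda>n. form (Y n) (unit i)" "f i"] assms
    by (simp add: represents_def form_diff_left)
qed

text \<open>Two sequences with the same function differ by a null sequence, so those chosen in
  \<open>ip\<close> may be exchanged for any others.\<close>

lemma ip_lim:
  assumes U: "represents U f" and Y: "represents Y g"
  shows "(\<lambda>n. form (U n) (Y n)) \<longlonglongrightarrow> ip f g"
proof -
  define U' where "U' = (SOME U. represents U f)"
  define Y' where "Y' = (SOME U. represents U g)"
  have U': "represents U' f" unfolding U'_def by (rule someI[of "\<lambda>U. represents U f", OF U])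
  have Y': "represents Y' g" unfolding Y'_def by (rule someI[of "\<lambda>U. represents U g", OF Y])
  have "(\<lambda>n. form (U' n) (Y' n)) \<longlonglongrightarrow> ip f g"
    using form_convergent[OF U'[THEN represents_cauchy] Y'[THEN represents_cauchy]]
    unfolding ip_def U'_def Y'_def convergent_LIMSEQ_iff by blast
  moreover have "(\<lambda>n. form (U n - U' n) (Y n)) \<longlonglongrightarrow> 0"
    by (rule form_null_left[OF represents_unique[OF U U'] Y[THEN represents_cauchy]])
  moreover have "(\<lambda>n. form (U' n) (Y n - Y' n)) \<longlonglongrightarrow> 0"
  proof -
    have "(\<lambda>n. cnj (form (Y n - Y' n) (U' n))) \<longlonglongrightarrow> cnj 0"
      by (intro tendsto_cnj form_null_left[OF represents_unique[OF Y Y'] U'[THEN represents_cauchy]])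
    then show ?thesis by (simp add: form_cnj[of "U' _"])
  qed
  ultimately have "(\<lambda>n. form (U' n) (Y' n) + form (U n - U' n) (Y n) + form (U' n) (Y n - Y' n)) \<longlonglongrightarrow> ip f g + 0 + 0"
    by (intro tendsto_add)
  then show ?thesis by (simp add: form_diff_left form_diff_right)
qed

lemma represents_feature: "represents (\<lambda>_. p) (feature p)"
  by (simp add: represents_def cauchy_const feature_def)

lemma ip_feature: "ip (feature p) (feature q) = form p q"
  using LIMSEQ_unique[OF ip_lim[OF represents_feature represents_feature] tendsto_const] .

lemma represents_add: "represents U f \<Longrightarrow> represents Y g \<Longrightarrow> represents (\<lambda>n. U n + Y n) (\<lambda>i. f i + g i)"
  by (simp add: represents_def cauchy_add form_add_left tendsto_add)

lemma represents_smult: "represents U f \<Longrightarrow> represents (\<lambda>n. Polynomial.smult a (U n)) (\<lambda>i. a * f i)"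
  by (simp add: represents_def cauchy_smult form_smult_left tendsto_mult_left)

lemma represents_diff: "represents U f \<Longrightarrow> represents Y g \<Longrightarrow> represents (\<lambda>n. U n - Y n) (\<lambda>i. f i - g i)"
  by (simp add: represents_def cauchy_diff form_diff_left tendsto_diff)

lemma ip_norm_lim:
  assumes "represents U f"
  shows "(\<lambda>n. fnorm (U n)) \<longlonglongrightarrow> ip_norm ip f"
  unfolding fnorm_def ip_norm_def by (intro tendsto_real_sqrt tendsto_Re ip_lim assms)

lemma ip_norm_triangle:
  assumes "f \<in> space" "g \<in> space"
  shows "ip_norm ip (\<lambda>i. f i + g i) \<le> ip_norm ip f + ip_norm ip g"
proof -
  obtain U Y where XY: "represents U f" "represents Y g" using assms spaceE by metis
  show ?thesis
    by (rule LIMSEQ_le[OF ip_norm_lim[OF represents_add[OF XY]] tendsto_add[OF XY[THEN ip_norm_lim]]])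
      (use fnorm_triangle in blast)
qed

lemma ip_norm_feature: "ip_norm ip (feature p) = fnorm p"
  by (simp add: ip_norm_def fnorm_def ip_feature)

lemma ip_norm_minus_commute:
  assumes "f \<in> space" "g \<in> space"
  shows "ip_norm ip (\<lambda>i. f i - g i) = ip_norm ip (\<lambda>i. g i - f i)"
proof -
  obtain U Y where XY: "represents U f" "represents Y g" using assms spaceE by metis
  show ?thesis
    using LIMSEQ_unique[OF ip_norm_lim[OF represents_diff[OF XY]]] ip_norm_lim[OF represents_diff[OF XY(2,1)]]
    by (simp add: fnorm_minus_commute[of "U _"])
qed

lemma represents_approx:
  assumes U: "represents U f"
  shows "(\<lambda>n. ip_norm ip (\<lambda>i. f i - feature (U n) i)) \<longlonglongrightarrow> 0"
proof (rule LIMSEQ_I)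
  fix \<epsilon> :: real assume \<epsilon>: "0 < \<epsilon>"
  obtain N where N: "\<And>m n. m \<ge> N \<Longrightarrow> n \<ge> N \<Longrightarrow> fnorm (U m - U n) < \<epsilon> / 2"
    using cauchyD[OF represents_cauchy[OF U] half_gt_zero[OF \<epsilon>]] by metis
  have "norm (ip_norm ip (\<lambda>i. f i - feature (U n) i) - 0) < \<epsilon>" if n: "n \<ge> N" for n
  proof -
    have lim: "(\<lambda>m. fnorm (U m - U n)) \<longlonglongrightarrow> ip_norm ip (\<lambda>i. f i - feature (U n) i)"
      by (rule ip_norm_lim[OF represents_diff[OF U represents_feature]])
    have "ip_norm ip (\<lambda>i. f i - feature (U n) i) \<le> \<epsilon> / 2"
      by (rule LIMSEQ_le_const2[OF lim]) (use N n in \<open>auto intro!: exI[of _ N] less_imp_le\<close>)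
    moreover have "0 \<le> ip_norm ip (\<lambda>i. f i - feature (U n) i)"
      using LIMSEQ_le_const[OF lim] fnorm_nonneg by simp
    ultimately show ?thesis using \<epsilon> by simp
  qed
  then show "\<exists>N. \<forall>n\<ge>N. norm (ip_norm ip (\<lambda>i. f i - feature (U n) i) - 0) < \<epsilon>" by blast
qed

text \<open>Reproducing property: evaluation at i has norm at most \<open>sqrt (k i i)\<close>, so a
  finite combination close in norm is close at all points. In this way decay passes from finite
  combinations to arbitrary vectors.\<close>

lemma approx_pointwise:
  assumes "f \<in> space" "0 < \<epsilon>"
  obtains p where "\<And>i. cmod (f i - feature p i) \<le> \<epsilon> * sqrt (k i i)"
proof -
  obtain U where U: "represents U f" using spaceE[OF assms(1)] .
  obtain N where N: "\<And>m n. m \<ge> N \<Longrightarrow> n \<ge> N \<Longrightarrow> fnorm (U m - U n) < \<epsilon>"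
    using cauchyD[OF represents_cauchy[OF U] assms(2)] by metis
  have "cmod (f i - feature (U N) i) \<le> \<epsilon> * sqrt (k i i)" for i
  proof -
    have "(\<lambda>n. cmod (form (U n) (unit i) - feature (U N) i)) \<longlonglongrightarrow> cmod (f i - feature (U N) i)"
      using U unfolding represents_def by (intro tendsto_norm tendsto_diff tendsto_const) blast
    moreover have "cmod (form (U n) (unit i) - feature (U N) i) \<le> \<epsilon> * sqrt (k i i)" if "n \<ge> N" for n
    proof -
      have "cmod (form (U n - U N) (unit i)) \<le> fnorm (U n - U N) * sqrt (k i i)"
        using form_cauchy_schwarz[of "U n - U N" "unit i"] by (simp add: fnorm_unit)
      also have "\<dots> \<le> \<epsilon> * sqrt (k i i)"
        using N[OF that order_refl] fnorm_nonneg[of "unit i"] by (intro mult_right_mono) (auto simp: fnorm_unit)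
      finally show ?thesis by (simp add: feature_def form_diff_left)
    qed
    ultimately show ?thesis by (intro LIMSEQ_le_const2) auto
  qed
  then show ?thesis using that by blast
qed

text \<open>Finite combinations within 1 / (n + 1) of f n form a Cauchy sequence for
  \<open>fnorm\<close>, and this sequence represents the limit.\<close>

lemma space_complete:
  assumes f: "\<And>n. f n \<in> space"
    and cau: "\<And>\<epsilon>. 0 < \<epsilon> \<Longrightarrow> \<exists>N. \<forall>m\<ge>N. \<forall>n\<ge>N. ip_norm ip (\<lambda>i. f m i - f n i) < \<epsilon>"
  shows "\<exists>l\<in>space. (\<lambda>n. ip_norm ip (\<lambda>i. f n i - l i)) \<longlonglongrightarrow> 0"
proof -
  have "\<exists>p. ip_norm ip (\<lambda>i. f n i - feature p i) < 1 / Suc n" for n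
  proof -
    obtain U where U: "represents U (f n)" using spaceE[OF f] .
    obtain N where "\<forall>m\<ge>N. norm (ip_norm ip (\<lambda>i. f n i - feature (U m) i) - 0) < 1 / Suc n"
      using LIMSEQ_D[OF represents_approx[OF U], of "1 / Suc n"] by auto
    then have "\<bar>ip_norm ip (\<lambda>i. f n i - feature (U N) i)\<bar> < 1 / Suc n" by simp
    then show ?thesis by (intro exI[of _ "U N"]) linarith
  qed
  then obtain p where p: "\<And>n. ip_norm ip (\<lambda>i. f n i - feature (p n) i) < 1 / Suc n" by metis
  have feat: "feature q \<in> space" for q using represents_space[OF represents_feature] .
  have diff: "(\<lambda>i. g i - h i) \<in> space" if "g \<in> space" "h \<in> space" for g h
    using that represents_diff represents_space by (metis spaceE)
  have split: "ip_norm ip (\<lambda>i. g i - h i) \<le> ip_norm ip (\<lambda>i. g i - u i) + ip_norm ip (\<lambda>i. u i - h i)"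
    if "g \<in> space" "h \<in> space" "u \<in> space" for g h u
    using ip_norm_triangle[OF diff[OF that(1,3)] diff[OF that(3,2)]] by simp
  have "cauchy p"
    unfolding cauchy_def
  proof (intro allI impI)
    fix \<epsilon> :: real assume \<epsilon>: "0 < \<epsilon>"
    obtain N where N: "\<And>m n. m \<ge> N \<Longrightarrow> n \<ge> N \<Longrightarrow> ip_norm ip (\<lambda>i. f m i - f n i) < \<epsilon> / 3"
      using cau[of "\<epsilon> / 3"] \<epsilon> by auto
    obtain M where M: "1 / real (Suc M) < \<epsilon> / 3" using nat_approx_posE[of "\<epsilon> / 3"] \<epsilon> by auto
    have small: "1 / real (Suc n) < \<epsilon> / 3" if "n \<ge> M" for n
      using M that by (meson frac_le le_less_trans of_nat_0_less_iff of_nat_mono Suc_le_mono zero_less_Suc zero_le_one order_refl)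
    have "fnorm (p m - p n) < \<epsilon>" if "m \<ge> max N M" "n \<ge> max N M" for m n
    proof -
      have "fnorm (p m - p n) = ip_norm ip (\<lambda>i. feature (p m) i - feature (p n) i)"
        using ip_norm_feature[of "p m - p n"] by (simp add: feature_def[abs_def] form_diff_left)
      also have "\<dots> \<le> ip_norm ip (\<lambda>i. feature (p m) i - f m i) + ip_norm ip (\<lambda>i. f m i - feature (p n) i)"
        by (rule split) (simp_all add: feat f)
      also have "\<dots> \<le> ip_norm ip (\<lambda>i. feature (p m) i - f m i) + (ip_norm ip (\<lambda>i. f m i - f n i) + ip_norm ip (\<lambda>i. f n i - feature (p n) i))"
        by (intro add_left_mono split) (simp_all add: feat f)
      also have "\<dots> < \<epsilon>"
        using p[of m] p[of n] small[of m] small[of n] N[of m n] that ip_norm_minus_commute[OF feat[of "p m"] f[of m]]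
        by simp
      finally show ?thesis .
    qed
    then show "\<exists>N. \<forall>m\<ge>N. \<forall>n\<ge>N. fnorm (p m - p n) < \<epsilon>" by blast
  qed
  define l where "l = (\<lambda>i. lim (\<lambda>n. form (p n) (unit i)))"
  have "represents p l"
    unfolding represents_def l_def
    using \<open>cauchy p\<close> form_convergent[OF \<open>cauchy p\<close> cauchy_const] by (simp add: convergent_LIMSEQ_iff)
  then have l: "l \<in> space" and lim: "(\<lambda>n. ip_norm ip (\<lambda>i. l i - feature (p n) i)) \<longlonglongrightarrow> 0"
    using represents_space represents_approx by blast+
  have "(\<lambda>n. 1 / real (Suc n) + ip_norm ip (\<lambda>i. l i - feature (p n) i)) \<longlonglongrightarrow> 0 + 0"
    by (intro tendsto_add lim LIMSEQ_Suc lim_1_over_n)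
  then have "(\<lambda>n. 1 / real (Suc n) + ip_norm ip (\<lambda>i. l i - feature (p n) i)) \<longlonglongrightarrow> 0" by simp
  then have "(\<lambda>n. ip_norm ip (\<lambda>i. f n i - l i)) \<longlonglongrightarrow> 0"
  proof (rule Lim_null_comparison[rotated], intro always_eventually allI)
    fix n
    obtain U where U: "represents U (\<lambda>i. f n i - l i)" using spaceE[OF diff[OF f l]] .
    have "0 \<le> ip_norm ip (\<lambda>i. f n i - l i)"
      using LIMSEQ_le_const[OF ip_norm_lim[OF U]] fnorm_nonneg by simp
    then show "norm (ip_norm ip (\<lambda>i. f n i - l i)) \<le> 1 / real (Suc n) + ip_norm ip (\<lambda>i. l i - feature (p n) i)"
      using split[OF f l feat, of n "p n"] p[of n] ip_norm_minus_commute[OF l feat[of "p n"]] by simp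
  qed
  then show ?thesis using l by blast
qed

definition hilbert :: "(complex, nat \<Rightarrow> complex) module" where
  "hilbert = \<lparr>carrier = space, mult = undefined, one = undefined, zero = (\<lambda>_. 0),
    add = (\<lambda>f g i. f i + g i), smult = (\<lambda>a f i. a * f i)\<rparr>"

lemma hilbert_simps [simp]:
  "carrier hilbert = space" "\<zero>\<^bsub>hilbert\<^esub> = (\<lambda>_. 0)"
  "f \<oplus>\<^bsub>hilbert\<^esub> g = (\<lambda>i. f i + g i)" "a \<odot>\<^bsub>hilbert\<^esub> f = (\<lambda>i. a * f i)"
  by (simp_all add: hilbert_def)

lemma space_add: "f \<in> space \<Longrightarrow> g \<in> space \<Longrightarrow> (\<lambda>i. f i + g i) \<in> space"
  using represents_add represents_space by (metis spaceE)

lemma space_smult: "f \<in> space \<Longrightarrow> (\<lambda>i. a * f i) \<in> space"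
  using represents_smult represents_space by (metis spaceE)

lemma space_zero: "(\<lambda>_. 0) \<in> space"
  using represents_space[OF represents_feature[of 0]] by (simp add: feature_def[abs_def] form_def)

lemma abelian_group_hilbert: "abelian_group hilbert"
proof (rule abelian_groupI)
  show "\<exists>g\<in>carrier hilbert. g \<oplus>\<^bsub>hilbert\<^esub> f = \<zero>\<^bsub>hilbert\<^esub>" if "f \<in> carrier hilbert" for f
    using space_smult[of f "-1"] that by (intro bexI[of _ "\<lambda>i. - 1 * f i"]) auto
qed (auto simp: space_add space_zero add_ac)

lemma hilbert_minus:
  assumes "f \<in> space" "g \<in> space"
  shows "f \<ominus>\<^bsub>hilbert\<^esub> g = (\<lambda>i. f i - g i)"
proof -
  interpret abelian_group hilbert by (rule abelian_group_hilbert)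
  have "(\<lambda>i. - g i) \<in> space" using space_smult[OF assms(2), of "-1"] by simp
  then have "\<ominus>\<^bsub>hilbert\<^esub> g = (\<lambda>i. - g i)"
    using assms by (intro minus_equality) auto
  then show ?thesis by (simp add: minus_eq)
qed

lemma module_hilbert: "module ring_of_type_algebra hilbert"
proof (rule moduleI)
  show "cring (ring_of_type_algebra :: complex ring)" by (rule cring_from_type_algebra)
qed (auto simp: abelian_group_hilbert space_smult ring_of_type_algebra_def algebra_simps)

theorem complex_hilbert_space_hilbert: "complex_hilbert_space hilbert ip"
  unfolding complex_hilbert_space_def
proof (intro conjI ballI allI impI)
  show "module ring_of_type_algebra hilbert" by (rule module_hilbert)
  show "ip (f \<oplus>\<^bsub>hilbert\<^esub> g) h = ip f h + ip g h"
    if mem: "f \<in> carrier hilbert" "g \<in> carrier hilbert" "h \<in> carrier hilbert" for f g h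
  proof -
    obtain U Y Z where XYZ: "represents U f" "represents Y g" "represents Z h" using mem[unfolded hilbert_simps] by (metis spaceE)
    then show ?thesis
      using LIMSEQ_unique[OF ip_lim[OF represents_add[OF XYZ(1,2)] XYZ(3)]]
        tendsto_add[OF ip_lim[OF XYZ(1,3)] ip_lim[OF XYZ(2,3)]]
      by (simp add: form_add_left)
  qed
  show "ip (a \<odot>\<^bsub>hilbert\<^esub> f) g = a * ip f g" if mem: "f \<in> carrier hilbert" "g \<in> carrier hilbert" for a f g
  proof -
    obtain U Y where XY: "represents U f" "represents Y g" using mem[unfolded hilbert_simps] by (metis spaceE)
    then show ?thesis
      using LIMSEQ_unique[OF ip_lim[OF represents_smult[OF XY(1)] XY(2), of a]]
        tendsto_mult_left[OF ip_lim[OF XY], of a]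
      by (simp add: form_smult_left)
  qed
  show "ip g f = cnj (ip f g)" if mem: "f \<in> carrier hilbert" "g \<in> carrier hilbert" for f g
  proof -
    obtain U Y where XY: "represents U f" "represents Y g" using mem[unfolded hilbert_simps] by (metis spaceE)
    then show ?thesis
      using LIMSEQ_unique[OF ip_lim[OF XY(2,1)]] tendsto_cnj[OF ip_lim[OF XY]]
      by (simp add: form_cnj[of "Y _" "U _"])
  qed
  show "0 < Re (ip f f)" if f: "f \<in> carrier hilbert" "f \<noteq> \<zero>\<^bsub>hilbert\<^esub>" for f
  proof -
    obtain U where U: "represents U f" using f(1) spaceE by (metis hilbert_simps(1))
    have lim: "(\<lambda>n. fnorm (U n)) \<longlonglongrightarrow> ip_norm ip f" by (rule ip_norm_lim[OF U])
    have "0 \<le> ip_norm ip f" using LIMSEQ_le_const[OF lim] fnorm_nonneg by simp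
    moreover have "ip_norm ip f \<noteq> 0"
    proof
      assume "ip_norm ip f = 0"
      then have "(\<lambda>n. form (U n) (unit i)) \<longlonglongrightarrow> 0" for i
        using form_null_left[OF _ cauchy_const] lim by simp
      moreover have "(\<lambda>n. form (U n) (unit i)) \<longlonglongrightarrow> f i" for i using U by (simp add: represents_def)
      ultimately have "f i = 0" for i by (metis LIMSEQ_unique)
      then show False using f(2) by auto
    qed
    ultimately show ?thesis by (auto simp: ip_norm_def)
  qed
  fix f :: "nat \<Rightarrow> nat \<Rightarrow> complex"
  assume f: "range f \<subseteq> carrier hilbert \<and> (\<forall>\<epsilon>>0. \<exists>N. \<forall>m\<ge>N. \<forall>n\<ge>N. ip_norm ip (f m \<ominus>\<^bsub>hilbert\<^esub> f n) < \<epsilon>)"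
  then have fs: "f n \<in> space" for n by auto
  have "\<exists>l\<in>space. (\<lambda>n. ip_norm ip (\<lambda>i. f n i - l i)) \<longlonglongrightarrow> 0"
    by (rule space_complete) (use f fs in \<open>auto simp: hilbert_minus\<close>)
  then show "\<exists>l\<in>carrier hilbert. (\<lambda>n. ip_norm ip (f n \<ominus>\<^bsub>hilbert\<^esub> l)) \<longlonglongrightarrow> 0"
    using fs by (auto simp: hilbert_minus)
qed

section \<open>Unitary operators from symmetries of the kernel\<close>

definition automorphism :: "(nat \<Rightarrow> nat) \<Rightarrow> bool" where
  "automorphism \<tau> \<longleftrightarrow> bij \<tau> \<and> (\<forall>i j. k (\<tau> i) (\<tau> j) = k i j)"

lemma automorphism_inv:
  assumes "automorphism \<tau>"
  shows "automorphism (inv_into UNIV \<tau>)"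
  unfolding automorphism_def
proof (intro conjI allI)
  show "bij (inv_into UNIV \<tau>)" using assms by (simp add: automorphism_def bij_imp_bij_inv)
  show "k (inv_into UNIV \<tau> i) (inv_into UNIV \<tau> j) = k i j" for i j
    using assms unfolding automorphism_def by (metis bij_inv_eq_iff)
qed

definition permute :: "(nat \<Rightarrow> nat) \<Rightarrow> complex poly \<Rightarrow> complex poly" where
  "permute \<tau> p = (\<Sum>i\<le>Polynomial.degree p. Polynomial.smult (Polynomial.coeff p i) (unit (\<tau> i)))"

lemma form_permute_unit:
  assumes "automorphism \<tau>"
  shows "form (permute \<tau> p) (unit (\<tau> j)) = form p (unit j)"
  using assms unfolding permute_def form_sum_left form_smult_left form_expand_left[of p]
  by (simp add: form_unit automorphism_def)

lemma form_permute:
  assumes "automorphism \<tau>"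
  shows "form (permute \<tau> p) (permute \<tau> q) = form p q"
proof -
  have "form (permute \<tau> q) (permute \<tau> p) = (\<Sum>i\<le>Polynomial.degree q. Polynomial.coeff q i * cnj (form (permute \<tau> p) (unit (\<tau> i))))"
    unfolding permute_def[of \<tau> q] form_sum_left form_smult_left form_cnj[of "unit _"] ..
  also have "\<dots> = form q p"
    by (simp add: form_permute_unit[OF assms] form_expand_left[of q] form_cnj[of "unit _" p])
  finally show ?thesis by (metis form_cnj)
qed

text \<open>Composing a function with \<tau> amounts to permuting coefficients by the inverse: the
  product of the permuted combination with the unit at i is the old product with the unit at
  \<open>\<tau> i\<close>.\<close>

lemma represents_permute:
  assumes \<tau>: "automorphism \<tau>" and U: "represents U f"
  shows "represents (\<lambda>n. permute (inv_into UNIV \<tau>) (U n)) (\<lambda>i. f (\<tau> i))"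
proof -
  note inv = automorphism_inv[OF \<tau>]
  have "fnorm (permute (inv_into UNIV \<tau>) p - permute (inv_into UNIV \<tau>) q) = fnorm (p - q)" for p q
    by (simp add: fnorm_def form_diff_left form_diff_right form_permute[OF inv])
  moreover have "form (permute (inv_into UNIV \<tau>) p) (unit i) = form p (unit (\<tau> i))" for p i
    using form_permute_unit[OF inv, of p "\<tau> i"] \<tau> by (simp add: automorphism_def bij_is_inj)
  ultimately show ?thesis using U by (simp add: represents_def cauchy_def)
qed

lemma space_permute: "automorphism \<tau> \<Longrightarrow> f \<in> space \<Longrightarrow> (\<lambda>i. f (\<tau> i)) \<in> space"
  using represents_permute represents_space by (metis spaceE)

theorem unitary_operator_permute:
  assumes \<tau>: "automorphism \<tau>"
  shows "unitary_operator hilbert ip (\<lambda>f i. f (\<tau> i))"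
  unfolding unitary_operator_def
proof (intro conjI ballI allI)
  have "bij \<tau>" using \<tau> by (simp add: automorphism_def)
  then have inv: "\<tau> (inv_into UNIV \<tau> i) = i" "inv_into UNIV \<tau> (\<tau> i) = i" for i
    by (simp_all add: bij_is_inj bij_is_surj surj_f_inv_f)
  show "bij_betw (\<lambda>f i. f (\<tau> i)) (carrier hilbert) (carrier hilbert)"
    by (rule bij_betwI[where g = "\<lambda>f i. f (inv_into UNIV \<tau> i)"])
      (use space_permute[OF \<tau>] space_permute[OF automorphism_inv[OF \<tau>]] inv in auto)
  show "ip (\<lambda>i. f (\<tau> i)) (\<lambda>i. g (\<tau> i)) = ip f g" if mem: "f \<in> carrier hilbert" "g \<in> carrier hilbert" for f g
  proof -
    obtain U Y where XY: "represents U f" "represents Y g" using mem[unfolded hilbert_simps] by (metis spaceE)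
    have "(\<lambda>n. form (permute (inv_into UNIV \<tau>) (U n)) (permute (inv_into UNIV \<tau>) (Y n))) \<longlonglongrightarrow> ip (\<lambda>i. f (\<tau> i)) (\<lambda>i. g (\<tau> i))"
      by (intro ip_lim represents_permute \<tau> XY)
    then show ?thesis
      using LIMSEQ_unique[OF ip_lim[OF XY]] by (simp add: form_permute[OF automorphism_inv[OF \<tau>]])
  qed
qed simp_all

end

section \<open>Property T against the Haagerup property\<close>

text \<open>The kernel of a direct sum: \<open>l i\<close> is the summand of the index i and
  \<open>x i\<close> its point. Different summands are orthogonal; within one summand x is
  injective, so coefficients can be carried over to points.\<close>

lemma psd_on_block_diagonal:
  fixes x :: "'i \<Rightarrow> 'a" and l :: "'i \<Rightarrow> 'm" and K :: "'m \<Rightarrow> 'a \<Rightarrow> 'a \<Rightarrow> real"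
  assumes x: "\<And>m. inj_on x {i. l i = m}" and K: "\<And>m. psd_on (range x) (K m)"
  shows "psd_on UNIV (\<lambda>i j. if l i = l j then K (l i) (x i) (x j) else 0)"
proof (rule psd_onI)
  show "(if l i = l j then K (l i) (x i) (x j) else 0) = (if l j = l i then K (l j) (x j) (x i) else 0)" for i j
    using psd_on_sym[OF K] by simp
  fix F :: "'i set" and c :: "'i \<Rightarrow> real" assume F: "finite F"
  let ?k = "\<lambda>i j. if l i = l j then K (l i) (x i) (x j) else 0"
  let ?F = "\<lambda>m. {i \<in> F. l i = m}"
  have "(\<Sum>i\<in>F. \<Sum>j\<in>F. c i * c j * ?k i j) = (\<Sum>m\<in>l ` F. \<Sum>i\<in>?F m. \<Sum>j\<in>F. c i * c j * ?k i j)"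
    using F by (subst sum.group[of F "l ` F" l]) auto
  also have "\<dots> = (\<Sum>m\<in>l ` F. \<Sum>i\<in>?F m. \<Sum>j\<in>?F m. c i * c j * K m (x i) (x j))"
    using F by (intro sum.cong refl sum.mono_neutral_cong_right) auto
  also have "0 \<le> \<dots>"
  proof (rule sum_nonneg)
    fix m
    let ?d = "\<lambda>y. c (inv_into (?F m) x y)"
    have inj: "inj_on x (?F m)" using x[of m] by (rule inj_on_subset) auto
    have "0 \<le> (\<Sum>y\<in>x ` ?F m. \<Sum>z\<in>x ` ?F m. ?d y * ?d z * K m y z)"
      using F by (intro psd_on_nonneg[OF K]) auto
    also have "\<dots> = (\<Sum>i\<in>?F m. \<Sum>j\<in>?F m. c i * c j * K m (x i) (x j))"
      using inj by (simp add: sum.reindex)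
    finally show "0 \<le> (\<Sum>i\<in>?F m. \<Sum>j\<in>?F m. c i * c j * K m (x i) (x j))" .
  qed
  finally show "0 \<le> (\<Sum>i\<in>F. \<Sum>j\<in>F. c i * c j * ?k i j)" .
qed

theorem property_T_haagerup_finite:
  assumes "group \<Gamma>" and T: "property_T \<Gamma>" and haagerup: "haagerup_property \<Gamma>"
  shows "finite (carrier \<Gamma>)"
proof (rule ccontr)
  assume inf: "infinite (carrier \<Gamma>)"
  interpret group \<Gamma> by fact
  obtain h where h_nonneg: "\<And>g. g \<in> carrier \<Gamma> \<Longrightarrow> 0 \<le> h g" and cnt: "conditionally_negative_type \<Gamma> h"
    and proper: "\<And>R. finite {g \<in> carrier \<Gamma>. h g \<le> R}"
    using haagerup unfolding haagerup_property_def by blast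
  have h_one: "h \<one>\<^bsub>\<Gamma>\<^esub> = 0" and h_inv: "\<And>g. g \<in> carrier \<Gamma> \<Longrightarrow> h (inv\<^bsub>\<Gamma>\<^esub> g) = h g"
    using cnt unfolding conditionally_negative_type_def by auto
  let ?C = "carrier \<Gamma> \<times> (UNIV :: nat set)"
  \<comment> \<open>Properness makes \<Gamma> countable, which permits the enumeration p of \<Gamma>
    \<times> \<nat>.\<close>
  have "carrier \<Gamma> = (\<Union>n::nat. {g \<in> carrier \<Gamma>. h g \<le> n})"
    by (auto simp: real_arch_simple)
  moreover have "countable (\<Union>n::nat. {g \<in> carrier \<Gamma>. h g \<le> n})"
    by (rule countable_UN) (simp_all add: countable_finite proper)
  ultimately have "countable (carrier \<Gamma>)" by (rule ssubst[where P = countable])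
  then have "countable ?C" by simp
  moreover have "infinite ?C" using inf by (auto simp: finite_cartesian_product_iff)
  ultimately have "bij_betw (from_nat_into ?C) UNIV ?C" by (rule bij_betw_from_nat_into)
  then obtain p :: "nat \<Rightarrow> _" where p: "bij_betw p UNIV ?C" by blast
  define x l where "x = (\<lambda>i. fst (p i))" and "l = (\<lambda>i. snd (p i))"
  define q where "q = inv_into UNIV p"
  have x: "x i \<in> carrier \<Gamma>" for i using bij_betwE[OF p] by (auto simp: x_def mem_Times_iff)
  have q: "x (q (g, m)) = g" "l (q (g, m)) = m" if "g \<in> carrier \<Gamma>" for g m
    using bij_betw_inv_into_right[OF p, of "(g, m)"] that by (simp_all add: x_def l_def q_def)
  have eqI: "i = j" if "x i = x j" "l i = l j" for i j
    using that p by (auto simp: x_def l_def bij_betw_def inj_on_def prod_eq_iff)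
  \<comment> \<open>\<open>Suc m\<close> avoids division by 0; the kernels approach the constant 1
    as m grows.\<close>
  define K where "K = (\<lambda>m::nat. \<lambda>y z. exp (- (1 / Suc m * h (inv\<^bsub>\<Gamma>\<^esub> y \<otimes>\<^bsub>\<Gamma>\<^esub> z))))"
  define k where "k = (\<lambda>i j. if l i = l j then K (l i) (x i) (x j) else 0)"
  interpret psd_kernel k
  proof
    have "psd_on (range x) (K m)" for m
      unfolding K_def using x
      by (intro psd_on_subset[OF conditionally_negative_type_exp[OF is_group cnt]]) auto
    moreover have "inj_on x {i. l i = m}" for m by (rule inj_onI) (use eqI in simp)
    ultimately show "psd_on UNIV k"
      unfolding k_def by (intro psd_on_block_diagonal)
  qed
  have k_refl: "k i i = 1" for i using x h_one by (simp add: k_def K_def)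
  define \<tau> where "\<tau> = (\<lambda>g i. q (g \<otimes>\<^bsub>\<Gamma>\<^esub> x i, l i))"
  have \<tau>: "x (\<tau> g i) = g \<otimes>\<^bsub>\<Gamma>\<^esub> x i" "l (\<tau> g i) = l i" if "g \<in> carrier \<Gamma>" for g i
    using that x by (simp_all add: \<tau>_def q)
  have \<tau>_mult: "\<tau> (g \<otimes>\<^bsub>\<Gamma>\<^esub> g') i = \<tau> g (\<tau> g' i)" if "g \<in> carrier \<Gamma>" "g' \<in> carrier \<Gamma>" for g g' i
    by (rule eqI) (use that x in \<open>simp_all add: \<tau> m_assoc\<close>)
  have \<tau>_one: "\<tau> \<one>\<^bsub>\<Gamma>\<^esub> i = i" for i
    by (rule eqI) (use x in \<open>simp_all add: \<tau>\<close>)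
  have K_translate: "K m (g \<otimes>\<^bsub>\<Gamma>\<^esub> y) (g \<otimes>\<^bsub>\<Gamma>\<^esub> z) = K m y z"
    if "g \<in> carrier \<Gamma>" "y \<in> carrier \<Gamma>" "z \<in> carrier \<Gamma>" for m g y z
  proof -
    have "inv\<^bsub>\<Gamma>\<^esub> g \<otimes>\<^bsub>\<Gamma>\<^esub> (g \<otimes>\<^bsub>\<Gamma>\<^esub> z) = z" using that by (simp flip: m_assoc)
    then have "inv\<^bsub>\<Gamma>\<^esub> (g \<otimes>\<^bsub>\<Gamma>\<^esub> y) \<otimes>\<^bsub>\<Gamma>\<^esub> (g \<otimes>\<^bsub>\<Gamma>\<^esub> z) = inv\<^bsub>\<Gamma>\<^esub> y \<otimes>\<^bsub>\<Gamma>\<^esub> z"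
      using that by (simp add: inv_mult_group m_assoc)
    then show ?thesis by (simp add: K_def)
  qed
  have auto: "automorphism (\<tau> g)" if g: "g \<in> carrier \<Gamma>" for g
    unfolding automorphism_def
  proof (intro conjI allI)
    have "\<tau> g (\<tau> (inv\<^bsub>\<Gamma>\<^esub> g) i) = i" "\<tau> (inv\<^bsub>\<Gamma>\<^esub> g) (\<tau> g i) = i" for i
      using g by (simp_all add: \<tau>_one flip: \<tau>_mult)
    then show "bij (\<tau> g)" by (intro bij_betw_byWitness[where f' = "\<tau> (inv\<^bsub>\<Gamma>\<^esub> g)"]) auto
    show "k (\<tau> g i) (\<tau> g j) = k i j" for i j
      using g x by (simp add: k_def \<tau> K_translate)
  qed
  \<comment> \<open>Composition reverses the order of products, which the inverse restores.\<close>
  define \<pi> where "\<pi> = (\<lambda>g f i. f (\<tau> (inv\<^bsub>\<Gamma>\<^esub> g) i) :: complex)"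
  have "unitary_representation \<Gamma> hilbert ip \<pi>"
    unfolding unitary_representation_def
  proof (intro conjI ballI)
    show "unitary_operator hilbert ip (\<pi> g)" if "g \<in> carrier \<Gamma>" for g
      unfolding \<pi>_def using that by (intro unitary_operator_permute auto) simp
    show "\<pi> (g \<otimes>\<^bsub>\<Gamma>\<^esub> g') v = \<pi> g (\<pi> g' v)" if "g \<in> carrier \<Gamma>" "g' \<in> carrier \<Gamma>" for g g' v
      using that by (simp add: \<pi>_def inv_mult_group \<tau>_mult)
  qed (simp_all add: complex_hilbert_space_hilbert \<pi>_def \<tau>_one)
  moreover have "almost_invariant_unit_vectors \<Gamma> hilbert ip \<pi>"
    unfolding almost_invariant_unit_vectors_def
  proof (intro allI impI)
    fix Q and \<epsilon> :: real assume Q: "finite Q \<and> Q \<subseteq> carrier \<Gamma> \<and> 0 < \<epsilon>"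
    \<comment> \<open>The square root is the displacement by g of the unit vector at (\<one>, m), as
      computed below.\<close>
    have "(\<lambda>m. sqrt (2 - 2 * exp (- (1 / real (Suc m) * h g)))) \<longlonglongrightarrow> sqrt (2 - 2 * exp (- (0 * h g)))" for g
      by (intro tendsto_intros LIMSEQ_Suc lim_1_over_n)
    then have "\<forall>\<^sub>F m in sequentially. sqrt (2 - 2 * exp (- (1 / real (Suc m) * h g))) < \<epsilon>" for g
      using order_tendstoD(2)[of _ "sqrt (2 - 2 * exp (- (0 * h g)))" sequentially \<epsilon>] Q by simp
    then have "\<forall>\<^sub>F m in sequentially. \<forall>g\<in>Q. sqrt (2 - 2 * exp (- (1 / real (Suc m) * h g))) < \<epsilon>"
      using Q by (intro eventually_ball_finite) auto
    then obtain m where m: "\<And>g. g \<in> Q \<Longrightarrow> sqrt (2 - 2 * exp (- (1 / real (Suc m) * h g))) < \<epsilon>"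
      unfolding eventually_sequentially by blast
    define i where "i = q (\<one>\<^bsub>\<Gamma>\<^esub>, m)"
    have i: "x i = \<one>\<^bsub>\<Gamma>\<^esub>" "l i = m" by (simp_all add: i_def q)
    define v where "v = feature (unit i)"
    have v: "v \<in> space" unfolding v_def by (rule represents_space[OF represents_feature])
    have "ip_norm ip (\<pi> g v \<ominus>\<^bsub>hilbert\<^esub> v) < \<epsilon>" if g: "g \<in> Q" for g
    proof -
      have gC: "g \<in> carrier \<Gamma>" using g Q by blast
      \<comment> \<open>Translating both arguments by g shows that \<open>\<pi> g\<close> carries
        the feature of the unit at i to that of the unit at \<open>\<tau> g i\<close>.\<close>
      have "k i (\<tau> (inv\<^bsub>\<Gamma>\<^esub> g) j) = k (\<tau> g i) j" for j
      proof -
        have "k i (\<tau> (inv\<^bsub>\<Gamma>\<^esub> g) j) = k (\<tau> g i) (\<tau> g (\<tau> (inv\<^bsub>\<Gamma>\<^esub> g) j))"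
          using auto[OF gC] by (simp add: automorphism_def)
        then show ?thesis using gC by (simp add: \<tau>_one flip: \<tau>_mult)
      qed
      then have \<pi>v: "\<pi> g v = feature (unit (\<tau> g i))"
        by (simp add: \<pi>_def v_def feature_def[abs_def] form_unit)
      then have "\<pi> g v \<ominus>\<^bsub>hilbert\<^esub> v = feature (unit (\<tau> g i) - unit i)"
        using v represents_space[OF represents_feature]
        by (simp add: hilbert_minus) (simp add: v_def feature_def[abs_def] form_diff_left)
      then have "ip_norm ip (\<pi> g v \<ominus>\<^bsub>hilbert\<^esub> v) = fnorm (unit (\<tau> g i) - unit i)"
        by (simp add: ip_norm_feature)
      also have "\<dots> = sqrt (2 - 2 * k (\<tau> g i) i)"
        by (simp add: fnorm_def form_diff_left form_diff_right form_unit k_refl k_sym[of i])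
      also have "k (\<tau> g i) i = exp (- (1 / real (Suc m) * h g))"
        using gC i by (simp add: k_def K_def \<tau> h_inv)
      finally show ?thesis using m[OF g] by simp
    qed
    moreover have "ip_norm ip v = 1" by (simp add: v_def ip_norm_feature fnorm_unit k_refl)
    ultimately show "\<exists>v\<in>carrier hilbert. ip_norm ip v = 1 \<and> (\<forall>g\<in>Q. ip_norm ip (\<pi> g v \<ominus>\<^bsub>hilbert\<^esub> v) < \<epsilon>)"
      using v by auto
  qed
  ultimately have "\<exists>v\<in>carrier hilbert. v \<noteq> \<zero>\<^bsub>hilbert\<^esub> \<and> (\<forall>g\<in>carrier \<Gamma>. \<pi> g v = v)"
    using T[unfolded property_T_def, rule_format, of hilbert ip \<pi>] by simp
  then obtain v where v: "v \<in> space" "v \<noteq> (\<lambda>_. 0)" and fixed: "\<And>g. g \<in> carrier \<Gamma> \<Longrightarrow> \<pi> g v = v"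
    by auto
  have v_\<tau>: "v (\<tau> g i) = v i" if "g \<in> carrier \<Gamma>" for g i
    using fun_cong[OF fixed[of "inv\<^bsub>\<Gamma>\<^esub> g"], of i] that by (simp add: \<pi>_def)
  text \<open>Matrix coefficients tend to 0 at infinity, so an invariant vector is 0.\<close>
  have "v i = 0" for i
  proof (rule ccontr)
    assume "v i \<noteq> 0"
    then have \<epsilon>: "0 < cmod (v i) / 2" by simp
    then obtain r where r: "\<And>j. cmod (v j - feature r j) \<le> cmod (v i) / 2 * sqrt (k j j)"
      using approx_pointwise[OF v(1)] by blast
    define b where "b = (\<Sum>j\<le>Polynomial.degree r. cmod (Polynomial.coeff r j))"
    have b: "0 \<le> b" by (simp add: b_def sum_nonneg)
    \<comment> \<open>The divisor b + 1 is positive even for r = 0, and b * \<eta> is then at most a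
      quarter of \<open>cmod (v i)\<close>.\<close>
    define \<eta> where "\<eta> = cmod (v i) / 4 / (b + 1)"
    have \<eta>0: "0 < \<eta>" using \<epsilon> b by (simp add: \<eta>_def)
    have "b + 1 \<noteq> 0" using b by linarith
    then have "(b + 1) * \<eta> = cmod (v i) / 4" 
      unfolding \<eta>_def by (metis nonzero_mult_div_cancel_left times_divide_eq_right)
    then have \<eta>: "0 < \<eta>" "b * \<eta> < cmod (v i) / 2"
      using \<eta>0 \<epsilon> unfolding distrib_right by linarith+
    \<comment> \<open>A kernel value of at least \<eta> bounds h at
      \<open>inv (x j) \<otimes> (g \<otimes> x i)\<close>; properness of h and injectivity in g
      leave finitely many g.\<close>
    have "finite {g \<in> carrier \<Gamma>. \<eta> \<le> k j (\<tau> g i)}" for j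
    proof -
      let ?\<phi> = "\<lambda>g. inv\<^bsub>\<Gamma>\<^esub> (x j) \<otimes>\<^bsub>\<Gamma>\<^esub> (g \<otimes>\<^bsub>\<Gamma>\<^esub> x i)"
      have "inj_on ?\<phi> (carrier \<Gamma>)" using x by (auto intro!: inj_onI)
      then have fin: "finite (?\<phi> -` {g \<in> carrier \<Gamma>. h g \<le> - ln \<eta> * Suc (l j)} \<inter> carrier \<Gamma>)"
        by (rule finite_vimage_IntI[OF proper])
      have "h (?\<phi> g) \<le> - ln \<eta> * Suc (l j)" if g: "g \<in> carrier \<Gamma>" "\<eta> \<le> k j (\<tau> g i)" for g
      proof -
        have "\<eta> \<le> exp (- (1 / Suc (l j) * h (?\<phi> g)))"
          using g \<eta>(1) by (simp add: k_def K_def \<tau> split: if_splits)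
        then have "ln \<eta> \<le> - (h (?\<phi> g) / Suc (l j))"
          using \<eta>(1) by (simp add: ln_le_cancel_iff[symmetric] del: ln_le_cancel_iff)
        then have "h (?\<phi> g) / Suc (l j) \<le> - ln \<eta>" by linarith
        then show ?thesis by (subst (asm) pos_divide_le_eq) simp_all
      qed
      then show ?thesis using x by (intro finite_subset[OF _ fin]) auto
    qed
    then have "finite (\<Union>j\<le>Polynomial.degree r. {g \<in> carrier \<Gamma>. \<eta> \<le> k j (\<tau> g i)})" by simp
    \<comment> \<open>Since \<Gamma> is infinite, some g avoids these finite sets. It moves i to an
      index where the approximant is small, while the invariant v keeps its value.\<close>
    then have "\<not> carrier \<Gamma> \<subseteq> (\<Union>j\<le>Polynomial.degree r. {g \<in> carrier \<Gamma>. \<eta> \<le> k j (\<tau> g i)})"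
      using inf finite_subset by blast
    then obtain g where "g \<in> carrier \<Gamma>" "g \<notin> (\<Union>j\<le>Polynomial.degree r. {g \<in> carrier \<Gamma>. \<eta> \<le> k j (\<tau> g i)})"
      by blast
    then have g: "g \<in> carrier \<Gamma>" "\<And>j. j \<le> Polynomial.degree r \<Longrightarrow> k j (\<tau> g i) < \<eta>"
      by (auto simp: not_le)
    have k_nonneg: "0 \<le> k j j'" for j j' by (simp add: k_def K_def)
    have "cmod (feature r (\<tau> g i)) \<le> (\<Sum>j\<le>Polynomial.degree r. cmod (Polynomial.coeff r j) * \<eta>)"
      unfolding feature_def form_expand_left[of r]
      by (rule sum_norm_le) (use g k_nonneg in \<open>auto simp: form_unit norm_mult intro!: mult_left_mono less_imp_le[OF g(2)]\<close>)
    then have "cmod (feature r (\<tau> g i)) < cmod (v i) / 2"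
      using \<eta>(2) unfolding b_def sum_distrib_right by linarith
    moreover have "cmod (v i - feature r (\<tau> g i)) \<le> cmod (v i) / 2"
      using r[of "\<tau> g i"] v_\<tau>[OF g(1)] by (simp add: k_refl)
    ultimately show False
      using norm_triangle_sub[of "v i" "feature r (\<tau> g i)"] by linarith
  qed
  then show False using v(2) by auto
qed

text \<open>The inverse of e is continuous on the compact image, so multiplication transported to
  the image is continuous on a compact square, hence uniformly continuous.\<close>

lemma spherical_group_if_compact_lie_group:
  fixes G :: "'g monoid" and e :: "'g \<Rightarrow> 'e::euclidean_space"
  assumes lie: "compact_lie_group G T V \<A>" and emb: "smooth_embedding T V \<A> e"
    and sphere: "e ` carrier G \<subseteq> sphere 0 1"
  shows "spherical_group G e"
proof -
  have grp: "group G" and top: "topspace T = carrier G"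
    and mult: "continuous_map (prod_topology T T) T (\<lambda>(x, y). x \<otimes>\<^bsub>G\<^esub> y)" and compact: "compact_space T"
    using lie by (auto simp: compact_lie_group_def lie_group_def smooth_map_def)
  interpret group G by fact
  let ?K = "e ` carrier G" and ?f = "inv_into (carrier G) e"
  have hom: "homeomorphic_map T (top_of_set ?K) e"
    using emb by (simp add: smooth_embedding_def embedding_map_def top)
  then have cont: "continuous_map T (top_of_set ?K) e" and inj: "inj_on e (carrier G)"
    by (auto simp: homeomorphic_imp_continuous_map homeomorphic_imp_injective_map top[symmetric])
  have "compactin (top_of_set ?K) (e ` topspace T)"
    using image_compactin[OF _ cont] compact by (simp add: compact_space_def)
  then have cK: "compact ?K" by (simp add: top compactin_subtopology)
  obtain f where f: "homeomorphic_maps T (top_of_set ?K) e f"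
    using hom by (auto simp: homeomorphic_map_maps)
  then have f_cont: "continuous_map (top_of_set ?K) T f" and fe: "\<And>x. x \<in> carrier G \<Longrightarrow> f (e x) = x"
    by (auto simp: homeomorphic_maps_def top)
  define \<mu> where "\<mu> = (\<lambda>p. e (f (fst p) \<otimes>\<^bsub>G\<^esub> f (snd p)))"
  have "continuous_map (top_of_set (?K \<times> ?K)) (prod_topology T T) (\<lambda>p. (f (fst p), f (snd p)))"
  proof (rule continuous_map_pairedI)
    have *: "continuous_map (top_of_set (?K \<times> ?K)) (top_of_set ?K) fst"
      "continuous_map (top_of_set (?K \<times> ?K)) (top_of_set ?K) snd"
      by (auto simp: continuous_map_in_subtopology intro!: continuous_intros)
    show "continuous_map (top_of_set (?K \<times> ?K)) T (\<lambda>p. f (fst p))"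
      "continuous_map (top_of_set (?K \<times> ?K)) T (\<lambda>p. f (snd p))"
      using continuous_map_compose[OF *(1) f_cont] continuous_map_compose[OF *(2) f_cont] by (simp_all add: o_def)
  qed
  from continuous_map_compose[OF continuous_map_compose[OF this mult] cont]
  have "continuous_map (top_of_set (?K \<times> ?K)) (top_of_set ?K) \<mu>"
    by (simp add: o_def \<mu>_def case_prod_unfold)
  then have "continuous_on (?K \<times> ?K) \<mu>"
    by (simp add: continuous_map_in_subtopology)
  then have unif: "uniformly_continuous_on (?K \<times> ?K) \<mu>"
    using cK by (intro compact_uniformly_continuous compact_Times)
  show ?thesis
  proof (intro spherical_group.intro spherical_group_axioms.intro)
    fix \<epsilon> :: real assume "0 < \<epsilon>"
    then obtain \<delta> where \<delta>: "0 < \<delta>"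
      "\<And>p q. p \<in> ?K \<times> ?K \<Longrightarrow> q \<in> ?K \<times> ?K \<Longrightarrow> dist q p < \<delta> \<Longrightarrow> dist (\<mu> q) (\<mu> p) < \<epsilon>"
      using unif unfolding uniformly_continuous_on_def by metis
    show "\<exists>\<delta>>0. \<forall>x\<in>carrier G. \<forall>x'\<in>carrier G. \<forall>y\<in>carrier G. \<forall>y'\<in>carrier G.
        dist (e x) (e x') < \<delta> \<longrightarrow> dist (e y) (e y') < \<delta> \<longrightarrow> dist (e (x \<otimes>\<^bsub>G\<^esub> y)) (e (x' \<otimes>\<^bsub>G\<^esub> y')) < \<epsilon>"
    proof (intro exI[of _ "\<delta> / 2"] conjI ballI impI)
      fix x x' y y' assume mem: "x \<in> carrier G" "x' \<in> carrier G" "y \<in> carrier G" "y' \<in> carrier G"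
        and d: "dist (e x) (e x') < \<delta> / 2" "dist (e y) (e y') < \<delta> / 2"
      have "dist (e x, e y) (e x', e y') \<le> dist (e x) (e x') + dist (e y) (e y')"
        unfolding dist_Pair_Pair by (rule sqrt_sum_squares_le_sum) auto
      then have "dist (\<mu> (e x, e y)) (\<mu> (e x', e y')) < \<epsilon>"
        using d mem by (intro \<delta>(2)) auto
      then show "dist (e (x \<otimes>\<^bsub>G\<^esub> y)) (e (x' \<otimes>\<^bsub>G\<^esub> y')) < \<epsilon>"
        using mem fe by (simp add: \<mu>_def)
    qed (use \<delta>(1) in simp)
  qed (use grp sphere inj cK in auto)
qed

theorem proposition4p4:
  fixes G :: "'g monoid"
    and T :: "'g topology"
    and V :: "'m::euclidean_space set"
    and \<A> :: "('g, 'm) chart set"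
    and \<Gamma> S :: "'g set"
    and e :: "'g \<Rightarrow> 'e::euclidean_space"
  assumes "compact_lie_group G T V \<A>"
    and "subgroup \<Gamma> G"
    and "T closure_of \<Gamma> = topspace T"
    and "finite S" and "S \<subseteq> \<Gamma>" and "generate G S = \<Gamma>"
    and "smooth_embedding T V \<A> e" and "e ` carrier G \<subseteq> sphere 0 1"
  shows
    "(uniformly_embeddable TYPE('h::{real_inner, complete_space})
        (open_cone e (carrier G)) (warped_cone_dist G e S)
      \<longrightarrow> haagerup_property (G\<lparr>carrier := \<Gamma>\<rparr>)) \<and>
     (infinite \<Gamma> \<and> property_T (G\<lparr>carrier := \<Gamma>\<rparr>)
      \<longrightarrow> \<not> uniformly_embeddable TYPE('h)
            (open_cone e (carrier G)) (warped_cone_dist G e S))"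
proof -
  interpret spherical_group G e
    using spherical_group_if_compact_lie_group assms by blast
  interpret spherical_warped_cone G e S
    by unfold_locales (use assms subgroup.subset in blast)+
  have haagerup: "haagerup_property (G\<lparr>carrier := \<Gamma>\<rparr>)"
    if "uniformly_embeddable TYPE('h) (open_cone e (carrier G)) (warped_cone_dist G e S)"
    using haagerup_if_embeddable[OF that] assms(6) by simp
  have "group (G\<lparr>carrier := \<Gamma>\<rparr>)" using subgroup_imp_group[OF assms(2)] .
  then show ?thesis
    using haagerup property_T_haagerup_finite[of "G\<lparr>carrier := \<Gamma>\<rparr>"] by auto
qed

end
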